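(* Let $0\le\alpha<n$, let $\delta:\mathbb{R}^n\to(0,n)$, let $p(\cdot),q(\cdot),r(\cdot)\in\mathcal{P}^{\log}(\mathbb{R}^n)$ and let $\beta\in(1,p_-)$ satisfy: (i) $\delta_->0$, $(r(\alpha+\delta))_+<n$ and $r_\infty\,(\alpha+\delta(\cdot))_+<n$; (ii) $p(x)\ge p_\infty$ for a.e. $x\in\mathbb{R}^n$, and $\frac1\beta+\frac{1}{(p')_+}>1$; (iii) $\frac1\beta-\frac{1}{p(x)}=\frac{\delta(x)}{n}=\frac{1}{r(x)}-\frac{\alpha}{n}-\frac{1}{q(x)}$ for $x\in\mathbb{R}^n$. Let $b$ be a real-valued locally integrable function on $\mathbb{R}^n$. Then $b\in\mathbb{L}(\delta(\cdot))$ and $b\ge0$ if and only if the commutator $[b,\mathcal{M}_\alpha]$ is bounded from $L^{r(\cdot)}(\mathbb{R}^n)$ to $L^{q(\cdot)}(\mathbb{R}^n)$.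
   Context: For a real function $g$ on $\mathbb{R}^n$ put $g_-:=\inf_{x\in\mathbb{R}^n}g(x)$ and $g_+:=\sup_{x\in\mathbb{R}^n}g(x)$; e.g. $(r(\alpha+\delta))_+=\sup_x r(x)(\alpha+\delta(x))$. $\mathcal{P}(\mathbb{R}^n)$ is the set of measurable $p(\cdot):\mathbb{R}^n\to(1,\infty)$ with $1<p_-\le p_+<\infty$. The conjugate exponent $p'(\cdot)$ is defined by $1/p(\cdot)+1/p'(\cdot)=1$. $\mathcal{P}^{\log}(\mathbb{R}^n)$ is the set of $p(\cdot)\in\mathcal{P}(\mathbb{R}^n)$ for which there exist $C_{\log}(p),C_\infty\in(0,\infty)$ and $p_\infty\in\mathbb{R}$ with $|p(x)-p(y)|\le \frac{C_{\log}(p)}{\ln(e+1/|x-y|)}$ and $|p(x)-p_\infty|\le\frac{C_\infty}{\ln(e+|x|)}$ for all $x,y\in\mathbb{R}^n$. Thus $p_\infty=\lim_{|x|\to\infty}p(x)$, and similarly for $r_\infty$. For $p(\cdot)\in\mathcal{P}(\mathbb{R}^n)$, $L^{p(\cdot)}(\mathbb{R}^n)$ is the space of measurable $f$ with $\int_{\mathbb{R}^n}(|f(x)|/\lambda)^{p(x)}dx<\infty$ for some $\lambda>0$, with norm $\|f\|_{L^{p(\cdot)}(\mathbb{R}^n)}=\inf\{\lambda>0:\int_{\mathbb{R}^n}(|f(x)|/\lambda)^{p(x)}dx\le1\}$. Variable Lipschitz space: $b\in\mathbb{L}(\delta(\cdot))$ if there is a constant $C$ with $|b(x)-b(y)|\le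 C|x-y|^{\delta(x)}$ for all $x,y\in\mathbb{R}^n$. Functions equal almost everywhere are identified (so $b\in\mathbb{L}(\delta(\cdot))$ and $b\ge0$ are understood after possibly changing $b$ on a null set). Cubes $Q\subset\mathbb{R}^n$ have sides parallel to the coordinate axes and $|Q|$ is Lebesgue measure. The fractional maximal function is $\mathcal{M}_\alpha f(x):=\sup_{Q\ni x}\frac{1}{|Q|^{1-\alpha/n}}\int_Q|f(y)|\,dy$, the supremum being over all cubes containing $x$. The (nonlinear) commutator is $[b,\mathcal{M}_\alpha](f)(x):=b(x)\mathcal{M}_\alpha(f)(x)-\mathcal{M}_\alpha(bf)(x)$. An operator $T$ (possibly nonlinear) is bounded from $L^{r(\cdot)}(\mathbb{R}^n)$ to $L^{q(\cdot)}(\mathbb{R}^n)$ if there is a constant $C$ such that, for all $f\in L^{r(\cdot)}(\mathbb{R}^n)$, $Tf$ is well defined a.e. and $\|Tf\|_{L^{q(\cdot)}(\mathbb{R}^n)}\le C\|f\|_{L^{r(\cdot)}(\mathbb{R}^n)}$. *)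

theory Defs
  imports "HOL-Analysis.Analysis"
begin

text \<open>Space dimension is \<open>n = CARD('n)\<close>. For a function \<open>g\<close>, the numbers \<open>g\<^sub>-\<close> and \<open>g\<^sub>+\<close>
  are written \<open>INF x. g x\<close> and \<open>SUP x. g x\<close>; these are real infima and suprema, hence meaningful
  only when \<open>g\<close> is bounded on the relevant side.\<close>

definition var_exponent :: "(real^'n \<Rightarrow> real) set" where
  "var_exponent = {p. p \<in> borel_measurable lebesgue \<and> (\<forall>x. 1 < p x) \<and>
     1 < (INF x. p x) \<and> bdd_above (range p)}"

text \<open>For \<open>x = y\<close> the first bound is trivially true (\<open>1 / 0 = 0\<close> in HOL).\<close>

definition log_exponent :: "(real^'n \<Rightarrow> real) set" where
  "log_exponent = {p \<in> var_exponent. \<exists>Clog>0. \<exists>Cinf>0. \<exists>l.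
     (\<forall>x y. \<bar>p x - p y\<bar> \<le> Clog / ln (exp 1 + 1 / norm (x - y))) \<and>
     (\<forall>x. \<bar>p x - l\<bar> \<le> Cinf / ln (exp 1 + norm x))}"

definition limit_exponent :: "(real^'n \<Rightarrow> real) \<Rightarrow> real" where
  "limit_exponent p = Lim at_infinity p"

definition conj_exponent :: "(real^'n \<Rightarrow> real) \<Rightarrow> real^'n \<Rightarrow> real" where
  "conj_exponent p x = p x / (p x - 1)"

lemma conj_exponent_eq:
  assumes "1 < p x"
  shows "1 / p x + 1 / conj_exponent p x = 1"
  using assms by (simp add: conj_exponent_def field_simps)

definition modular :: "(real^'n \<Rightarrow> real) \<Rightarrow> (real^'n \<Rightarrow> real) \<Rightarrow> ennreal" where
  "modular p f = (\<integral>\<^sup>+ x. ennreal (\<bar>f x\<bar> powr p x) \<partial>lebesgue)"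

definition var_Lp :: "(real^'n \<Rightarrow> real) \<Rightarrow> (real^'n \<Rightarrow> real) set" where
  "var_Lp p = {f \<in> borel_measurable lebesgue. \<exists>t>0. modular p (\<lambda>x. f x / t) < \<infinity>}"

definition var_Lp_norm :: "(real^'n \<Rightarrow> real) \<Rightarrow> (real^'n \<Rightarrow> real) \<Rightarrow> real" where
  "var_Lp_norm p f = Inf {t. 0 < t \<and> modular p (\<lambda>x. f x / t) \<le> 1}"

definition var_Lipschitz :: "(real^'n \<Rightarrow> real) \<Rightarrow> (real^'n \<Rightarrow> real) set" where
  "var_Lipschitz \<delta> = {b. \<exists>C. \<forall>x y. \<bar>b x - b y\<bar> \<le> C * norm (x - y) powr \<delta> x}"

definition locally_integrable :: "(real^'n \<Rightarrow> real) \<Rightarrow> bool" where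
  "locally_integrable b \<longleftrightarrow> (\<forall>K. compact K \<longrightarrow> b absolutely_integrable_on K)"

definition cubes :: "(real^'n) set set" where
  "cubes = {cbox a (\<chi> i. a $ i + l) | a l. 0 < l}"

text \<open>The fractional maximal function takes values in \<open>[0, \<infinity>]\<close>.\<close>

definition frac_maximal :: "real \<Rightarrow> (real^'n \<Rightarrow> real) \<Rightarrow> real^'n \<Rightarrow> ennreal" where
  "frac_maximal \<alpha> f x = (SUP Q \<in> {Q \<in> cubes. x \<in> Q}.
     (\<integral>\<^sup>+ y \<in> Q. ennreal \<bar>f y\<bar> \<partial>lebesgue)
       / ennreal (measure lebesgue Q powr (1 - \<alpha> / real CARD('n))))"

text \<open>The commutator is a partial function: its value at a point is defined when both
  maximal functions are finite there, so that the difference is a real number.\<close>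

definition commutator ::
    "(real^'n \<Rightarrow> real) \<Rightarrow> real \<Rightarrow> (real^'n \<Rightarrow> real) \<Rightarrow> real^'n \<rightharpoonup> real" where
  "commutator b \<alpha> f x =
     (if frac_maximal \<alpha> f x < \<infinity> \<and> frac_maximal \<alpha> (\<lambda>y. b y * f y) x < \<infinity>
      then Some (b x * enn2real (frac_maximal \<alpha> f x)
                 - enn2real (frac_maximal \<alpha> (\<lambda>y. b y * f y) x))
      else None)"

text \<open>The function \<open>g\<close> below represents \<open>T f\<close>, which need only be defined almost everywhere.
  Membership of \<open>g\<close> in the target space is required explicitly, because
  \<open>var_Lp_norm\<close> is meaningful only for members.\<close>

definition bounded_operator ::
    "(real^'n \<Rightarrow> real) \<Rightarrow> (real^'n \<Rightarrow> real) \<Rightarrow> ((real^'n \<Rightarrow> real) \<Rightarrow> real^'n \<rightharpoonup> real) \<Rightarrow> bool" where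
  "bounded_operator r q T \<longleftrightarrow> (\<exists>C. \<forall>f \<in> var_Lp r. \<exists>g \<in> var_Lp q.
     (AE x in lebesgue. T f x = Some (g x)) \<and> var_Lp_norm q g \<le> C * var_Lp_norm r f)"

end

theory Submission
  imports Defs
begin

text \<open>
  For nonnegative \<open>b\<close> in the variable Lipschitz space the commutator is dominated pointwise by the
  fractional maximal function of variable order \<open>\<alpha> + \<delta> x\<close>. If the modular of \<open>f\<close> is at most 1, a mean
  \<open>A\<close> of \<open>\<bar>f\<bar>\<close> over a cube \<open>Q\<close> around \<open>x\<close> is at most a constant times \<open>\<bar>Q\<bar> powr (- 1 / r x)\<close> (small cubes)
  or \<open>\<bar>Q\<bar> powr (- 1 / L)\<close> with \<open>L\<close> the limit of \<open>r\<close> (large cubes). Trading \<open>\<bar>Q\<bar>\<close> for \<open>A\<close> as Hedberg does bounds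
  the \<open>q x\<close>-th power of the fractional mean by \<open>A powr r x\<close> plus an integrable term, and the latter is
  controlled by the Hardy-Littlewood maximal theorem for the exponent \<open>INF x. r x\<close>, since
  log-Hoelder continuity lets \<open>A powr (r x / s)\<close> be compared with the mean of \<open>\<bar>f y\<bar> powr (r y / s)\<close>.

  Conversely, testing the commutator on the indicator of \<open>Q\<close>, whose fractional maximal function is
  \<open>\<bar>Q\<bar> powr (\<alpha> / n)\<close> on \<open>Q\<close>, shows that the mean of \<open>\<bar>b\<bar>\<close> exceeds \<open>b\<close> on \<open>Q\<close> by at most the commutator divided by
  \<open>\<bar>Q\<bar> powr (\<alpha> / n)\<close>. Averaging bounds both the mean oscillation of \<open>b\<close> and the gap between the means
  of \<open>\<bar>b\<bar>\<close> and \<open>b\<close> by a multiple of \<open>l powr \<delta> x\<close>, \<open>l\<close> the side length of \<open>Q\<close> (for \<open>l > 1\<close> the exponent is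
  the limit of \<open>\<delta>\<close>, which is at most \<open>\<delta> x\<close>). The first bound gives the Lipschitz estimate by
  Campanato's argument, the second one nonnegativity.
\<close>


text \<open>The obstacle is that \<open>r y\<close> has to be replaced by \<open>r x\<close> inside
  an integral before a mean can be raised to the power \<open>r x\<close>. Log-Hoelder continuity
  makes this replacement cost only a constant when the base lies between a negative power of e + |x|
  and 1/|Q|. The normalisation of the modular supplies the upper restriction. Below the lower one
  the integrable function \<open>decay m\<close>, with m = n + 2, is added as an error term. The
  maximal theorem is applied to |f|^(r/s), whose s-th power |f|^r has integral at most 1; the
  exponent r/s is at least 1 because s is the infimum of r. The hypothesis on r_infinity times the
  supremum of \<alpha> + \<delta> leaves a margin \<theta> in Hedberg's exponent on large cubes, and
  this margin lets very small means be absorbed by the decay. For necessity, (iii) passes to the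
  limit at infinity, so the norms of cube indicators produce the side length to the power
  \<delta>(x), or to its limit d on large cubes. The inequality d \<le> \<delta>(x) comes from p
  \<ge> p_infinity, upgraded from almost everywhere to everywhere by continuity.\<close>

section \<open>Cubes and countable families of sets\<close>

definition cube :: "real^'n \<Rightarrow> real \<Rightarrow> (real^'n) set" where
  "cube a l = cbox a (\<chi> i. a $ i + l)"

lemma cubes_eq: "cubes = {cube a l | a l. 0 < l}"
  by (simp add: cubes_def cube_def)

lemma mem_cube: "x \<in> cube a l \<longleftrightarrow> (\<forall>i. a $ i \<le> x $ i \<and> x $ i \<le> a $ i + l)"
  by (simp add: cube_def mem_box_cart)

lemma sets_cube [measurable, simp]: "cube a l \<in> sets lebesgue" "cube a l \<in> sets borel"
  by (simp_all add: cube_def)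

lemma compact_cube: "compact (cube a l)"
  by (simp add: cube_def)

lemma content_cube: "0 < l \<Longrightarrow> measure lborel (cube (a :: real^'n) l) = l ^ CARD('n)"
  by (simp add: cube_def content_cbox_if_cart interval_eq_empty_cart not_less)

lemma emeasure_lborel_cube: "0 < l \<Longrightarrow> emeasure lborel (cube (a :: real^'n) l) = ennreal (l ^ CARD('n))"
  by (subst emeasure_eq_ennreal_measure) (simp_all add: content_cube, simp add: cube_def emeasure_lborel_cbox_eq)

lemma emeasure_cube: "0 < l \<Longrightarrow> emeasure lebesgue (cube (a :: real^'n) l) = ennreal (l ^ CARD('n))"
  by (simp add: emeasure_lborel_cube)

lemma norm_cube:
  fixes x y :: "real^'n"
  assumes "x \<in> cube a l" "y \<in> cube a l"
  shows "norm (x - y) \<le> real CARD('n) * l"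
proof -
  have "norm (x - y) \<le> (\<Sum>i\<in>UNIV. \<bar>(x - y) $ i\<bar>)" by (rule norm_le_l1_cart)
  also have "\<dots> \<le> (\<Sum>i\<in>(UNIV::'n set). l)"
  proof (rule sum_mono)
    fix i
    have "a $ i \<le> x $ i" "x $ i \<le> a $ i + l" "a $ i \<le> y $ i" "y $ i \<le> a $ i + l"
      using assms by (auto simp: mem_cube)
    then show "\<bar>(x - y) $ i\<bar> \<le> l" by (simp add: abs_le_iff)
  qed
  finally show ?thesis by simp
qed

lemma corner_in_cube: "0 \<le> l \<Longrightarrow> a \<in> cube a l"
  by (simp add: mem_cube)

text \<open>The indicator of a union is at most the sum of the indicators; then the two integrals
  are exchanged. Using \<open>count_space\<close> spares an enumeration of the Vitali and dyadic
  families below.\<close>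

lemma emeasure_countable_subadditive:
  assumes "countable I" "\<And>i. i \<in> I \<Longrightarrow> X i \<in> sets M"
  shows "emeasure M (\<Union>i\<in>I. X i) \<le> (\<integral>\<^sup>+ i. emeasure M (X i) \<partial>count_space I)"
proof -
  have U: "(\<Union>i\<in>I. X i) \<in> sets M" using assms by (intro sets.countable_UN'') auto
  have "emeasure M (\<Union>i\<in>I. X i) = (\<integral>\<^sup>+ x. indicator (\<Union>i\<in>I. X i) x \<partial>M)"
    using U by simp
  also have "\<dots> \<le> (\<integral>\<^sup>+ x. (\<integral>\<^sup>+ i. indicator (X i) x \<partial>count_space I) \<partial>M)"
  proof (intro nn_integral_mono)
    fix x
    show "indicator (\<Union>i\<in>I. X i) x \<le> (\<integral>\<^sup>+ i. (indicator (X i) x :: ennreal) \<partial>count_space I)"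
    proof (cases "x \<in> (\<Union>i\<in>I. X i)")
      case True
      then obtain j where j: "j \<in> I" "x \<in> X j" by auto
      have "(1::ennreal) = (\<integral>\<^sup>+ i. indicator {j} i \<partial>count_space I)"
        using j by (subst nn_integral_indicator) (auto simp: emeasure_count_space)
      also have "\<dots> \<le> (\<integral>\<^sup>+ i. indicator (X i) x \<partial>count_space I)"
        using j by (intro nn_integral_mono) (auto simp: indicator_def)
      finally show ?thesis using True by simp
    qed simp
  qed
  also have "\<dots> = (\<integral>\<^sup>+ i. (\<integral>\<^sup>+ x. indicator (X i) x \<partial>M) \<partial>count_space I)"
    using assms by (intro nn_integral_count_space_nn_integral) auto
  also have "\<dots> = (\<integral>\<^sup>+ i. emeasure M (X i) \<partial>count_space I)"
    using assms by (intro nn_integral_cong) auto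
  finally show ?thesis .
qed

text \<open>This is countable additivity of the measure with density \<open>f\<close>.\<close>

lemma nn_integral_disjoint_family_le:
  assumes "countable I" "\<And>i. i \<in> I \<Longrightarrow> X i \<in> sets M" "disjoint_family_on X I"
    and [measurable]: "f \<in> borel_measurable M"
  shows "(\<integral>\<^sup>+ i. (\<integral>\<^sup>+ x\<in>X i. f x \<partial>M) \<partial>count_space I) \<le> (\<integral>\<^sup>+ x. f x \<partial>M)"
proof -
  let ?N = "density M f"
  have U: "(\<Union>i\<in>I. X i) \<in> sets M" using assms by (intro sets.countable_UN'') auto
  have "(\<integral>\<^sup>+ i. (\<integral>\<^sup>+ x\<in>X i. f x \<partial>M) \<partial>count_space I) = (\<integral>\<^sup>+ i. emeasure ?N (X i) \<partial>count_space I)"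
    using assms by (intro nn_integral_cong) (auto simp: emeasure_density)
  also have "\<dots> = emeasure ?N (\<Union>i\<in>I. X i)"
    using assms by (intro emeasure_UN_countable[symmetric]) auto
  also have "\<dots> \<le> emeasure ?N (space ?N)"
    by (rule emeasure_space)
  also have "\<dots> = (\<integral>\<^sup>+ x. f x \<partial>M)"
    by (subst emeasure_density) (auto intro!: nn_integral_cong)
  finally show ?thesis .
qed

section \<open>Fractional means over cubes and the weak type inequality\<close>

abbreviation absint :: "(real^'n) set \<Rightarrow> (real^'n \<Rightarrow> real) \<Rightarrow> ennreal" where
  "absint Q f \<equiv> (\<integral>\<^sup>+ y \<in> Q. ennreal \<bar>f y\<bar> \<partial>lebesgue)"

abbreviation frac_mean :: "real \<Rightarrow> real^'n \<Rightarrow> real \<Rightarrow> (real^'n \<Rightarrow> real) \<Rightarrow> ennreal" where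
  "frac_mean \<eta> a l f \<equiv> absint (cube a l) f / ennreal ((l ^ CARD('n)) powr (1 - \<eta> / real CARD('n)))"

text \<open>Strictly below a supremum a single cube is a witness. This form serves both the covering
  argument and the openness of superlevel sets.\<close>

lemma frac_maximal_less_iff:
  fixes x :: "real^'n"
  shows "t < frac_maximal \<eta> f x \<longleftrightarrow> (\<exists>a l. 0 < l \<and> x \<in> cube a l \<and>
    t < frac_mean \<eta> a l f)"
proof
  assume "t < frac_maximal \<eta> f x"
  then obtain Q where "Q \<in> cubes" "x \<in> Q" "t < (\<integral>\<^sup>+ y \<in> Q. ennreal \<bar>f y\<bar> \<partial>lebesgue)
       / ennreal (measure lebesgue Q powr (1 - \<eta> / real CARD('n)))"
    unfolding frac_maximal_def less_SUP_iff by blast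
  moreover from this obtain a l where "0 < l" "Q = cube a l" by (auto simp: cubes_eq)
  ultimately have "0 < l \<and> x \<in> cube a l \<and>
    t < frac_mean \<eta> a l f"
    by (simp add: content_cube)
  then show "\<exists>a l. 0 < l \<and> x \<in> cube a l \<and>
    t < frac_mean \<eta> a l f"
    by blast
next
  assume "\<exists>a l. 0 < l \<and> x \<in> cube a l \<and>
    t < frac_mean \<eta> a l f"
  then obtain a l where l: "0 < l" "x \<in> cube a l"
    "t < frac_mean \<eta> a l f"
    by blast
  show "t < frac_maximal \<eta> f x"
    unfolding frac_maximal_def less_SUP_iff
    by (rule bexI[of _ "cube a l"]) (use l in \<open>auto simp: cubes_eq content_cube\<close>)
qed

lemma frac_maximal_upper:
  fixes x :: "real^'n"
  assumes "0 < l" "x \<in> cube a l"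
  shows "frac_mean \<eta> a l f
    \<le> frac_maximal \<eta> f x"
  unfolding frac_maximal_def
  by (rule SUP_upper2[of "cube a l"]) (use assms in \<open>auto simp: cubes_eq content_cube\<close>)

lemma frac_maximal_least:
  fixes x :: "real^'n"
  assumes "\<And>a l. 0 < l \<Longrightarrow> x \<in> cube a l \<Longrightarrow> absint (cube a l) f
       / ennreal ((l ^ CARD('n)) powr (1 - \<eta> / real CARD('n))) \<le> B"
  shows "frac_maximal \<eta> f x \<le> B"
  unfolding frac_maximal_def
  by (rule SUP_least) (use assms in \<open>auto simp: cubes_eq content_cube\<close>)

text \<open>Only the divisor is a positive real; \<open>t\<close> and \<open>I\<close> may be
  infinite.\<close>

lemma ennreal_less_divide_iff:
  assumes "0 < m"
  shows "t < I / ennreal m \<longleftrightarrow> t * ennreal m < I"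
proof -
  have "I / ennreal m \<le> t" if "I \<le> t * ennreal m"
  proof -
    have "I / ennreal m \<le> t * ennreal m / ennreal m" using that by (rule divide_right_mono_ennreal)
    also have "\<dots> = t" using assms by (simp add: mult_divide_eq_ennreal)
    finally show ?thesis .
  qed
  moreover have "I \<le> t * ennreal m" if "I / ennreal m \<le> t"
  proof -
    have "I = I / ennreal m * ennreal m"
      using assms by (simp add: ennreal_divide_times)
    also have "\<dots> \<le> t * ennreal m" using that by (rule mult_right_mono) simp
    finally show ?thesis .
  qed
  ultimately show ?thesis by (meson not_le)
qed

lemma frac_maximal_zero_lessD:
  fixes x :: "real^'n"
  assumes "ennreal t < frac_maximal 0 f x" "0 \<le> t"
  obtains a l where "0 < l" "x \<in> cube a l"
    "ennreal (t * l ^ CARD('n)) < absint (cube a l) f"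
proof -
  from assms(1) obtain a l where l: "0 < l" "x \<in> cube a l" and
    *: "ennreal t < absint (cube a l) f / ennreal (l ^ CARD('n))"
    unfolding frac_maximal_less_iff by auto
  have "ennreal t * ennreal (l ^ CARD('n)) < absint (cube a l) f"
    using * l by (subst ennreal_less_divide_iff[symmetric]) auto
  then have "ennreal (t * l ^ CARD('n)) < absint (cube a l) f"
    using l assms(2) by (simp add: ennreal_mult)
  with l that show ?thesis by blast
qed

text \<open>Vitali covering: every point of the superlevel set lies in a cube whose volume is less
  than 1/t times the integral of |f| over it. Balls around a disjoint subfamily, enlarged five
  times, still cover the set.\<close>

lemma weak_type:
  "\<exists>A>0. \<forall>(f :: real^'n \<Rightarrow> real) t. f \<in> borel_measurable lebesgue \<longrightarrow> 0 < t \<longrightarrow>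
     emeasure lebesgue {x. ennreal t < frac_maximal 0 f x} \<le> ennreal (A / t) * (\<integral>\<^sup>+ x. ennreal \<bar>f x\<bar> \<partial>lebesgue)"
proof -
  let ?n = "real CARD('n)"
  \<comment> \<open>The volume of a ball of radius 5n, that is, the ratio between the enlarged ball
    belonging to a cube and the cube itself.\<close>
  define A where "A = unit_ball_vol ?n * (5 * ?n) ^ CARD('n)"
  have A: "A > 0" by (simp add: A_def)
  show ?thesis
  proof (intro exI[of _ A] conjI A allI impI)
    fix f :: "real^'n \<Rightarrow> real" and t :: real
    assume f [measurable]: "f \<in> borel_measurable lebesgue" and t: "0 < t"
    let ?S = "{x. ennreal t < frac_maximal 0 f x}"
    let ?I = "\<integral>\<^sup>+ x. ennreal \<bar>f x\<bar> \<partial>lebesgue"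
    show "emeasure lebesgue ?S \<le> ennreal (A / t) * ?I"
    proof (cases "?I = \<infinity>")
      case True
      then show ?thesis using A t by (simp add: ennreal_mult_top)
    next
      case False
      then obtain J where J: "?I = ennreal J" "0 \<le> J" by (cases ?I) auto
      define K where "K = {(a, l). 0 < l \<and>
        ennreal (t * l ^ CARD('n)) < absint (cube a l) f}"
      have cov: "\<exists>i\<in>K. x \<in> cube (fst i) (snd i)" if "x \<in> ?S" for x
        using that frac_maximal_zero_lessD[of t f x] t unfolding K_def by fastforce
      \<comment> \<open>The balls are centred at the corner of the cube, and n * l bounds its
        diameter.\<close>
      have sub: "cube a l \<subseteq> cball a (?n * l)" if "0 < l" for a :: "real^'n" and l
        using norm_cube[OF corner_in_cube[of l a]] that by (auto simp: dist_norm)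
      \<comment> \<open>Vitali's lemma needs bounded radii. Finiteness of the integral bounds l^n by
        J / t, and l \<le> l^n once l exceeds 1.\<close>
      have bd: "0 < ?n * snd i \<and> ?n * snd i \<le> ?n * max 1 (J / t)" if "i \<in> K" for i
      proof -
        obtain a l where i: "i = (a, l)" by force
        have l: "0 < l" using that i by (auto simp: K_def)
        have "ennreal (t * l ^ CARD('n)) < absint (cube a l) f"
          using that i by (auto simp: K_def)
        also have "\<dots> \<le> ?I" by (intro nn_integral_mono) (auto simp: indicator_def)
        finally have "t * l ^ CARD('n) < J" using J l t by (simp add: ennreal_less_iff)
        then have *: "l ^ CARD('n) < J / t" using t by (simp add: field_simps)
        have "l \<le> max 1 (J / t)"
        proof (cases "l \<le> 1")
          case False
          then have "l ^ 1 \<le> l ^ CARD('n)" by (intro power_increasing) auto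
          with * show ?thesis by simp
        qed simp
        then show ?thesis using l i by simp
      qed
      obtain C where C: "countable C" "C \<subseteq> K"
        "pairwise (\<lambda>i j. disjnt (cball (fst i) (?n * snd i)) (cball (fst j) (?n * snd j))) C"
        "\<And>i. i \<in> K \<Longrightarrow> \<exists>j. j \<in> C \<and> \<not> disjnt (cball (fst i) (?n * snd i)) (cball (fst j) (?n * snd j)) \<and>
            cball (fst i) (?n * snd i) \<subseteq> ball (fst j) (5 * (?n * snd j))"
        using Vitali_covering_lemma_cballs_balls[of K "\<lambda>i. ?n * snd i" "?n * max 1 (J / t)" fst] bd by blast
      have C0: "0 < snd i" if "i \<in> C" for i using C(2) that by (auto simp: K_def)
      have "?S \<subseteq> (\<Union>j\<in>C. ball (fst j) (5 * (?n * snd j)))"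
      proof
        fix x assume "x \<in> ?S"
        then obtain i where i: "i \<in> K" "x \<in> cube (fst i) (snd i)" using cov by blast
        then have "x \<in> cball (fst i) (?n * snd i)" using sub[of "snd i" "fst i"] unfolding K_def by force
        with C(4)[OF i(1)] show "x \<in> (\<Union>j\<in>C. ball (fst j) (5 * (?n * snd j)))" by blast
      qed
      then have "emeasure lebesgue ?S \<le> emeasure lebesgue (\<Union>j\<in>C. ball (fst j) (5 * (?n * snd j)))"
        using C(1) by (intro emeasure_mono sets.countable_UN'') auto
      also have "\<dots> \<le> (\<integral>\<^sup>+ j. emeasure lebesgue (ball (fst j) (5 * (?n * snd j))) \<partial>count_space C)"
        using C(1) by (intro emeasure_countable_subadditive) auto
      also have "\<dots> \<le> (\<integral>\<^sup>+ j. ennreal (A / t) * absint (cube (fst j) (snd j)) f \<partial>count_space C)"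
      proof (intro nn_integral_mono)
        fix j assume "j \<in> space (count_space C)"
        then have j: "j \<in> C" by simp
        have "emeasure lebesgue (ball (fst j) (5 * (?n * snd j))) = ennreal (A * snd j ^ CARD('n))"
          using C0[OF j] by (simp add: emeasure_ball A_def power_mult_distrib mult_ac)
        also have "\<dots> = ennreal (A / t) * ennreal (t * snd j ^ CARD('n))"
          using t A C0[OF j] by (simp add: ennreal_mult[symmetric])
        also have "\<dots> \<le> ennreal (A / t) * absint (cube (fst j) (snd j)) f"
          using j C(2) by (intro mult_left_mono) (auto simp: K_def intro: less_imp_le)
        finally show "emeasure lebesgue (ball (fst j) (5 * (?n * snd j))) \<le> \<dots>" .
      qed
      also have "\<dots> = ennreal (A / t) * (\<integral>\<^sup>+ j. absint (cube (fst j) (snd j)) f \<partial>count_space C)"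
        by (rule nn_integral_cmult) simp
      also have "\<dots> \<le> ennreal (A / t) * ?I"
      proof (intro mult_left_mono nn_integral_disjoint_family_le)
        show "disjoint_family_on (\<lambda>j. cube (fst j) (snd j)) C"
          unfolding disjoint_family_on_def
        proof (intro ballI impI)
          fix i j assume ij: "i \<in> C" "j \<in> C" "i \<noteq> j"
          then have "disjnt (cball (fst i) (?n * snd i)) (cball (fst j) (?n * snd j))"
            using C(3) by (auto simp: pairwise_def)
          then show "cube (fst i) (snd i) \<inter> cube (fst j) (snd j) = {}"
            using sub[OF C0[OF ij(1)], of "fst i"] sub[OF C0[OF ij(2)], of "fst j"] by (auto simp: disjnt_def)
        qed
      qed (use C in auto)
      finally show ?thesis .
    qed
  qed
qed

section \<open>The maximal theorem\<close>

text \<open>A witnessing cube can be enlarged a little on all sides: the integral does not decrease,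
  the denominator varies continuously and the inequality is strict. The enlarged cube then serves
  all points near \<open>x\<close>.\<close>

lemma open_frac_maximal_superlevel:
  fixes f :: "real^'n \<Rightarrow> real"
  shows "open {x. t < frac_maximal \<eta> f x}"
proof (subst open_subopen, safe)
  fix x assume "t < frac_maximal \<eta> f x"
  let ?e = "1 - \<eta> / real CARD('n)"
  let ?m = "\<lambda>l. (l ^ CARD('n)) powr ?e"
  from \<open>t < frac_maximal \<eta> f x\<close> obtain a l where l: "0 < l" "x \<in> cube a l"
    and t: "t < absint (cube a l) f / ennreal (?m l)"
    unfolding frac_maximal_less_iff by blast
  let ?I = "\<integral>\<^sup>+ y \<in> cube a l. ennreal \<bar>f y\<bar> \<partial>lebesgue"
  have "t * ennreal (?m l) < ?I"
    using t l by (subst ennreal_less_divide_iff[symmetric]) auto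
  \<comment> \<open>\<open>t\<close> is finite because it lies strictly below another value;
    continuity of multiplication by \<open>t\<close> depends on this.\<close>
  moreover have "((\<lambda>\<epsilon>. t * ennreal (?m (l + 2 * \<epsilon>))) \<longlongrightarrow> t * ennreal (?m (l + 2 * 0))) (at_right 0)"
    using l t by (intro ennreal_tendsto_cmult tendsto_ennrealI tendsto_intros) (auto simp: top_unique less_top)
  ultimately have "\<forall>\<^sub>F \<epsilon> in at_right 0. t * ennreal (?m (l + 2 * \<epsilon>)) < ?I"
    by (intro order_tendstoD(2)[where y = "t * ennreal (?m (l + 2 * 0))"]) auto
  moreover have "\<forall>\<^sub>F \<epsilon> in at_right 0. (0::real) < \<epsilon>"
    by (rule eventually_at_right_less)
  ultimately have "\<forall>\<^sub>F \<epsilon> in at_right 0. t * ennreal (?m (l + 2 * \<epsilon>)) < ?I \<and> 0 < \<epsilon>"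
    by (rule eventually_conj)
  then obtain \<epsilon> where \<epsilon>: "0 < \<epsilon>" "t * ennreal (?m (l + 2 * \<epsilon>)) < ?I"
    using eventually_happens'[of "at_right (0::real)"] by auto
  let ?a = "\<chi> i. a $ i - \<epsilon>"
  let ?U = "box ?a (\<chi> i. a $ i + l + \<epsilon>)"
  have "?U \<subseteq> {x. t < frac_maximal \<eta> f x}"
  proof
    fix y assume "y \<in> ?U"
    then have y: "y \<in> cube ?a (l + 2 * \<epsilon>)"
      by (auto simp: mem_box_cart mem_cube intro: less_imp_le) (smt (verit))
    have "cube a l \<subseteq> cube ?a (l + 2 * \<epsilon>)"
      using \<epsilon>(1) by (auto simp: mem_cube intro: order_trans) (smt (verit))+
    then have "?I \<le> absint (cube ?a (l + 2 * \<epsilon>)) f"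
      by (intro nn_integral_mono) (auto simp: indicator_def)
    with \<epsilon> have "t * ennreal (?m (l + 2 * \<epsilon>)) < absint (cube ?a (l + 2 * \<epsilon>)) f"
      by simp
    then have "t < absint (cube ?a (l + 2 * \<epsilon>)) f / ennreal (?m (l + 2 * \<epsilon>))"
      using l \<epsilon> by (subst ennreal_less_divide_iff) auto
    then show "y \<in> {x. t < frac_maximal \<eta> f x}"
      unfolding mem_Collect_eq frac_maximal_less_iff using y l \<epsilon>(1)
      by (intro exI[of _ ?a] exI[of _ "l + 2 * \<epsilon>"]) auto
  qed
  moreover have "x \<in> ?U"
    using l \<epsilon>(1) by (auto simp: mem_box_cart mem_cube) (smt (verit))+
  ultimately show "\<exists>T. open T \<and> x \<in> T \<and> T \<subseteq> {x. t < frac_maximal \<eta> f x}"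
    by (intro exI[of _ ?U]) auto
qed

lemma measurable_frac_maximal [measurable]:
  "frac_maximal \<eta> f \<in> borel_measurable borel" "frac_maximal \<eta> f \<in> borel_measurable lebesgue"
proof -
  show *: "frac_maximal \<eta> f \<in> borel_measurable borel"
    using open_frac_maximal_superlevel[of _ \<eta> f] by (intro borel_measurableI_greater) (simp add: borel_open)
  show "frac_maximal \<eta> f \<in> borel_measurable lebesgue"
    using * by (simp add: measurable_completion)
qed

section \<open>Truncation, layer cake and the strong type inequality\<close>

abbreviation tail_int :: "real \<Rightarrow> (real^'n \<Rightarrow> real) \<Rightarrow> ennreal" where
  "tail_int t f \<equiv> (\<integral>\<^sup>+ x. ennreal (\<bar>f x\<bar> * indicator {y. t < 2 * \<bar>y\<bar>} (f x)) \<partial>lebesgue)"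

text \<open>Discarding the values of |f| up to t/2 lowers every mean by at most t/2, so the
  truncated function still has maximal function above t/2. Interpolation needs the integral over the
  tail only.\<close>

lemma weak_type_truncated:
  "\<exists>A>0. \<forall>(f :: real^'n \<Rightarrow> real) t. f \<in> borel_measurable lebesgue \<longrightarrow> 0 < t \<longrightarrow>
     emeasure lebesgue {x. ennreal t < frac_maximal 0 f x}
       \<le> ennreal (A / t) * tail_int t f"
proof -
  obtain A where A: "A > 0" and wt: "\<And>(f :: real^'n \<Rightarrow> real) t. f \<in> borel_measurable lebesgue \<Longrightarrow> 0 < t \<Longrightarrow>
     emeasure lebesgue {x. ennreal t < frac_maximal 0 f x} \<le> ennreal (A / t) * (\<integral>\<^sup>+ x. ennreal \<bar>f x\<bar> \<partial>lebesgue)"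
    using weak_type by blast
  show ?thesis
  proof (intro exI[of _ "2 * A"] conjI allI impI)
    show "0 < 2 * A" using A by simp
    fix f :: "real^'n \<Rightarrow> real" and t :: real
    assume f [measurable]: "f \<in> borel_measurable lebesgue" and t: "0 < t"
    define f1 where "f1 x = f x * indicator {y. t < 2 * \<bar>y\<bar>} (f x)" for x
    have f1 [measurable]: "f1 \<in> borel_measurable lebesgue"
      unfolding f1_def by measurable
    have "{x. ennreal t < frac_maximal 0 f x} \<subseteq> {x. ennreal (t / 2) < frac_maximal 0 f1 x}"
    proof safe
      fix x assume x: "ennreal t < frac_maximal 0 f x"
      obtain a l where l: "0 < l" "x \<in> cube a l"
        "ennreal (t * l ^ CARD('n)) < absint (cube a l) f"
        by (rule frac_maximal_zero_lessD[OF x less_imp_le[OF t]])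
      let ?T = "ennreal (t / 2 * l ^ CARD('n))"
      have T: "ennreal (t * l ^ CARD('n)) = ?T + ?T"
        using l(1) t by (subst ennreal_plus[symmetric]) auto
      note l(3)
      also have "absint (cube a l) f
          \<le> (\<integral>\<^sup>+ y. ennreal \<bar>f1 y\<bar> * indicator (cube a l) y + ennreal (t / 2) * indicator (cube a l) y \<partial>lebesgue)"
        using t by (intro nn_integral_mono) (auto simp: f1_def indicator_def ennreal_leI)
      also have "\<dots> = absint (cube a l) f1 + ennreal (t / 2) * emeasure lebesgue (cube a l)"
        by (subst nn_integral_add) (auto simp: nn_integral_cmult_indicator)
      also have "ennreal (t / 2) * emeasure lebesgue (cube a l) = ?T"
        unfolding emeasure_cube[OF l(1)] using l(1) t by (subst ennreal_mult[symmetric]) auto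
      finally have "?T + ?T < absint (cube a l) f1 + ?T" unfolding T .
      then have "?T < absint (cube a l) f1"
        by (meson add_right_mono not_le)
      then have "ennreal (t / 2) * ennreal (l ^ CARD('n)) < absint (cube a l) f1"
        using l(1) t by (subst ennreal_mult[symmetric]) auto
      then have "ennreal (t / 2) < absint (cube a l) f1 / ennreal (l ^ CARD('n))"
        using l(1) by (subst ennreal_less_divide_iff) auto
      then show "ennreal (t / 2) < frac_maximal 0 f1 x"
        unfolding frac_maximal_less_iff using l by (intro exI[of _ a] exI[of _ l]) auto
    qed
    then have "emeasure lebesgue {x. ennreal t < frac_maximal 0 f x} \<le> emeasure lebesgue {x. ennreal (t / 2) < frac_maximal 0 f1 x}"
      by (intro emeasure_mono) auto
    also have "\<dots> \<le> ennreal (A / (t / 2)) * (\<integral>\<^sup>+ x. ennreal \<bar>f1 x\<bar> \<partial>lebesgue)"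
      using t by (intro wt) auto
    also have "\<dots> = ennreal (2 * A / t) * tail_int t f"
      by (simp add: f1_def abs_mult mult.commute)
    finally show "emeasure lebesgue {x. ennreal t < frac_maximal 0 f x} \<le> \<dots>" .
  qed
qed

lemma layer_cake_powr:
  assumes "0 \<le> (y::real)" "0 < a"
  shows "(\<integral>\<^sup>+ t. ennreal (t powr (a - 1)) * indicator {0<..<y} t \<partial>lborel) = ennreal (y powr a / a)"
proof -
  have "(\<integral>\<^sup>+ t. ennreal (t powr (a - 1)) * indicator {0<..<y} t \<partial>lborel)
      = (\<integral>\<^sup>+ t. ennreal (indicator {0..y} t * t powr (a - 1)) \<partial>lborel)"
  proof (rule nn_integral_cong_AE)
    \<comment> \<open>The known integral is over the closed interval; its end points form a null
      set.\<close>
    have "AE t in lborel. t \<noteq> 0 \<and> t \<noteq> y"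
      using AE_lborel_singleton[of "0::real"] AE_lborel_singleton[of y] by eventually_elim auto
    then show "AE t in lborel. ennreal (t powr (a - 1)) * indicator {0<..<y} t = ennreal (indicator {0..y} t * t powr (a - 1))"
      by eventually_elim (auto simp: indicator_def)
  qed
  also have "\<dots> = ennreal (y powr (a - 1 + 1) / (a - 1 + 1))"
    using assms by (intro nn_integral_has_integral_lebesgue has_integral_powr_from_0) auto
  finally show ?thesis by simp
qed

text \<open>Required for exchanging the level variable with the integral over space, since the
  measure is the completed one.\<close>

lemma sigma_finite_lebesgue: "sigma_finite_measure (lebesgue :: 'a::euclidean_space measure)"
proof
  show "\<exists>A::'a set set. countable A \<and> A \<subseteq> sets lebesgue \<and> \<Union>A = space lebesgue \<and> (\<forall>a\<in>A. emeasure lebesgue a \<noteq> \<infinity>)"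
  proof (intro exI[of _ "range (\<lambda>k. cball 0 (real k))"] conjI ballI)
    show "\<Union>(range (\<lambda>k. cball (0::'a) (real k))) = space lebesgue"
      using real_arch_simple by (auto simp: dist_norm)
    fix a assume "a \<in> range (\<lambda>k. cball (0::'a) (real k))"
    then show "emeasure lebesgue a \<noteq> \<infinity>"
      using emeasure_lborel_cball_finite[of "0::'a"] by (auto simp: less_top[symmetric])
  qed auto
qed

text \<open>Marcinkiewicz interpolation. Since \<open>enn2real\<close> sends infinity to 0, the
  integral bound says nothing where the maximal function is infinite; the second conjunct closes
  this gap.\<close>

theorem maximal_strong_type:
  assumes s: "1 < s"
  shows "\<exists>A>0. \<forall>f :: real^'n \<Rightarrow> real. f \<in> borel_measurable lebesgue \<longrightarrow>
     (\<integral>\<^sup>+ x. ennreal (enn2real (frac_maximal 0 f x) powr s) \<partial>lebesgue)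
       \<le> ennreal A * (\<integral>\<^sup>+ x. ennreal (\<bar>f x\<bar> powr s) \<partial>lebesgue) \<and>
     ((\<integral>\<^sup>+ x. ennreal (\<bar>f x\<bar> powr s) \<partial>lebesgue) < \<infinity> \<longrightarrow> (AE x in lebesgue. frac_maximal 0 f x < \<infinity>))"
proof -
  obtain A where A: "A > 0" and wt: "\<And>(f :: real^'n \<Rightarrow> real) t. f \<in> borel_measurable lebesgue \<Longrightarrow> 0 < t \<Longrightarrow>
     emeasure lebesgue {x. ennreal t < frac_maximal 0 f x}
       \<le> ennreal (A / t) * tail_int t f"
    using weak_type_truncated by blast
  interpret L: sigma_finite_measure "lebesgue :: (real^'n) measure" by (rule sigma_finite_lebesgue)
  interpret P: pair_sigma_finite "lborel :: real measure" "lebesgue :: (real^'n) measure" ..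
  \<comment> \<open>Integrating s * A * |f| * t^(s - 2) over 0 < t < 2|f| gives exactly B *
    |f|^s.\<close>
  define B where "B = s * A * 2 powr (s - 1) / (s - 1)"
  have B: "B > 0" using s A by (simp add: B_def)
  show ?thesis
  proof (intro exI[of _ B] conjI B allI impI)
    fix f :: "real^'n \<Rightarrow> real"
    assume f [measurable]: "f \<in> borel_measurable lebesgue"
    let ?M = "frac_maximal 0 f"
    let ?u = "\<lambda>t x. ennreal (s * t powr (s - 1)) * indicator {t. 0 < t \<and> ennreal t < ?M x} t"
    let ?w = "\<lambda>t x. ennreal (s * A * \<bar>f x\<bar>) * (ennreal (t powr ((s - 1) - 1)) * indicator {0<..<2 * \<bar>f x\<bar>} t)"
    let ?J = "\<integral>\<^sup>+ x. ennreal (\<bar>f x\<bar> powr s) \<partial>lebesgue"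
    have 1: "ennreal (enn2real (?M x) powr s)
       \<le> (\<integral>\<^sup>+ t. ?u t x \<partial>lborel)" for x
    proof -
      have "ennreal (enn2real (?M x) powr s) = ennreal s * ennreal (enn2real (?M x) powr s / s)"
        using s by (simp add: ennreal_mult[symmetric])
      also have "\<dots> = ennreal s * (\<integral>\<^sup>+ t. ennreal (t powr (s - 1)) * indicator {0<..<enn2real (?M x)} t \<partial>lborel)"
        using s by (subst layer_cake_powr) auto
      also have "\<dots> = (\<integral>\<^sup>+ t. ennreal s * (ennreal (t powr (s - 1)) * indicator {0<..<enn2real (?M x)} t) \<partial>lborel)"
        by (rule nn_integral_cmult[symmetric]) simp
      also have "\<dots> \<le> (\<integral>\<^sup>+ t. ?u t x \<partial>lborel)"
      proof (intro nn_integral_mono)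
        fix t :: real
        have "ennreal t < ?M x" if "0 < t" "t < enn2real (?M x)"
          using that by (cases "?M x") (auto simp: ennreal_less_iff)
        then show "ennreal s * (ennreal (t powr (s - 1)) * indicator {0<..<enn2real (?M x)} t)
           \<le> ?u t x"
          using s by (auto simp: indicator_def ennreal_mult)
      qed
      finally show ?thesis .
    qed
    have "(\<integral>\<^sup>+ x. ennreal (enn2real (?M x) powr s) \<partial>lebesgue)
       \<le> (\<integral>\<^sup>+ x. (\<integral>\<^sup>+ t. ?u t x \<partial>lborel) \<partial>lebesgue)"
      by (intro nn_integral_mono 1)
    also have "\<dots> = (\<integral>\<^sup>+ t. (\<integral>\<^sup>+ x. ?u t x \<partial>lebesgue) \<partial>lborel)"
      by (rule P.Fubini') measurable
    also have "\<dots> \<le> (\<integral>\<^sup>+ t. (\<integral>\<^sup>+ x. ?w t x \<partial>lebesgue) \<partial>lborel)"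
    proof (rule nn_integral_mono)
      fix t :: real
      show "(\<integral>\<^sup>+ x. ?u t x \<partial>lebesgue)
        \<le> (\<integral>\<^sup>+ x. ?w t x \<partial>lebesgue)"
      proof (cases "0 < t")
        case t: True
        have "(\<integral>\<^sup>+ x. ?u t x \<partial>lebesgue)
          = (\<integral>\<^sup>+ x. ennreal (s * t powr (s - 1)) * indicator {x. ennreal t < ?M x} x \<partial>lebesgue)"
          using t by (intro nn_integral_cong) (auto simp: indicator_def)
        also have "\<dots> = ennreal (s * t powr (s - 1)) * emeasure lebesgue {x. ennreal t < ?M x}"
          by (rule nn_integral_cmult_indicator) simp
        also have "\<dots> \<le> ennreal (s * t powr (s - 1)) * (ennreal (A / t) * tail_int t f)"
          using t by (intro mult_left_mono wt) auto
        also have "\<dots> = (\<integral>\<^sup>+ x. ennreal (s * t powr (s - 1) * (A / t)) * ennreal (\<bar>f x\<bar> * indicator {y. t < 2 * \<bar>y\<bar>} (f x)) \<partial>lebesgue)"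
        proof -
          have "ennreal (s * t powr (s - 1)) * ennreal (A / t) = ennreal (s * t powr (s - 1) * (A / t))"
            using s A t by (intro ennreal_mult[symmetric]) auto
          then show ?thesis by (subst nn_integral_cmult) (auto simp: mult.assoc[symmetric])
        qed
        also have "\<dots> = (\<integral>\<^sup>+ x. ?w t x \<partial>lebesgue)"
          using s A t by (intro nn_integral_cong) (auto simp: indicator_def ennreal_mult[symmetric] powr_diff power2_eq_square mult_ac)
        finally show ?thesis by simp
      qed (auto simp: indicator_def)
    qed
    also have "\<dots> = (\<integral>\<^sup>+ x. (\<integral>\<^sup>+ t. ?w t x \<partial>lborel) \<partial>lebesgue)"
    proof -
      have [measurable]: "(\<lambda>p. indicator {0<..<2 * \<bar>f (snd p)\<bar>} (fst p) :: ennreal)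
          \<in> borel_measurable (lborel \<Otimes>\<^sub>M lebesgue)"
        unfolding indicator_def greaterThanLessThan_iff by measurable
      show ?thesis
        by (rule P.Fubini'[symmetric]) measurable
    qed
    also have "\<dots> = (\<integral>\<^sup>+ x. ennreal B * ennreal (\<bar>f x\<bar> powr s) \<partial>lebesgue)"
    proof (intro nn_integral_cong)
      fix x
      have "(\<integral>\<^sup>+ t. ?w t x \<partial>lborel)
        = ennreal (s * A * \<bar>f x\<bar>) * ennreal ((2 * \<bar>f x\<bar>) powr (s - 1) / (s - 1))"
        using s by (subst nn_integral_cmult, simp, subst layer_cake_powr) auto
      also have "\<dots> = ennreal B * ennreal (\<bar>f x\<bar> powr s)"
        using s A by (simp add: ennreal_mult[symmetric] B_def powr_mult powr_diff)
      finally show "(\<integral>\<^sup>+ t. ?w t x \<partial>lborel)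
        = ennreal B * ennreal (\<bar>f x\<bar> powr s)" .
    qed
    also have "\<dots> = ennreal B * ?J"
      by (rule nn_integral_cmult) measurable
    finally show "(\<integral>\<^sup>+ x. ennreal (enn2real (?M x) powr s) \<partial>lebesgue) \<le> ennreal B * ?J" .
    assume fin: "?J < \<infinity>"
    then obtain J where J: "?J = ennreal J" "0 \<le> J"
      by (cases ?J) auto
    let ?E = "{x. ?M x = \<infinity>}"
    \<comment> \<open>For t \<ge> 1, every value with 2|f| > t satisfies |f| \<le> 2^(s - 1) |f|^s,
      so the weak type bound becomes c / t and tends to 0.\<close>
    define c where "c = A * 2 powr (s - 1) * J"
    have bnd: "emeasure lebesgue ?E \<le> ennreal (c / t)" if t: "1 \<le> t" for t
    proof -
      have "emeasure lebesgue ?E \<le> emeasure lebesgue {x. ennreal t < ?M x}"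
        by (intro emeasure_mono) auto
      also have "\<dots> \<le> ennreal (A / t) * tail_int t f"
        using t by (intro wt) auto
      also have "\<dots> \<le> ennreal (A / t) * (\<integral>\<^sup>+ x. ennreal (2 powr (s - 1)) * ennreal (\<bar>f x\<bar> powr s) \<partial>lebesgue)"
      proof (intro mult_left_mono nn_integral_mono)
        fix x
        show "ennreal (\<bar>f x\<bar> * indicator {y. t < 2 * \<bar>y\<bar>} (f x)) \<le> ennreal (2 powr (s - 1)) * ennreal (\<bar>f x\<bar> powr s)"
        proof (cases "t < 2 * \<bar>f x\<bar>")
          case True
          then have "1 \<le> (2 * \<bar>f x\<bar>) powr (s - 1)" using t s by (intro ge_one_powr_ge_zero) auto
          then have "\<bar>f x\<bar> \<le> \<bar>f x\<bar> * (2 * \<bar>f x\<bar>) powr (s - 1)" by (simp add: mult_le_cancel_left1)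
          also have "\<dots> = 2 powr (s - 1) * \<bar>f x\<bar> powr s"
            by (simp add: powr_mult powr_diff)
          finally show ?thesis using True by (simp add: ennreal_mult[symmetric] ennreal_leI)
        qed simp
      qed simp
      also have "\<dots> = ennreal (c / t)"
        using A t J by (subst nn_integral_cmult) (auto simp: ennreal_mult[symmetric] c_def)
      finally show ?thesis .
    qed
    have c: "0 \<le> c" using A J by (simp add: c_def)
    have "emeasure lebesgue ?E = 0"
    proof (rule ccontr)
      assume ne: "emeasure lebesgue ?E \<noteq> 0"
      have "emeasure lebesgue ?E \<le> ennreal (c / 1)" by (rule bnd) simp
      then obtain e where e: "emeasure lebesgue ?E = ennreal e" "0 \<le> e"
        by (cases "emeasure lebesgue ?E") (auto simp: top_unique)
      with ne have e0: "0 < e" by auto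
      \<comment> \<open>Chosen so that c / t \<le> e / 2, which contradicts e \<le> c / t for
        positive e.\<close>
      define t where "t = max 1 (2 * c / e)"
      have "e \<le> c / t" using bnd[of t] e c by (auto simp: t_def)
      moreover have "2 * c / e \<le> t" "1 \<le> t" by (auto simp: t_def)
      ultimately have "e * t \<le> c" "2 * c \<le> t * e" using e0 by (auto simp: field_simps)
      then have "c \<le> 0" by (simp add: mult.commute)
      with \<open>e * t \<le> c\<close> e0 \<open>1 \<le> t\<close> show False
        by (smt (verit) mult_pos_pos)
    qed
    moreover have "?E \<in> sets lebesgue" by simp
    ultimately have "?E \<in> null_sets lebesgue" by auto
    then have "AE x in lebesgue. x \<notin> ?E" by (rule AE_not_in)
    then show "AE x in lebesgue. ?M x < \<infinity>" by eventually_elim (auto simp: less_top)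
  qed
qed

section \<open>Log-Hoelder exponents and means over cubes\<close>

text \<open>A signed Bochner mean, hence 0 for non-integrable functions; integrability therefore
  accompanies every linearity and monotonicity rule.\<close>

definition mean :: "(real^'n) set \<Rightarrow> (real^'n \<Rightarrow> real) \<Rightarrow> real" where
  "mean Q f = (LINT y:Q|lebesgue. f y) / measure lebesgue Q"

lemma mean_add:
  assumes "set_integrable lebesgue Q f" "set_integrable lebesgue Q g"
  shows "mean Q (\<lambda>y. f y + g y) = mean Q f + mean Q g"
  unfolding mean_def using assms by (subst set_integral_add) (auto simp: add_divide_distrib)

lemma mean_diff:
  assumes "set_integrable lebesgue Q f" "set_integrable lebesgue Q g"
  shows "mean Q (\<lambda>y. f y - g y) = mean Q f - mean Q g"
  unfolding mean_def using assms by (subst set_integral_diff) (auto simp: diff_divide_distrib)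

lemma mean_cmult: "mean Q (\<lambda>y. c * f y) = c * mean Q f"
  unfolding mean_def by simp

lemma mean_mono:
  assumes "set_integrable lebesgue Q f" "set_integrable lebesgue Q g" "\<And>y. y \<in> Q \<Longrightarrow> f y \<le> g y"
  shows "mean Q f \<le> mean Q g"
  unfolding mean_def using assms by (intro divide_right_mono set_integral_mono) auto

lemma set_integrable_const_cube: "set_integrable lebesgue (cube a l) (\<lambda>y. c :: real)"
  by (simp add: cube_def absolutely_integrable_on_const)

lemma mean_const:
  assumes "0 < l" shows "mean (cube a l) (\<lambda>y. c) = c"
  unfolding mean_def using assms
  by (simp add: set_lebesgue_integral_def content_cube)

lemma mean_nonneg:
  assumes "\<And>y. y \<in> Q \<Longrightarrow> 0 \<le> f y"
  shows "0 \<le> mean Q f"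
  unfolding mean_def set_lebesgue_integral_def
  using assms by (intro divide_nonneg_nonneg Bochner_Integration.integral_nonneg) (auto simp: indicator_def)

text \<open>Replaces Jensen's inequality: with \<open>k\<close> half the mean of \<open>g\<close>, integration gives
  \<open>k powr u \<le> mean (g powr u)\<close>, and \<open>k\<close> and \<open>u\<close> may depend on the point.\<close>

lemma le_add_powr_mult:
  assumes "0 \<le> g" "0 < k" "1 \<le> (u::real)"
  shows "g \<le> k + k powr (1 - u) * g powr u"
proof (cases "g \<le> k")
  case False
  then have "g = g powr (1 - u) * g powr u"
    using assms by (simp add: powr_add[symmetric])
  also have "\<dots> \<le> k powr (1 - u) * g powr u"
    using False assms by (intro mult_right_mono powr_mono2') auto
  finally show ?thesis using assms by simp
qed (use assms in \<open>simp add: add_increasing2\<close>)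

text \<open>Error term that absorbs the variation of an exponent at infinity.\<close>

definition decay :: "real \<Rightarrow> real^'n \<Rightarrow> real" where
  "decay m x = (exp 1 + norm x) powr (- m)"

lemma exp_1_plus_ge: "1 \<le> exp 1 + norm (x :: 'a :: real_normed_vector)" "0 < exp 1 + norm x"
  using norm_ge_zero[of x] one_le_exp_iff[of 1] by (smt (verit) exp_gt_zero)+

lemma decay_pos: "0 < decay m x"
  unfolding decay_def using exp_1_plus_ge[of x] by simp

lemma decay_le_1: "0 \<le> m \<Longrightarrow> decay m x \<le> 1"
  unfolding decay_def using exp_1_plus_ge[of x] powr_mono[of "- m" 0 "exp 1 + norm x"] by simp

lemma continuous_decay: "continuous_on S (decay m :: real^'n \<Rightarrow> real)"
proof -
  have "exp 1 + norm x \<noteq> 0" for x :: "real^'n"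
    using exp_1_plus_ge(2)[of x] by linarith
  then show ?thesis unfolding decay_def by (intro continuous_intros) simp_all
qed

lemma continuous_imp_lebesgue_measurable:
  fixes f :: "real^'n \<Rightarrow> real"
  shows "continuous_on UNIV f \<Longrightarrow> f \<in> borel_measurable lebesgue"
  using borel_measurable_continuous_onI[of f] by (intro measurable_completion) simp

lemma measurable_decay [measurable]: "decay m \<in> borel_measurable lebesgue"
  by (intro continuous_imp_lebesgue_measurable continuous_decay)

lemma set_integrable_decay: "set_integrable lebesgue (cube a l) (decay m)"
  unfolding cube_def by (intro absolutely_integrable_continuous continuous_decay)

text \<open>With j the integer part of |x|, the ball of radius 1 + j has volume of order (1 + j)^n.
  A decay of order n + 2 therefore leaves the convergent series of 1/(1 + j)^2.\<close>

lemma decay_integrable: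
  assumes m: "real CARD('n) + 2 \<le> m"
  shows "\<exists>H\<ge>0. (\<integral>\<^sup>+ x. ennreal (decay m (x :: real^'n)) \<partial>lebesgue) \<le> ennreal H"
proof -
  let ?n = "real CARD('n)"
  define V where "V = unit_ball_vol ?n"
  have V: "0 \<le> V" by (simp add: V_def)
  let ?c = "\<lambda>j::nat. (1 + real j) powr (- (?n + 2))"
  have sm: "summable (\<lambda>j::nat. V * inverse ((1 + real j) ^ 2))"
    using inverse_power_summable[of 2, where 'a = real]
    by (intro summable_mult) (simp add: summable_Suc_iff[of "\<lambda>j. inverse (real j ^ 2)", symmetric] add.commute)
  have "(\<integral>\<^sup>+ x. ennreal (decay m (x :: real^'n)) \<partial>lebesgue)
     \<le> (\<integral>\<^sup>+ x. (\<Sum>j. ennreal (?c j) * indicator (cball 0 (1 + real j)) (x :: real^'n)) \<partial>lebesgue)"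
  proof (intro nn_integral_mono)
    fix x :: "real^'n"
    define j where "j = nat \<lfloor>norm x\<rfloor>"
    have j: "real j \<le> norm x" "norm x \<le> 1 + real j" unfolding j_def by auto linarith
    have "decay m x \<le> (1 + norm x) powr (- m)"
      unfolding decay_def using m one_le_exp_iff[of "1::real"] by (intro powr_mono2') (auto intro: add_pos_nonneg)
    also have "\<dots> \<le> (1 + norm x) powr (- (?n + 2))"
      using m by (intro powr_mono) auto
    also have "\<dots> \<le> ?c j" using j by (intro powr_mono2') auto
    finally have "ennreal (decay m x) \<le> ennreal (?c j) * indicator (cball 0 (1 + real j)) x"
      using j by (simp add: ennreal_leI)
    also have "\<dots> \<le> (\<Sum>j. ennreal (?c j) * indicator (cball 0 (1 + real j)) x)"
      by (rule order_trans[OF _ sum_le_suminf[OF _ finite.insertI[OF finite.emptyI, of j]]])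
         (simp_all only: sum.insert finite.emptyI empty_iff not_False_eq_True sum.empty add_0_right order_refl zero_le summableI)
    finally show "ennreal (decay m x) \<le> (\<Sum>j. ennreal (?c j) * indicator (cball 0 (1 + real j)) x)" .
  qed
  also have "\<dots> = (\<Sum>j. \<integral>\<^sup>+ x. ennreal (?c j) * indicator (cball 0 (1 + real j)) (x :: real^'n) \<partial>lebesgue)"
    by (intro nn_integral_suminf borel_measurable_times_ennreal borel_measurable_const borel_measurable_indicator) simp
  also have "\<dots> = (\<Sum>j. ennreal (V * inverse ((1 + real j) ^ 2)))"
  proof (rule arg_cong[where f = suminf], rule ext)
    fix j
    have "(\<integral>\<^sup>+ x. ennreal (?c j) * indicator (cball 0 (1 + real j)) (x :: real^'n) \<partial>lebesgue)
        = ennreal (?c j) * emeasure lebesgue (cball (0::real^'n) (1 + real j))"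
      by (rule nn_integral_cmult_indicator) simp
    also have "\<dots> = ennreal (?c j) * ennreal (V * (1 + real j) ^ CARD('n))"
      by (simp add: emeasure_cball V_def)
    also have "\<dots> = ennreal (V * (?c j * (1 + real j) powr ?n))"
      using V by (subst ennreal_mult[symmetric]) (auto simp: powr_realpow mult.left_commute)
    also have "?c j * (1 + real j) powr ?n = inverse ((1 + real j) ^ 2)"
      by (subst powr_add[symmetric]) (simp add: powr_minus)
    finally show "(\<integral>\<^sup>+ x. ennreal (?c j) * indicator (cball 0 (1 + real j)) (x :: real^'n) \<partial>lebesgue)
      = ennreal (V * inverse ((1 + real j) ^ 2))" .
  qed
  also have "\<dots> = ennreal (\<Sum>j. V * inverse ((1 + real j) ^ 2))"
    using V sm by (intro suminf_ennreal2) auto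
  finally show ?thesis using V sm by (intro exI[of _ "\<Sum>j. V * inverse ((1 + real j) ^ 2)"] conjI suminf_nonneg) auto
qed

text \<open>Product form with a single constant for both conditions. It avoids divisions and passes
  directly to r/s and to functions such as 1/p.\<close>

definition log_holder :: "(real^'n \<Rightarrow> real) \<Rightarrow> real \<Rightarrow> real \<Rightarrow> bool" where
  "log_holder u L C \<longleftrightarrow> (\<forall>x y. \<bar>u x - u y\<bar> * ln (exp 1 + 1 / norm (x - y)) \<le> C) \<and>
     (\<forall>x. \<bar>u x - L\<bar> * ln (exp 1 + norm x) \<le> C)"

lemma ln_exp_1_plus: "0 \<le> t \<Longrightarrow> 1 \<le> ln (exp 1 + (t::real))"
  by (metis exp_gt_zero ln_exp ln_mono add.right_neutral add_left_mono)

lemma ln_exp_1_plus_pos: "0 \<le> t \<Longrightarrow> 0 < ln (exp 1 + (t::real))"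
  using ln_exp_1_plus[of t] by linarith

lemma log_holder_nonneg: "log_holder u L C \<Longrightarrow> 0 \<le> C"
  unfolding log_holder_def by (metis abs_zero diff_self mult_zero_left)

text \<open>The oscillation of \<open>u\<close> at distance comparable to \<open>l\<close> is of
  order 1/ln(1/l), which exactly cancels the logarithm of 1/l. The factor \<open>N\<close> allows
  for the diameter of a cube.\<close>

lemma log_holder_local:
  assumes lh: "log_holder u L C" and l: "0 < l" "l \<le> 1" and N: "1 \<le> N" and xy: "norm (x - y) \<le> N * l"
  shows "(1 / l) powr \<bar>u x - u y\<bar> \<le> exp ((ln N + 1) * C)"
proof (cases "x = y")
  case True
  then show ?thesis using log_holder_nonneg[OF lh] N l by simp
next
  case False
  define d where "d = norm (x - y)"
  have d: "0 < d" "d \<le> N * l" using False xy by (auto simp: d_def)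
  have "1 / l \<le> N * (1 / d)" using d l by (simp add: field_simps)
  then have "ln (1 / l) \<le> ln (N * (1 / d))" using l by (intro ln_mono) auto
  also have "\<dots> = ln N + ln (1 / d)" using d N by (subst ln_mult) auto
  also have "ln (1 / d) \<le> ln (exp 1 + 1 / d)" using d by (intro ln_mono) auto
  \<comment> \<open>The logarithm on the right is at least 1, so the additive ln N may be multiplied
    by it.\<close>
  also have "ln N + ln (exp 1 + 1 / d) \<le> ln N * ln (exp 1 + 1 / d) + ln (exp 1 + 1 / d)"
    using ln_exp_1_plus[of "1 / d"] d N by (simp add: mult_le_cancel_left1 not_less)
  finally have *: "ln (1 / l) \<le> (ln N + 1) * ln (exp 1 + 1 / d)" by (simp add: algebra_simps)
  have "\<bar>u x - u y\<bar> * ln (1 / l) \<le> \<bar>u x - u y\<bar> * ((ln N + 1) * ln (exp 1 + 1 / d))"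
    using * by (intro mult_left_mono) auto
  also have "\<dots> = (ln N + 1) * (\<bar>u x - u y\<bar> * ln (exp 1 + 1 / d))" by simp
  also have "\<dots> \<le> (ln N + 1) * C"
    using lh N unfolding log_holder_def d_def by (intro mult_left_mono) (auto intro: add_nonneg_nonneg)
  finally show ?thesis using l by (simp add: powr_def)
qed

text \<open>The counterpart at infinity: -ln t is at most m times ln(e + |x|), which the decay of |u
  x - L| compensates. A free \<open>D\<close> is kept because \<open>t\<close> may exceed 1, where
  the power is not monotone in the wanted direction.\<close>

lemma log_holder_infinity:
  assumes lh: "log_holder u L C" and m: "0 \<le> m" and t: "decay m x \<le> t"
    and D: "0 \<le> D" "D \<le> \<bar>u x - L\<bar>"
  shows "t powr (- D) \<le> exp (m * C)"
proof -
  have t0: "0 < t" using t decay_pos[of m x] by simp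
  have "ln (decay m x) \<le> ln t" using t decay_pos[of m x] by (intro ln_mono)
  then have *: "- ln t \<le> m * ln (exp 1 + norm x)"
    using exp_1_plus_ge[of x] by (simp add: decay_def ln_powr)
  have pos: "0 \<le> ln (exp 1 + norm x)" using ln_exp_1_plus[of "norm x"] by simp
  have "D * (- ln t) \<le> D * (m * ln (exp 1 + norm x))"
    using * D by (intro mult_left_mono)
  also have "\<dots> \<le> \<bar>u x - L\<bar> * (m * ln (exp 1 + norm x))"
    using D m pos by (intro mult_right_mono) auto
  also have "\<dots> = m * (\<bar>u x - L\<bar> * ln (exp 1 + norm x))" by simp
  also have "\<dots> \<le> m * C" using lh m unfolding log_holder_def by (intro mult_left_mono) auto
  finally show ?thesis using t0 by (simp add: powr_def)
qed

text \<open>A Jensen inequality for varying exponents. Half of the mean serves as threshold in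
  \<open>le_add_powr_mult\<close>; integration leaves the other half bounded by the mean of the
  powers, once \<open>u y\<close> has been exchanged for \<open>u x\<close>. The bound by 1 + 1/|Q|,
  valid for modular at most 1, caps large means.\<close>

lemma key_estimate:
  fixes u :: "real^'n \<Rightarrow> real"
  assumes lh: "log_holder u L C" and u: "\<And>x. 1 \<le> u x" and L: "1 \<le> L" and m: "0 \<le> m"
  shows "\<exists>K\<ge>1. \<forall>a l x g. 0 < l \<longrightarrow> x \<in> cube a l \<longrightarrow> (\<forall>y. 0 \<le> g y) \<longrightarrow>
     set_integrable lebesgue (cube a l) g \<longrightarrow> set_integrable lebesgue (cube a l) (\<lambda>y. g y powr u y) \<longrightarrow>
     mean (cube a l) g \<le> 1 + 1 / l ^ CARD('n) \<longrightarrow>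
     (mean (cube a l) g / 2) powr u x
       \<le> K * mean (cube a l) (\<lambda>y. g y powr u y) + mean (cube a l) (decay m) + decay m x"
proof -
  let ?n = "real CARD('n)"
  define K1 where "K1 = exp ((ln ?n + 1) * C) powr ?n"
  define K2 where "K2 = exp (m * C)"
  define K where "K = max K1 (K2 ^ 2)"
  have C0: "0 \<le> C" by (rule log_holder_nonneg[OF lh])
  have n1: "1 \<le> ?n" by (simp add: Suc_leI)
  have K2: "1 \<le> K2" using m C0 by (simp add: K2_def)
  have K1: "0 \<le> K1" by (simp add: K1_def)
  show ?thesis
  proof (intro exI[of _ K] conjI allI impI)
    show "1 \<le> K" using one_le_power[OF K2, of 2] by (auto simp: K_def max_def)
    fix a :: "real^'n" and l x and g :: "real^'n \<Rightarrow> real"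
    assume l: "0 < l" and x: "x \<in> cube a l" and g: "\<forall>y. 0 \<le> g y"
      and ig: "set_integrable lebesgue (cube a l) g"
      and igu: "set_integrable lebesgue (cube a l) (\<lambda>y. g y powr u y)"
      and A: "mean (cube a l) g \<le> 1 + 1 / l ^ CARD('n)"
    let ?Q = "cube a l"
    let ?B = "mean ?Q (\<lambda>y. g y powr u y)"
    define c where "c = mean ?Q g / 2"
    have A2: "mean ?Q g = c + c" by (simp add: c_def)
    have c0: "0 \<le> c" unfolding c_def using g by (intro divide_nonneg_nonneg mean_nonneg) auto
    have mu: "0 \<le> ?B" by (intro mean_nonneg) simp
    have mh: "0 \<le> mean ?Q (decay m)" by (intro mean_nonneg) (simp add: decay_pos less_imp_le)
    have h0: "0 \<le> decay m x" by (simp add: decay_pos less_imp_le)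
    have "c powr u x \<le> K * ?B + mean ?Q (decay m) + decay m x"
    proof (cases "c = 0")
      case True
      have "0 \<le> K * ?B"
        using mu \<open>1 \<le> K\<close> by simp
      then show ?thesis using mh h0 True by simp
    next
      case False
      with c0 have c: "0 < c" by simp
      have cu: "c powr (u x - 1) * c = c powr u x" "c powr (u x - 1) * c powr (1 - u x) = 1"
        using c by (simp_all add: powr_diff powr_add[symmetric])
      \<comment> \<open>Above 1 the local condition exchanges the exponents, below
        \<open>decay m x\<close> the error term alone suffices, and in between the exchange goes
        through the value \<open>L\<close> at infinity.\<close>
      consider (big) "1 < c" | (tiny) "c \<le> 1" "c < decay m x" | (mid) "c \<le> 1" "decay m x \<le> c"
        by linarith
      then show ?thesis
      proof cases
        case big
        \<comment> \<open>A half-mean above 1 forces |Q| < 1 and is itself at most 1/|Q|, which is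
          what the local condition can handle.\<close>
        define q where "q = l ^ CARD('n)"
        have q: "0 < q" using l by (simp add: q_def)
        have "2 * c \<le> 1 + 1 / q" using A A2 by (simp add: q_def)
        with big have cq: "c \<le> 1 / q" and "1 < 1 / q" by linarith+
        then have "q < 1" using q by (simp add: field_simps)
        then have l1: "l \<le> 1"
          unfolding q_def using l by (meson leI less_imp_le not_less one_le_power)
        have "g y \<le> c + K1 * c powr (1 - u x) * g y powr u y" if "y \<in> ?Q" for y
        proof -
          have "c powr (1 - u y) = c powr (u x - u y) * c powr (1 - u x)"
            using c by (simp add: powr_add[symmetric])
          also have "c powr (u x - u y) \<le> c powr \<bar>u x - u y\<bar>"
            using big by (intro powr_mono) auto
          also have "\<dots> \<le> ((1 / l) powr ?n) powr \<bar>u x - u y\<bar>"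
            using c cq l by (intro powr_mono2) (auto simp: q_def powr_realpow power_one_over)
          also have "\<dots> = ((1 / l) powr \<bar>u x - u y\<bar>) powr ?n" by (simp add: powr_powr mult.commute)
          also have "\<dots> \<le> K1"
            unfolding K1_def using log_holder_local[OF lh l l1 n1 norm_cube[OF x that]]
            by (intro powr_mono2) auto
          finally have "c powr (1 - u y) \<le> K1 * c powr (1 - u x)" by (simp add: mult_right_mono)
          then have "c powr (1 - u y) * g y powr u y \<le> K1 * c powr (1 - u x) * g y powr u y"
            by (intro mult_right_mono) auto
          with le_add_powr_mult[of "g y" c "u y"] g u c show ?thesis by (smt (verit))
        qed
        then have "mean ?Q g \<le> mean ?Q (\<lambda>y. c + K1 * c powr (1 - u x) * g y powr u y)"
          by (intro mean_mono set_integral_add ig set_integrable_const_cube set_integrable_mult_right igu)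
        also have "\<dots> = c + K1 * c powr (1 - u x) * ?B"
          using l by (subst mean_add) (auto simp: mean_const mean_cmult igu intro: set_integrable_const_cube)
        finally have "c \<le> K1 * c powr (1 - u x) * ?B" using A2 by simp
        then have "c powr (u x - 1) * c \<le> c powr (u x - 1) * (K1 * c powr (1 - u x) * ?B)"
          by (intro mult_left_mono) auto
        also have "\<dots> = (c powr (u x - 1) * c powr (1 - u x)) * (K1 * ?B)" by simp
        finally have "c powr u x \<le> K1 * ?B" unfolding cu by simp
        also have "\<dots> \<le> K * ?B"
          using mu by (intro mult_right_mono) (auto simp: K_def)
        finally show ?thesis using mh h0 by simp
      next
        case tiny
        have "c powr u x \<le> c powr 1" using c tiny u by (intro powr_mono') auto
        moreover have "0 \<le> K * ?B" using mu \<open>1 \<le> K\<close> by simp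
        ultimately show ?thesis using tiny c mh by simp
      next
        case mid
        have "g y \<le> c + decay m y + K2 ^ 2 * c powr (1 - u x) * g y powr u y" if "y \<in> ?Q" for y
        proof -
          \<comment> \<open>Raising the threshold to \<open>decay m y\<close> makes
            \<open>log_holder_infinity\<close> applicable at \<open>y\<close>, at the cost of the
            mean of the decay. One factor \<open>K2\<close> pays for passing from \<open>u y\<close>
            to \<open>L\<close>, the other for passing from \<open>L\<close> to
            \<open>u x\<close>.\<close>
          define k where "k = max c (decay m y)"
          have k: "0 < k" "k \<le> 1" "c \<le> k" "decay m y \<le> k"
            using c mid decay_le_1[OF m, of y] by (auto simp: k_def)
          have "k powr (1 - u y) = k powr (L - u y) * k powr (1 - L)"
            using k by (simp add: powr_add[symmetric])
          also have "\<dots> \<le> K2 * c powr (1 - L)"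
          proof (intro mult_mono)
            have "k powr (L - u y) \<le> k powr (- \<bar>u y - L\<bar>)" using k by (intro powr_mono') auto
            also have "\<dots> \<le> K2" unfolding K2_def using k by (intro log_holder_infinity[OF lh m]) auto
            finally show "k powr (L - u y) \<le> K2" .
            show "k powr (1 - L) \<le> c powr (1 - L)" using c k L by (intro powr_mono2') auto
          qed (use K2 in auto)
          also have "c powr (1 - L) = c powr (u x - L) * c powr (1 - u x)"
            using c by (simp add: powr_add[symmetric])
          also have "c powr (u x - L) \<le> c powr (- \<bar>u x - L\<bar>)" using c mid by (intro powr_mono') auto
          also have "\<dots> \<le> K2" unfolding K2_def using mid by (intro log_holder_infinity[OF lh m]) auto
          finally have "k powr (1 - u y) \<le> K2 ^ 2 * c powr (1 - u x)"
            using K2 by (simp add: mult_left_mono mult_right_mono power2_eq_square mult.assoc)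
          then have "k powr (1 - u y) * g y powr u y \<le> K2 ^ 2 * c powr (1 - u x) * g y powr u y"
            by (intro mult_right_mono) auto
          moreover have "g y \<le> k + k powr (1 - u y) * g y powr u y"
            using le_add_powr_mult[of "g y" k "u y"] g u k by auto
          moreover have "k \<le> c + decay m y" using c decay_pos[of m y] by (simp add: k_def)
          ultimately show ?thesis by linarith
        qed
        then have "mean ?Q g \<le> mean ?Q (\<lambda>y. c + decay m y + K2 ^ 2 * c powr (1 - u x) * g y powr u y)"
          by (intro mean_mono set_integral_add ig set_integrable_const_cube set_integrable_decay set_integrable_mult_right igu)
        also have "\<dots> = mean ?Q (\<lambda>y. c + decay m y) + mean ?Q (\<lambda>y. K2 ^ 2 * c powr (1 - u x) * g y powr u y)"
          by (intro mean_add set_integral_add set_integrable_const_cube set_integrable_decay set_integrable_mult_right igu)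
        also have "\<dots> = c + mean ?Q (decay m) + K2 ^ 2 * c powr (1 - u x) * ?B"
          using l by (subst mean_add) (auto simp: mean_const mean_cmult intro: set_integrable_const_cube set_integrable_decay)
        finally have "c \<le> mean ?Q (decay m) + K2 ^ 2 * c powr (1 - u x) * ?B" using A2 by simp
        then have "c powr (u x - 1) * c \<le> c powr (u x - 1) * (mean ?Q (decay m) + K2 ^ 2 * c powr (1 - u x) * ?B)"
          by (intro mult_left_mono) auto
        also have "\<dots> = c powr (u x - 1) * mean ?Q (decay m) + (c powr (u x - 1) * c powr (1 - u x)) * (K2 ^ 2 * ?B)"
          by (simp add: algebra_simps)
        finally have "c powr u x \<le> c powr (u x - 1) * mean ?Q (decay m) + K2 ^ 2 * ?B" unfolding cu by simp
        moreover have "c powr (u x - 1) * mean ?Q (decay m) \<le> 1 * mean ?Q (decay m)"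
          using c mid u mh by (intro mult_right_mono) (auto intro: powr_le1)
        moreover have "K2 ^ 2 * ?B \<le> K * ?B"
          using mu by (intro mult_right_mono) (auto simp: K_def)
        ultimately show ?thesis using h0 by linarith
      qed
    qed
    then show "(mean ?Q g / 2) powr u x
       \<le> K * ?B + mean ?Q (decay m) + decay m x" by (simp add: c_def)
  qed
qed

section \<open>Exponent classes and the limit at infinity\<close>

lemma var_exponentD:
  assumes "p \<in> var_exponent"
  shows "p \<in> borel_measurable lebesgue" "1 < p x" "1 < (INF x. p x)" "(INF x. p x) \<le> p x" "p x \<le> (SUP x. p x)"
proof -
  have b: "bdd_below (range p)" using assms by (intro bdd_belowI[of _ 1]) (auto simp: var_exponent_def less_imp_le)
  show "(INF x. p x) \<le> p x" using b by (intro cINF_lower) auto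
  show "p x \<le> (SUP x. p x)" using assms by (intro cSUP_upper) (auto simp: var_exponent_def)
qed (use assms in \<open>auto simp: var_exponent_def\<close>)

text \<open>The constant in the decay condition must be the limit at infinity because the bound on
  the difference tends to 0; this identifies it with \<open>limit_exponent p\<close>.\<close>

lemma log_exponentD:
  fixes p :: "real^'n \<Rightarrow> real"
  assumes "p \<in> log_exponent"
  shows "p \<in> var_exponent" "(p \<longlongrightarrow> limit_exponent p) at_infinity" "\<exists>C. log_holder p (limit_exponent p) C"
    "(INF x. p x) \<le> limit_exponent p"
proof -
  show v: "p \<in> var_exponent" using assms by (simp add: log_exponent_def)
  obtain Cl Ci l where C: "Cl > 0" "Ci > 0"
    "\<And>x y. \<bar>p x - p y\<bar> \<le> Cl / ln (exp 1 + 1 / norm (x - y))"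
    "\<And>x. \<bar>p x - l\<bar> \<le> Ci / ln (exp 1 + norm x)"
    using assms by (auto simp: log_exponent_def)
  have "((\<lambda>x::real^'n. Ci / ln (exp 1 + norm x)) \<longlongrightarrow> 0) at_infinity"
    by (rule real_tendsto_divide_at_top[OF tendsto_const filterlim_compose[OF ln_at_top
        filterlim_tendsto_add_at_top[OF tendsto_const filterlim_norm_at_top]]])
  then have "((\<lambda>x. p x - l) \<longlongrightarrow> 0) at_infinity"
    by (rule Lim_null_comparison[rotated]) (simp add: C(4))
  then have t: "(p \<longlongrightarrow> l) at_infinity" by (rule LIM_zero_cancel)
  moreover have "\<not> trivial_limit (at_infinity :: (real^'n) filter)"
    by (rule trivial_limit_at_infinity)
  ultimately have l: "limit_exponent p = l" unfolding limit_exponent_def by (intro tendsto_Lim) auto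
  show "(p \<longlongrightarrow> limit_exponent p) at_infinity" using t l by simp
  show "(INF x. p x) \<le> limit_exponent p"
    by (rule tendsto_lowerbound[OF t[folded l]]) (auto simp: var_exponentD(4)[OF v] trivial_limit_at_infinity)
  have "log_holder p l (max Cl Ci)"
    unfolding log_holder_def
  proof (intro conjI allI)
    fix x y
    have "\<bar>p x - p y\<bar> * ln (exp 1 + 1 / norm (x - y)) \<le> Cl"
      using C(3)[of x y] ln_exp_1_plus_pos[of "1 / norm (x - y)"] by (simp add: pos_le_divide_eq)
    then show "\<bar>p x - p y\<bar> * ln (exp 1 + 1 / norm (x - y)) \<le> max Cl Ci" by simp
    have "\<bar>p x - l\<bar> * ln (exp 1 + norm x) \<le> Ci"
      using C(4)[of x] ln_exp_1_plus_pos[of "norm x"] by (simp add: pos_le_divide_eq)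
    then show "\<bar>p x - l\<bar> * ln (exp 1 + norm x) \<le> max Cl Ci" by simp
  qed
  then show "\<exists>C. log_holder p (limit_exponent p) C" unfolding l by blast
qed

lemma decay_0: "decay 0 = (\<lambda>x :: real^'n. 1)"
proof
  fix x :: "real^'n"
  show "decay 0 x = 1" using exp_1_plus_ge(2)[of x] by (simp add: decay_def)
qed

lemma log_holder_scale:
  assumes "log_holder u L C" "1 \<le> s"
  shows "log_holder (\<lambda>x. u x / s) (L / s) C"
proof -
  have *: "\<bar>a / s - b / s\<bar> * t \<le> C" if "\<bar>a - b\<bar> * t \<le> C" "0 \<le> t" for a b t
  proof -
    have "\<bar>a / s - b / s\<bar> = \<bar>a - b\<bar> / s" using assms(2) by (simp add: diff_divide_distrib[symmetric])
    also have "\<dots> \<le> \<bar>a - b\<bar>" using assms(2) by (simp add: divide_le_eq mult_le_cancel_left1)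
    finally show ?thesis using that by (meson mult_right_mono order_trans)
  qed
  show ?thesis
    using assms(1) unfolding log_holder_def by (intro conjI allI * less_imp_le[OF ln_exp_1_plus_pos]) auto
qed

section \<open>Functions of modular at most one and their means over cubes\<close>

lemma integrable_imp_set_integrable:
  fixes f :: "'a \<Rightarrow> 'b :: {banach, second_countable_topology}"
  shows "integrable M f \<Longrightarrow> A \<in> sets M \<Longrightarrow> set_integrable M A f"
  unfolding set_integrable_def by (rule integrable_mult_indicator)

lemma set_integral_le_integral:
  fixes f :: "'a \<Rightarrow> real"
  assumes f: "integrable M f" "\<And>x. 0 \<le> f x" and A: "A \<in> sets M"
  shows "(LINT x:A|M. f x) \<le> (LINT x|M. f x)"
  unfolding set_lebesgue_integral_def
  by (rule integral_mono[OF integrable_mult_indicator[OF A f(1)] f(1)]) (auto simp: indicator_def f(2))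

text \<open>The normalisation used throughout: homogeneity reduces norm estimates to functions of
  modular at most 1. It is instantiated with \<open>r\<close> for the input and with
  \<open>q\<close> for the commutator.\<close>

locale unit_modular =
  fixes r g :: "real^'n \<Rightarrow> real"
  assumes r [measurable]: "r \<in> borel_measurable lebesgue" and r1: "\<And>x. 1 \<le> r x"
    and g [measurable]: "g \<in> borel_measurable lebesgue" and g0: "\<And>x. 0 \<le> g x"
    and modular_le: "(\<integral>\<^sup>+ x. ennreal (g x powr r x) \<partial>lebesgue) \<le> 1"
begin

lemma integrable_powr: "integrable lebesgue (\<lambda>x. g x powr r x)"
  using modular_le by (intro integrableI_nonneg) (auto simp: less_top[symmetric] top_unique intro: le_less_trans)

text \<open>For 0 \<le> u \<le> r the power is at most 1 + g^r, and constants are integrable on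
  cubes. The cases u = 1 and u = r/s are the ones needed later.\<close>

lemma set_integrable_powr:
  assumes [measurable]: "u \<in> borel_measurable lebesgue" and u: "\<And>x. 0 \<le> u x" "\<And>x. u x \<le> r x"
  shows "set_integrable lebesgue (cube a l) (\<lambda>x. g x powr u x)"
proof -
  have i: "set_integrable lebesgue (cube a l) (\<lambda>x. 1 + g x powr r x)"
    by (intro set_integral_add set_integrable_const_cube integrable_imp_set_integrable integrable_powr) simp
  have "g x powr u x \<le> 1 + g x powr r x" for x
  proof (cases "g x \<le> 1")
    case True
    then have "g x powr u x \<le> 1" using g0 u by (intro powr_le1) auto
    then show ?thesis by (simp add: add_increasing2)
  next
    case False
    then have "g x powr u x \<le> g x powr r x" using u by (intro powr_mono) auto
    then show ?thesis by simp
  qed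
  then show ?thesis
    by (intro set_integrable_bound[OF i]) (auto simp: set_borel_measurable_def)
qed

lemma set_integrable_self: "set_integrable lebesgue (cube a l) g"
  using set_integrable_powr[of "\<lambda>_. 1" a l] r1 g0 by simp

lemma mean_powr_le:
  assumes "0 < l" shows "mean (cube a l) (\<lambda>x. g x powr r x) \<le> 1 / l ^ CARD('n)"
proof -
  have "(LINT x:cube a l|lebesgue. g x powr r x) \<le> (LINT x|lebesgue. g x powr r x)"
    by (intro set_integral_le_integral integrable_powr) auto
  also have "\<dots> = enn2real (\<integral>\<^sup>+ x. ennreal (g x powr r x) \<partial>lebesgue)"
    by (intro integral_eq_nn_integral) auto
  also have "\<dots> \<le> 1" using enn2real_mono[OF modular_le] by simp
  finally show ?thesis unfolding mean_def using assms by (simp add: content_cube divide_right_mono)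
qed

lemma mean_self_le:
  assumes "0 < l" shows "mean (cube a l) g \<le> 1 + 1 / l ^ CARD('n)"
proof -
  have "mean (cube a l) g \<le> mean (cube a l) (\<lambda>x. 1 + g x powr r x)"
  proof (intro mean_mono set_integrable_self set_integral_add set_integrable_const_cube set_integrable_powr)
    fix x show "g x \<le> 1 + g x powr r x" using le_add_powr_mult[of "g x" 1 "r x"] g0 r1 by simp
    show "0 \<le> r x" using r1[of x] by simp
  qed auto
  also have "\<dots> = 1 + mean (cube a l) (\<lambda>x. g x powr r x)"
    using assms by (subst mean_add) (auto simp: mean_const intro!: set_integrable_const_cube set_integrable_powr order_trans[OF zero_le_one r1])
  also have "\<dots> \<le> 1 + 1 / l ^ CARD('n)" using mean_powr_le[OF assms] by simp
  finally show ?thesis .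
qed

end

lemma mean_decay_le:
  assumes "(\<integral>\<^sup>+ x. ennreal (decay m (x :: real^'n)) \<partial>lebesgue) \<le> ennreal H" "0 \<le> H" "0 < l"
  shows "mean (cube a l) (decay m :: real^'n \<Rightarrow> real) \<le> H / l ^ CARD('n)"
proof -
  have i: "integrable lebesgue (decay m :: real^'n \<Rightarrow> real)"
    using assms by (intro integrableI_nonneg) (auto simp: decay_pos less_imp_le intro: le_less_trans)
  have "(LINT x:cube a l|lebesgue. decay m x) \<le> (LINT x|lebesgue. decay m (x :: real^'n))"
    by (intro set_integral_le_integral i) (auto simp: decay_pos less_imp_le)
  also have "\<dots> = enn2real (\<integral>\<^sup>+ x. ennreal (decay m (x :: real^'n)) \<partial>lebesgue)"
    by (intro integral_eq_nn_integral) (auto simp: decay_pos less_imp_le)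
  also have "\<dots> \<le> H" using enn2real_mono[OF assms(1)] assms(2) by simp
  finally show ?thesis unfolding mean_def using assms by (simp add: content_cube divide_right_mono)
qed

text \<open>\<open>key_estimate\<close> with m = 0, where the decay is the constant 1: on a small
  cube this error is at most 1/|Q|, the same order as the main term. Then the root of order
  \<open>r x\<close> is taken.\<close>

lemma mean_small_cube:
  fixes r :: "real^'n \<Rightarrow> real"
  assumes lh: "log_holder r L C" and r1: "\<And>x. 1 \<le> r x" and L: "1 \<le> L"
  shows "\<exists>K\<ge>1. \<forall>g a l x. unit_modular r g \<longrightarrow> 0 < l \<longrightarrow> l \<le> 1 \<longrightarrow> x \<in> cube a l \<longrightarrow>
    mean (cube a l) g \<le> K * (l ^ CARD('n)) powr (- (1 / r x))"
proof -
  obtain K where K: "1 \<le> K" "\<And>a l x g. 0 < l \<Longrightarrow> x \<in> cube a l \<Longrightarrow> (\<And>y. 0 \<le> g y) \<Longrightarrow>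
     set_integrable lebesgue (cube a l) g \<Longrightarrow> set_integrable lebesgue (cube a l) (\<lambda>y. g y powr r y) \<Longrightarrow>
     mean (cube a l) g \<le> 1 + 1 / l ^ CARD('n) \<Longrightarrow>
     (mean (cube a l) g / 2) powr r x
       \<le> K * mean (cube a l) (\<lambda>y. g y powr r y) + mean (cube a l) (decay 0) + decay 0 x"
    using key_estimate[OF lh r1 L order_refl] by blast
  show ?thesis
  proof (intro exI[of _ "2 * (K + 2)"] conjI allI impI)
    show "1 \<le> 2 * (K + 2)" using K by simp
    fix g and a x :: "real^'n" and l
    assume um: "unit_modular r g" and l: "0 < l" "l \<le> 1" "x \<in> cube a l"
    interpret unit_modular r g by fact
    let ?v = "l ^ CARD('n)"
    have v: "0 < ?v" "?v \<le> 1" using l by (auto simp: power_le_one)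
    have r0: "0 \<le> r x" "0 < r x" for x using r1[of x] by auto
    have A0: "0 \<le> mean (cube a l) g" by (intro mean_nonneg g0)
    have "(mean (cube a l) g / 2) powr r x
       \<le> K * mean (cube a l) (\<lambda>y. g y powr r y) + mean (cube a l) (decay 0) + decay 0 x"
      by (intro K l g0 set_integrable_self set_integrable_powr mean_self_le r r0 order_refl)
    also have "\<dots> = K * mean (cube a l) (\<lambda>y. g y powr r y) + 1 + 1"
      using l by (simp add: decay_0 mean_const)
    also have "\<dots> \<le> K * (1 / ?v) + 1 / ?v + 1 / ?v"
      using K(1) v by (intro add_mono mult_left_mono mean_powr_le l) (auto simp: field_simps)
    also have "\<dots> = (K + 2) / ?v" by (simp add: add_divide_distrib)
    finally have "((mean (cube a l) g / 2) powr r x) powr (1 / r x) \<le> ((K + 2) / ?v) powr (1 / r x)"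
      using r0 by (intro powr_mono2) auto
    also have "\<dots> = (K + 2) powr (1 / r x) * ?v powr (- (1 / r x))"
      using K v by (simp add: powr_divide powr_minus_divide)
    also have "\<dots> \<le> (K + 2) powr 1 * ?v powr (- (1 / r x))"
      using K r1[of x] by (intro mult_right_mono powr_mono) auto
    finally show "mean (cube a l) g \<le> 2 * (K + 2) * ?v powr (- (1 / r x))"
      using A0 r0[of x] K(1) by (simp add: powr_powr algebra_simps)
  qed
qed

text \<open>All exponents are compared with \<open>L\<close>, so no point of the cube enters the
  bound. The total mass of the decay is finite, and 1/|Q| is at most |Q|^(-1/L) for a large
  cube.\<close>

lemma mean_large_cube:
  fixes r :: "real^'n \<Rightarrow> real"
  assumes lh: "log_holder r L C" and r1: "\<And>x. 1 \<le> r x" and L: "1 \<le> L"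
  shows "\<exists>K\<ge>1. \<forall>g a l. unit_modular r g \<longrightarrow> 1 \<le> l \<longrightarrow>
    mean (cube a l) g \<le> K * (l ^ CARD('n)) powr (- (1 / L))"
proof -
  define m where "m = real CARD('n) + 2"
  have m: "0 \<le> m" by (simp add: m_def)
  obtain H where H: "0 \<le> H" "(\<integral>\<^sup>+ x. ennreal (decay m (x :: real^'n)) \<partial>lebesgue) \<le> ennreal H"
    using decay_integrable[where 'n = 'n and m = m] by (auto simp: m_def)
  define K where "K = exp (m * C)"
  have K: "0 \<le> K" by (simp add: K_def)
  show ?thesis
  proof (intro exI[of _ "1 + H + K"] conjI allI impI)
    show "1 \<le> 1 + H + K" using K H by simp
    fix g and a :: "real^'n" and l
    assume um: "unit_modular r g" and l: "1 \<le> (l :: real)"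
    interpret unit_modular r g by fact
    have l0: "0 < l" using l by simp
    have r0: "0 \<le> r x" "0 < r x" for x using r1[of x] by auto
    let ?v = "l ^ CARD('n)" let ?Q = "cube a l"
    have v: "1 \<le> ?v" using l by simp
    \<comment> \<open>The solution of c = c^(1 - L) / |Q|, which balances the two terms of
      \<open>le_add_powr_mult\<close>.\<close>
    define c where "c = ?v powr (- (1 / L))"
    have c: "0 < c" "c \<le> 1" using v L l0 powr_mono[of "- (1 / L)" 0 ?v] by (auto simp: c_def)
    have cv: "c powr (1 - L) / ?v = c"
    proof -
      have e: "- (1 / L) * (1 - L) + - 1 = - (1 / L)" using L by (simp add: field_simps)
      have "c powr (1 - L) * ?v powr (- 1) = c"
        unfolding c_def powr_powr powr_add[symmetric] e ..
      then show ?thesis using l0 by (simp add: powr_minus_divide)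
    qed
    have "1 / ?v = ?v powr (- 1)" using v l0 by (simp add: powr_minus_divide)
    also have "\<dots> \<le> c" unfolding c_def using v L by (intro powr_mono) auto
    finally have vc: "1 / ?v \<le> c" .
    have ptw: "g y \<le> c + decay m y + K * c powr (1 - L) * g y powr r y" for y
    proof -
      define k where "k = max c (decay m y)"
      have k: "0 < k" "k \<le> 1" "c \<le> k" "decay m y \<le> k"
        using c decay_le_1[OF m, of y] by (auto simp: k_def)
      have "k powr (1 - r y) = k powr (L - r y) * k powr (1 - L)"
        using k by (simp add: powr_add[symmetric])
      also have "\<dots> \<le> K * c powr (1 - L)"
      proof (intro mult_mono)
        have "k powr (L - r y) \<le> k powr (- \<bar>r y - L\<bar>)" using k by (intro powr_mono') auto
        also have "\<dots> \<le> K" unfolding K_def using k by (intro log_holder_infinity[OF lh m]) auto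
        finally show "k powr (L - r y) \<le> K" .
        show "k powr (1 - L) \<le> c powr (1 - L)" using c k L by (intro powr_mono2') auto
      qed (use K in auto)
      finally have "k powr (1 - r y) * g y powr r y \<le> K * c powr (1 - L) * g y powr r y"
        by (intro mult_right_mono) auto
      moreover have "g y \<le> k + k powr (1 - r y) * g y powr r y"
        using le_add_powr_mult[of "g y" k "r y"] g0 r1 k by auto
      moreover have "k \<le> c + decay m y" using c decay_pos[of m y] by (simp add: k_def)
      ultimately show ?thesis by linarith
    qed
    have ir: "set_integrable lebesgue ?Q (\<lambda>y. g y powr r y)"
      by (intro set_integrable_powr r r0 order_refl)
    have "mean ?Q g \<le> mean ?Q (\<lambda>y. c + decay m y + K * c powr (1 - L) * g y powr r y)"
      by (intro mean_mono set_integral_add set_integrable_self set_integrable_const_cube set_integrable_decay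
          set_integrable_mult_right ir ptw)
    also have "\<dots> = mean ?Q (\<lambda>y. c + decay m y) + mean ?Q (\<lambda>y. K * c powr (1 - L) * g y powr r y)"
      by (intro mean_add set_integral_add set_integrable_const_cube set_integrable_decay set_integrable_mult_right ir)
    also have "\<dots> = c + mean ?Q (decay m) + K * c powr (1 - L) * mean ?Q (\<lambda>y. g y powr r y)"
      using l0 by (subst mean_add) (auto simp: mean_const mean_cmult intro: set_integrable_const_cube set_integrable_decay)
    also have "\<dots> \<le> c + H / ?v + K * c powr (1 - L) * (1 / ?v)"
      using K H l0 by (intro add_mono mult_left_mono mean_powr_le mean_decay_le) auto
    also have "\<dots> = c + H * (1 / ?v) + K * (c powr (1 - L) / ?v)" by simp
    also have "\<dots> \<le> c + H * c + K * c"
      unfolding cv using H K vc by (intro add_mono mult_left_mono) auto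
    finally show "mean ?Q g \<le> (1 + H + K) * ?v powr (- (1 / L))" by (simp add: c_def algebra_simps)
  qed
qed

text \<open>The bound on \<open>A\<close> reads v^(1/L) \<le> K / A. Raising it to the power L * e
  trades the volume factor for a negative power of \<open>A\<close>.\<close>

lemma hedberg_powr:
  assumes A: "0 \<le> A" "A \<le> K * v powr (- (1 / L))" and v: "0 < v" and L: "0 < (L::real)" and e: "0 \<le> e"
    and K: "0 < K"
  shows "v powr e * A \<le> K powr (L * e) * A powr (1 - L * e)"
proof (cases "A = 0")
  case False
  with A have A0: "0 < A" by simp
  have "A * v powr (1 / L) \<le> K" using A v by (simp add: powr_minus_divide field_simps)
  then have *: "v powr (1 / L) \<le> K / A" using A0 by (simp add: field_simps)
  have "v powr e = (v powr (1 / L)) powr (L * e)" using L by (simp add: powr_powr)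
  also have "\<dots> \<le> (K / A) powr (L * e)" using * L e by (intro powr_mono2) auto
  also have "\<dots> = K powr (L * e) / A powr (L * e)" using A0 K by (simp add: powr_divide)
  finally have "v powr e * A \<le> K powr (L * e) / A powr (L * e) * A"
    using A0 by (intro mult_right_mono) auto
  also have "\<dots> = K powr (L * e) * A powr (1 - L * e)" using A0 by (simp add: powr_diff)
  finally show ?thesis .
qed simp

lemma powr_add3_le:
  assumes "0 \<le> a" "0 \<le> b" "0 \<le> (c::real)" "0 \<le> s"
  shows "(a + b + c) powr s \<le> 3 powr s * (a powr s + b powr s + c powr s)"
proof -
  define M where "M = max a (max b c)"
  have "(a + b + c) powr s \<le> (3 * M) powr s" using assms by (intro powr_mono2) (auto simp: M_def)
  also have "\<dots> = 3 powr s * M powr s" using assms by (simp add: powr_mult)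
  also have "M powr s \<le> a powr s + b powr s + c powr s"
    unfolding M_def max_def by (auto intro: add_increasing add_increasing2)
  finally show ?thesis by (simp add: mult_left_mono)
qed

lemma set_nn_integral_eq_mean:
  fixes a :: "real^'n"
  assumes "set_integrable lebesgue (cube a l) f" "\<And>y. 0 \<le> f y" "0 < l"
  shows "(\<integral>\<^sup>+ y \<in> cube a l. ennreal (f y) \<partial>lebesgue) = ennreal (l ^ CARD('n) * mean (cube a l) f)"
proof -
  have "(\<integral>\<^sup>+ y \<in> cube a l. ennreal (f y) \<partial>lebesgue) = ennreal (LINT y:cube a l|lebesgue. f y)"
  proof -
    have "(\<integral>\<^sup>+ y \<in> cube a l. ennreal (f y) \<partial>lebesgue) = (\<integral>\<^sup>+ y. ennreal (indicator (cube a l) y *\<^sub>R f y) \<partial>lebesgue)"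
      by (intro nn_integral_cong) (auto simp: indicator_def)
    also have "\<dots> = ennreal (LINT y:cube a l|lebesgue. f y)"
      unfolding set_lebesgue_integral_def
      using assms(1,2) by (intro nn_integral_eq_integral) (auto simp: set_integrable_def)
    finally show ?thesis .
  qed
  also have "(LINT y:cube a l|lebesgue. f y) = l ^ CARD('n) * mean (cube a l) f"
    using assms(3) by (simp add: mean_def content_cube)
  finally show ?thesis .
qed

lemma mean_le_frac_maximal:
  fixes x :: "real^'n"
  assumes "set_integrable lebesgue (cube a l) f" "\<And>y. 0 \<le> f y" "0 < l" "x \<in> cube a l" "frac_maximal 0 f x < \<infinity>"
  shows "mean (cube a l) f \<le> enn2real (frac_maximal 0 f x)"
proof -
  have m: "0 \<le> mean (cube a l) f" by (intro mean_nonneg assms)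
  have "ennreal (mean (cube a l) f) = ennreal (l ^ CARD('n) * mean (cube a l) f) / ennreal (l ^ CARD('n))"
    using m assms(3) by (subst divide_ennreal) auto
  also have "\<dots> = (\<integral>\<^sup>+ y \<in> cube a l. ennreal (f y) \<partial>lebesgue) / ennreal (l ^ CARD('n))"
    using assms by (subst set_nn_integral_eq_mean) auto
  also have "\<dots> \<le> frac_maximal 0 f x"
    using frac_maximal_upper[OF assms(3,4), of f 0] assms(2,3) by simp
  finally have "enn2real (ennreal (mean (cube a l) f)) \<le> enn2real (frac_maximal 0 f x)"
    using assms(5) by (intro enn2real_mono) auto
  then show ?thesis using m by simp
qed

section \<open>The fractional maximal function on variable Lebesgue spaces\<close>

lemma mult_ge_one: "1 \<le> a \<Longrightarrow> 1 \<le> b \<Longrightarrow> 1 \<le> a * (b :: real)"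
  using mult_mono[of 1 a 1 b] by simp

text \<open>Real-variable core of Hedberg's argument: on small cubes the trivial bound for the mean has
  exponent \<open>1 / r x\<close>, on large cubes only \<open>1 / L\<close>; there the discrepancy between \<open>r x\<close> and \<open>L\<close>
  is absorbed by the decay term.\<close>

lemma hedberg_small:
  assumes A: "0 \<le> A" "A \<le> K * v powr (- (1 / r))" and v: "0 < v" and r: "1 < (r::real)" and q: "1 < q"
    and e: "0 \<le> e" "1 / q = 1 / r - e" and K: "1 \<le> K"
  shows "(v powr e * A) powr q \<le> K powr q * A powr r"
proof -
  have rq: "1 - r * e = r / q" using e(2) r by (simp add: field_simps)
  have "r * e \<le> 1" using rq r q by (smt (verit) divide_pos_pos)
  have "v powr e * A \<le> K powr (r * e) * A powr (1 - r * e)"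
    using A v r e K by (intro hedberg_powr) auto
  also have "\<dots> \<le> K powr 1 * A powr (r / q)"
    unfolding rq using \<open>r * e \<le> 1\<close> K by (intro mult_right_mono powr_mono) auto
  finally have "(v powr e * A) powr q \<le> (K * A powr (r / q)) powr q"
    using A K q by (intro powr_mono2) auto
  also have "\<dots> = K powr q * A powr r" using q by (simp add: powr_mult powr_powr)
  finally show ?thesis .
qed

text \<open>The trade leaves \<open>A powr (1 - L * e)\<close> where \<open>A powr (r x / q)\<close>
  is wanted; the quotient \<open>A powr ((r x - L) * e)\<close> is bounded while \<open>A\<close>
  lies between \<open>decay (m / \<theta>) x\<close> and 2. For smaller \<open>A\<close> the
  exponent 1 - L * e \<ge> \<theta> brings the power below \<open>decay m x\<close>.\<close>

lemma hedberg_large: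
  fixes x :: "real^'n"
  assumes lh: "log_holder r L C" and A: "0 \<le> A" "A \<le> 2" "A \<le> K * v powr (- (1 / L))" and v: "0 < v"
    and r: "1 < r x" "r x \<le> R" and L: "1 < L" "L \<le> R" and q: "1 < q"
    and e: "0 \<le> e" "1 / q = 1 / r x - e" and K: "1 \<le> K"
    and \<theta>: "0 < \<theta>" "L * e \<le> 1 - \<theta>" and m: "0 \<le> m"
  shows "(v powr e * A) powr q \<le> (K * (2 powr R * exp (m / \<theta> * C))) powr q * (A powr r x + decay m x)"
proof -
  define K5 where "K5 = 2 powr R * exp (m / \<theta> * C)"
  have C: "0 \<le> C" by (rule log_holder_nonneg[OF lh])
  have ge: "1 \<le> exp (m / \<theta> * C)" "1 \<le> 2 powr R"
    using m \<theta> C L by (auto intro: ge_one_powr_ge_zero)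
  have K5: "2 powr R \<le> K5" "exp (m / \<theta> * C) \<le> K5" "1 \<le> K5"
    using mult_left_mono[OF ge(1), of "2 powr R"] mult_right_mono[OF ge(2), of "exp (m / \<theta> * C)"] mult_ge_one[OF ge(2,1)]
    unfolding K5_def by simp_all
  have rq: "1 - r x * e = r x / q" using e(2) r by (simp add: field_simps)
  have e1: "e \<le> 1" using e(2) r q by (smt (verit) divide_le_eq_1 divide_pos_pos)
  have Le: "L * e \<le> 1" using \<theta> by simp
  have 1: "v powr e * A \<le> K * A powr (1 - L * e)"
  proof -
    have "v powr e * A \<le> K powr (L * e) * A powr (1 - L * e)"
      using A v L e K by (intro hedberg_powr) auto
    also have "\<dots> \<le> K powr 1 * A powr (1 - L * e)"
      using Le K by (intro mult_right_mono powr_mono) auto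
    finally show ?thesis using K by simp
  qed
  have dec: "0 < decay m x" by (rule decay_pos)
  show ?thesis unfolding K5_def[symmetric]
  proof (cases "decay (m / \<theta>) x \<le> A")
    case True
    then have A0: "0 < A" using decay_pos[of "m / \<theta>" x] by simp
    \<comment> \<open>The modulus of the exponent discrepancy. It is at most |r x - L| since e \<le>
      1, as \<open>log_holder_infinity\<close> demands.\<close>
    define D where "D = \<bar>r x - L\<bar> * e"
    have D: "0 \<le> D" "D \<le> \<bar>r x - L\<bar>" using e e1 by (auto simp: D_def mult_le_cancel_left2)
    have "A powr ((r x - L) * e) \<le> K5"
    proof (cases "1 \<le> A")
      case True
      have "A powr ((r x - L) * e) \<le> A powr D" using True e by (intro powr_mono) (auto simp: D_def mult_right_mono)
      also have "\<dots> \<le> 2 powr D" using A A0 D by (intro powr_mono2) auto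
      also have "\<dots> \<le> 2 powr R" using D r L by (intro powr_mono) auto
      finally show ?thesis using K5 by simp
    next
      case False
      have "- D \<le> (r x - L) * e"
        unfolding D_def using e mult_right_mono[of "- \<bar>r x - L\<bar>" "r x - L" e] by simp
      then have "A powr ((r x - L) * e) \<le> A powr (- D)" using False A0 by (intro powr_mono') auto
      also have "\<dots> \<le> exp (m / \<theta> * C)" using True D m \<theta> by (intro log_holder_infinity[OF lh]) auto
      finally show ?thesis using K5 by simp
    qed
    moreover have "A powr (1 - L * e) = A powr (r x / q) * A powr ((r x - L) * e)"
      unfolding rq[symmetric] powr_add[symmetric] by (simp add: algebra_simps)
    ultimately have "v powr e * A \<le> K * (A powr (r x / q) * K5)"
      using 1 K by (smt (verit) mult_left_mono powr_ge_zero)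
    then have "(v powr e * A) powr q \<le> ((K * K5) * A powr (r x / q)) powr q"
      using A q by (intro powr_mono2) (auto simp: mult_ac)
    also have "\<dots> = (K * K5) powr q * A powr r x" using q K K5 by (simp add: powr_mult powr_powr)
    also have "\<dots> \<le> (K * K5) powr q * (A powr r x + decay m x)"
      using dec by (intro mult_left_mono) auto
    finally show "(v powr e * A) powr q \<le> (K * K5) powr q * (A powr r x + decay m x)" .
  next
    case False
    have b: "1 \<le> exp 1 + norm x" by (rule exp_1_plus_ge)
    have "A powr (1 - L * e) \<le> decay (m / \<theta>) x powr (1 - L * e)"
      using A False Le by (intro powr_mono2) auto
    also have "\<dots> \<le> decay (m / \<theta>) x powr \<theta>"
      using \<theta> decay_le_1[of "m / \<theta>" x] m decay_pos[of "m / \<theta>" x] by (intro powr_mono') auto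
    also have "\<dots> = decay m x" using \<theta> by (simp add: decay_def powr_powr)
    finally have "v powr e * A \<le> K * decay m x" using 1 K by (smt (verit) mult_left_mono)
    then have "(v powr e * A) powr q \<le> (K * decay m x) powr q"
      using A q by (intro powr_mono2) auto
    also have "\<dots> = K powr q * decay m x powr q" by (simp add: powr_mult)
    also have "\<dots> \<le> (K * K5) powr q * decay m x powr 1"
      using K K5 q dec decay_le_1[OF m, of x] by (intro mult_mono powr_mono2 powr_mono') (auto simp: mult_le_cancel_left1)
    also have "\<dots> \<le> (K * K5) powr q * (A powr r x + decay m x)"
      using dec by (intro mult_left_mono) auto
    finally show "(v powr e * A) powr q \<le> (K * K5) powr q * (A powr r x + decay m x)" .
  qed
qed

text \<open>The order \<eta> varies with the point, so the conclusion is phrased through a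
  measurable majorant \<open>G\<close>; measurability of the maximal function of variable order need
  not be discussed. One \<open>G\<close> bounds the means over all cubes containing the
  point.\<close>

proposition frac_maximal_modular:
  fixes r q \<eta> :: "real^'n \<Rightarrow> real"
  assumes r: "r \<in> log_exponent" and q: "q \<in> var_exponent"
    and \<eta>: "\<And>x. 0 \<le> \<eta> x" "\<And>x. 1 / q x = 1 / r x - \<eta> x / real CARD('n)"
    and \<theta>: "0 < \<theta>" "\<And>x. limit_exponent r * (\<eta> x / real CARD('n)) \<le> 1 - \<theta>"
  shows "\<exists>K\<ge>1. \<forall>f. f \<in> borel_measurable lebesgue \<longrightarrow> modular r f \<le> 1 \<longrightarrow>
     (\<exists>G \<in> borel_measurable lebesgue. (\<forall>x. 0 \<le> G x) \<and> (\<integral>\<^sup>+ x. ennreal (G x) \<partial>lebesgue) \<le> ennreal K \<and>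
       (AE x in lebesgue. frac_maximal (\<eta> x) f x \<le> ennreal (G x powr (1 / q x))))"
    (is "\<exists>K\<ge>1. \<forall>f. _ \<longrightarrow> _ \<longrightarrow> ?G K f")
proof -
  define L where "L = limit_exponent r"
  \<comment> \<open>As s > 1, the maximal theorem applies to |f|^(r/s); its s-th power is |f|^r, of
    integral at most 1.\<close>
  define s where "s = (INF x. r x)"
  define R where "R = max (SUP x. r x) L"
  define R' where "R' = (SUP x. q x)"
  define m where "m = real CARD('n) + 2"
  note rv = var_exponentD[OF log_exponentD(1)[OF r]]
  note qv = var_exponentD[OF q]
  have [measurable]: "r \<in> borel_measurable lebesgue" by (rule rv)
  have s: "1 < s" "\<And>x. s \<le> r x" "s \<le> L" using rv log_exponentD(4)[OF r] by (auto simp: s_def L_def)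
  have R: "\<And>x. r x \<le> R" "L \<le> R" using rv(5) by (auto simp: R_def intro: le_max_iff_disj[THEN iffD2])
  have R': "\<And>x. q x \<le> R'" using qv by (auto simp: R'_def)
  have m: "0 \<le> m" by (simp add: m_def)
  obtain C where lh: "log_holder r L C" using log_exponentD(3)[OF r] by (auto simp: L_def)
  have r1: "1 \<le> r x" for x using s(1,2) by (meson less_imp_le order_trans)
  have L1: "1 \<le> L" "1 < L" using s by auto
  obtain H where H: "0 \<le> H" "(\<integral>\<^sup>+ x. ennreal (decay m (x :: real^'n)) \<partial>lebesgue) \<le> ennreal H"
    using decay_integrable[where 'n = 'n and m = m] by (auto simp: m_def)
  obtain K0 where K0: "1 \<le> K0" "\<And>a l x g. 0 < l \<Longrightarrow> x \<in> cube a l \<Longrightarrow> (\<And>y. 0 \<le> g y) \<Longrightarrow>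
     set_integrable lebesgue (cube a l) g \<Longrightarrow> set_integrable lebesgue (cube a l) (\<lambda>y. g y powr (r y / s)) \<Longrightarrow>
     mean (cube a l) g \<le> 1 + 1 / l ^ CARD('n) \<Longrightarrow>
     (mean (cube a l) g / 2) powr (r x / s)
       \<le> K0 * mean (cube a l) (\<lambda>y. g y powr (r y / s)) + mean (cube a l) (decay m) + decay m x"
    using key_estimate[OF log_holder_scale[OF lh], of s m] s m by (auto simp: divide_simps)
  obtain B where B: "0 < B" "\<And>f :: real^'n \<Rightarrow> real. f \<in> borel_measurable lebesgue \<Longrightarrow>
     (\<integral>\<^sup>+ x. ennreal (enn2real (frac_maximal 0 f x) powr s) \<partial>lebesgue)
       \<le> ennreal B * (\<integral>\<^sup>+ x. ennreal (\<bar>f x\<bar> powr s) \<partial>lebesgue)"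
    "\<And>f :: real^'n \<Rightarrow> real. f \<in> borel_measurable lebesgue \<Longrightarrow>
      (\<integral>\<^sup>+ x. ennreal (\<bar>f x\<bar> powr s) \<partial>lebesgue) < \<infinity> \<Longrightarrow> (AE x in lebesgue. frac_maximal 0 f x < \<infinity>)"
    using maximal_strong_type[OF s(1), where 'n = 'n] by blast
  obtain K1 where K1: "1 \<le> K1" "\<And>g a l x. unit_modular r g \<Longrightarrow> 0 < l \<Longrightarrow> l \<le> 1 \<Longrightarrow> x \<in> cube a l \<Longrightarrow>
    mean (cube a l) g \<le> K1 * (l ^ CARD('n)) powr (- (1 / r x))"
    using mean_small_cube[OF lh r1 L1(1)] by blast
  obtain K2 where K2: "1 \<le> K2" "\<And>g a l. unit_modular r g \<Longrightarrow> 1 \<le> l \<Longrightarrow>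
    mean (cube a l) g \<le> K2 * (l ^ CARD('n)) powr (- (1 / L))"
    using mean_large_cube[OF lh r1 L1(1)] by blast
  define K5 where "K5 = 2 powr R * exp (m / \<theta> * C)"
  have "0 \<le> C" by (rule log_holder_nonneg[OF lh])
  then have K5: "1 \<le> K5" unfolding K5_def using m \<theta> R L1
    by (intro mult_ge_one ge_one_powr_ge_zero) (auto simp: one_le_exp_iff)
  define M where "M = max K1 K2 * K5"
  \<comment> \<open>\<open>M\<close> is at least 1, so the largest value of \<open>q\<close> removes
    the point from the exponent of the constant.\<close>
  define K6 where "K6 = M powr R'"
  have R'0: "0 \<le> R'" using R'[of 0] qv(2)[of 0] by simp
  have KK: "1 \<le> M" unfolding M_def using K1(1) K2(1) K5 by (intro mult_ge_one) auto
  have K6: "1 \<le> K6" unfolding K6_def using R'0 KK by (intro ge_one_powr_ge_zero) auto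
  define K7 where "K7 = 2 powr R * 3 powr s"
  have K7: "1 \<le> K7" unfolding K7_def using R L1 s by (intro mult_ge_one ge_one_powr_ge_zero) auto
  define J where "J = K6 * (K7 * (K0 powr s * B + B * H + H) + H)"
  \<comment> \<open>The three powers are those of the terms of \<open>key_estimate\<close> for the
    exponent r/s, with means replaced by maximal functions; the final decay comes from
    \<open>hedberg_large\<close>. In \<open>K7\<close> the factor 2^R undoes halving the mean and
    3^s splits the power of the sum.\<close>
  define G where "G f x = K6 * (K7 * ((K0 * enn2real (frac_maximal 0 (\<lambda>y. \<bar>f y\<bar> powr (r y / s)) x)) powr s
      + enn2real (frac_maximal 0 (decay m) x) powr s + decay m x powr s) + decay m x)" for f x
  have hs: "(\<integral>\<^sup>+ x. ennreal (decay m (x::real^'n) powr s) \<partial>lebesgue) \<le> ennreal H"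
  proof -
    have "decay m x powr s \<le> decay m x" for x :: "real^'n"
      using powr_mono'[of 1 s "decay m x"] decay_le_1[OF m, of x] decay_pos[of m x] s by simp
    then have "(\<integral>\<^sup>+ x. ennreal (decay m (x::real^'n) powr s) \<partial>lebesgue) \<le> (\<integral>\<^sup>+ x. ennreal (decay m (x::real^'n)) \<partial>lebesgue)"
      using decay_pos by (intro nn_integral_mono ennreal_leI) (auto simp: less_imp_le)
    then show ?thesis using H by simp
  qed
  have abs_decay: "\<bar>decay m x\<bar> = decay m x" for x :: "real^'n" using decay_pos[of m x] by simp
  have Mh: "(\<integral>\<^sup>+ x. ennreal (enn2real (frac_maximal 0 (decay m) (x::real^'n)) powr s) \<partial>lebesgue) \<le> ennreal (B * H)"
  proof -
    have "(\<integral>\<^sup>+ x. ennreal (enn2real (frac_maximal 0 (decay m) (x::real^'n)) powr s) \<partial>lebesgue)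
       \<le> ennreal B * (\<integral>\<^sup>+ x. ennreal (\<bar>decay m (x::real^'n)\<bar> powr s) \<partial>lebesgue)"
      by (rule B(2)) simp
    also have "\<dots> \<le> ennreal B * ennreal H" unfolding abs_decay by (intro mult_left_mono hs) simp
    finally show ?thesis using B H by (simp add: ennreal_mult)
  qed
  \<comment> \<open>An infinite maximal function would become 0 under \<open>enn2real\<close>;
    finiteness is what allows means to be bounded by it.\<close>
  have Mhfin: "AE x in lebesgue. frac_maximal 0 (decay m) (x::real^'n) < \<infinity>"
    by (rule B(3)) (auto simp: abs_decay intro: le_less_trans[OF hs])
  show ?thesis
  proof (intro exI[of _ "max 1 J"] conjI allI impI)
    fix f :: "real^'n \<Rightarrow> real"
    assume f [measurable]: "f \<in> borel_measurable lebesgue" and mod: "modular r f \<le> 1"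
    define g where "g y = \<bar>f y\<bar>" for y
    define F where "F y = g y powr (r y / s)" for y
    have [measurable]: "g \<in> borel_measurable lebesgue" unfolding g_def by measurable
    let ?MF = "\<lambda>x. enn2real (frac_maximal 0 F x)" and ?Mh = "\<lambda>x :: real^'n. enn2real (frac_maximal 0 (decay m) x)"
    interpret unit_modular r g
      using mod r1 by unfold_locales (auto simp: g_def modular_def)
    have [measurable]: "F \<in> borel_measurable lebesgue" unfolding F_def by measurable
    have F0: "\<bar>F y\<bar> = F y" "0 \<le> F y" for y by (auto simp: F_def)
    have Fs: "F x powr s = g x powr r x" for x using s by (simp add: F_def powr_powr)
    have MF: "(\<integral>\<^sup>+ x. ennreal (?MF x powr s) \<partial>lebesgue) \<le> ennreal B"
    proof -
      have "(\<integral>\<^sup>+ x. ennreal (?MF x powr s) \<partial>lebesgue)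
        \<le> ennreal B * (\<integral>\<^sup>+ x. ennreal (\<bar>F x\<bar> powr s) \<partial>lebesgue)" by (rule B(2)) simp
      also have "\<dots> \<le> ennreal B * 1" unfolding F0 Fs by (intro mult_left_mono modular_le) simp
      finally show ?thesis by simp
    qed
    have MFfin: "AE x in lebesgue. frac_maximal 0 F x < \<infinity>"
      by (rule B(3)) (auto simp: F0 Fs intro: le_less_trans[OF modular_le])
    have Geq: "G f x = K6 * (K7 * ((K0 * ?MF x) powr s
      + ?Mh x powr s + decay m x powr s) + decay m x)" for x
      unfolding G_def F_def[abs_def] g_def ..
    show "?G (max 1 J) f"
    proof (intro bexI[of _ "G f"] conjI allI)
      show "G f \<in> borel_measurable lebesgue" unfolding Geq[abs_def] by measurable
      show G0: "0 \<le> G f x" for x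
        unfolding Geq using K6 K7 decay_pos[of m x] by (intro mult_nonneg_nonneg add_nonneg_nonneg) auto
      have "(\<integral>\<^sup>+ x. ennreal (G f x) \<partial>lebesgue) = (\<integral>\<^sup>+ x. ennreal K6 * (ennreal K7 * (ennreal (K0 powr s) * ennreal (?MF x powr s)
         + ennreal (?Mh x powr s) + ennreal (decay m x powr s)) + ennreal (decay m x)) \<partial>lebesgue)"
        unfolding Geq using K6 K7 K0(1)
        by (intro nn_integral_cong)
           (simp add: ennreal_mult[symmetric] ennreal_plus[symmetric] decay_pos less_imp_le powr_mult del: ennreal_plus)
      also have "\<dots> = ennreal K6 * (ennreal K7 * (ennreal (K0 powr s) * (\<integral>\<^sup>+ x. ennreal (?MF x powr s) \<partial>lebesgue)
         + (\<integral>\<^sup>+ x. ennreal (?Mh x powr s) \<partial>lebesgue) + (\<integral>\<^sup>+ x. ennreal (decay m (x::real^'n) powr s) \<partial>lebesgue))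
         + (\<integral>\<^sup>+ x. ennreal (decay m (x::real^'n)) \<partial>lebesgue))"
        by (simp add: nn_integral_cmult nn_integral_add)
      also have "\<dots> \<le> ennreal K6 * (ennreal K7 * (ennreal (K0 powr s) * ennreal B + ennreal (B * H) + ennreal H) + ennreal H)"
        by (intro mult_left_mono add_mono MF Mh hs H) auto
      also have "\<dots> = ennreal J"
        using K6 K7 K0(1) B(1) H(1) unfolding J_def
        by (simp add: ennreal_mult[symmetric] ennreal_plus[symmetric] del: ennreal_plus)
      also have "\<dots> \<le> ennreal (max 1 J)" by (intro ennreal_leI) simp
      finally show "(\<integral>\<^sup>+ x. ennreal (G f x) \<partial>lebesgue) \<le> ennreal (max 1 J)" .
      show "AE x in lebesgue. frac_maximal (\<eta> x) f x \<le> ennreal (G f x powr (1 / q x))"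
        using MFfin Mhfin
      proof eventually_elim
        fix x assume fin: "frac_maximal 0 F x < \<infinity>" "frac_maximal 0 (decay m) x < \<infinity>"
        let ?N = "real CARD('n)"
        show "frac_maximal (\<eta> x) f x \<le> ennreal (G f x powr (1 / q x))"
        proof (rule frac_maximal_least)
          fix a l assume l: "0 < l" "x \<in> cube a l"
          define v where "v = l ^ CARD('n)"
          let ?W = "(K0 * ?MF x) powr s + ?Mh x powr s + decay m x powr s"
          define A where "A = mean (cube a l) g"
          have v: "0 < v" using l by (simp add: v_def)
          have A0: "0 \<le> A" unfolding A_def by (intro mean_nonneg g0)
          have iF: "set_integrable lebesgue (cube a l) F"
            unfolding F_def
          proof (intro set_integrable_powr)
            show "0 \<le> r x / s" "r x / s \<le> r x" for x
              using s r1[of x] by (auto simp: divide_le_eq mult_le_cancel_left1)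
          qed measurable
          have "(A / 2) powr (r x / s) \<le> K0 * mean (cube a l) F + mean (cube a l) (decay m) + decay m x"
            unfolding A_def F_def by (intro K0(2) l g0 set_integrable_self mean_self_le iF[unfolded F_def])
          also have "\<dots> \<le> K0 * ?MF x + ?Mh x + decay m x"
            using K0(1) by (intro add_mono mult_left_mono mean_le_frac_maximal iF F0 l fin set_integrable_decay order_refl)
              (auto simp: decay_pos less_imp_le)
          finally have "((A / 2) powr (r x / s)) powr s \<le> (K0 * ?MF x + ?Mh x + decay m x) powr s"
            using s by (intro powr_mono2) auto
          also have "\<dots> \<le> 3 powr s * (?W)"
            using K0(1) s by (intro powr_add3_le) (auto simp: decay_pos less_imp_le)
          finally have A2: "(A / 2) powr r x \<le> 3 powr s * (?W)"
            using s by (simp add: powr_powr)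
          have "A powr r x = 2 powr r x * (A / 2) powr r x" by (simp add: powr_mult[symmetric])
          also have "\<dots> \<le> 2 powr R * (3 powr s * (?W))"
            using R by (intro mult_mono A2 powr_mono) auto
          finally have Ar: "A powr r x + decay m x \<le> G f x / K6"
            using K6 by (simp add: Geq K7_def mult.assoc)
          have qx: "1 < q x" by (rule qv)
          have eN: "0 \<le> \<eta> x / ?N" using \<eta>(1) by simp
          have "(v powr (\<eta> x / ?N) * A) powr q x \<le> M powr q x * (A powr r x + decay m x)"
          proof (cases "l \<le> 1")
            case True
            have "(v powr (\<eta> x / ?N) * A) powr q x \<le> K1 powr q x * A powr r x"
              using K1(2)[OF unit_modular_axioms l(1) True l(2)] rv(2) \<eta>(2)
              by (intro hedberg_small A0 v qx eN K1(1)) (auto simp: A_def v_def)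
            also have "\<dots> \<le> M powr q x * (A powr r x + decay m x)"
            proof (intro mult_mono powr_mono2)
              have "K1 * 1 \<le> M" unfolding M_def using K1(1) K5 by (intro mult_mono) auto
              then show "K1 \<le> M" by simp
            qed (use K1(1) qx decay_pos[of m x] in auto)
            finally show ?thesis .
          next
            case False
            then have l1: "1 \<le> l" by simp
            have "A \<le> 1 + 1 / v" unfolding A_def v_def by (rule mean_self_le[OF l(1)])
            moreover have "1 \<le> v" using l1 by (simp add: v_def)
            ultimately have "A \<le> 2" by (smt (verit) divide_le_eq_1)
            then have "(v powr (\<eta> x / ?N) * A) powr q x \<le> (K2 * (2 powr R * exp (m / \<theta> * C))) powr q x * (A powr r x + decay m x)"
              using K2(2)[OF unit_modular_axioms l1] rv(2) \<eta>(2) R L1 \<theta> eN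
              by (intro hedberg_large[OF lh A0 _ _ v _ _ L1(2) R(2) qx eN _ K2(1) \<theta>(1) _ m]) (auto simp: A_def v_def L_def)
            also have "\<dots> \<le> M powr q x * (A powr r x + decay m x)"
              unfolding K5_def[symmetric] M_def using K2(1) K5 qx decay_pos[of m x]
              by (intro mult_right_mono powr_mono2) auto
            finally show ?thesis .
          qed
          also have "\<dots> \<le> K6 * (G f x / K6)"
          proof (intro mult_mono Ar)
            show "M powr q x \<le> K6"
              unfolding K6_def using R' KK by (intro powr_mono) auto
            show "0 \<le> A powr r x + decay m x" using decay_pos[of m x] by (intro add_nonneg_nonneg) auto
          qed (use K6 in auto)
          finally have "(v powr (\<eta> x / ?N) * A) powr q x \<le> G f x" using K6 by simp
          then have "((v powr (\<eta> x / ?N) * A) powr q x) powr (1 / q x) \<le> G f x powr (1 / q x)"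
            using qx by (intro powr_mono2) auto
          then have le: "v powr (\<eta> x / ?N) * A \<le> G f x powr (1 / q x)"
            using qx A0 by (simp add: powr_powr)
          have "absint (cube a l) f = ennreal (v * A)"
            unfolding A_def v_def using set_nn_integral_eq_mean[OF set_integrable_self g0 l(1), of a]
            by (simp add: g_def[abs_def])
          then have "absint (cube a l) f / ennreal ((l ^ CARD('n)) powr (1 - \<eta> x / ?N))
            = ennreal (v * A / v powr (1 - \<eta> x / ?N))"
            using v A0 by (simp add: v_def[symmetric] divide_ennreal)
          also have "v * A / v powr (1 - \<eta> x / ?N) = v powr (\<eta> x / ?N) * A"
            using v by (simp add: powr_diff)
          finally show "absint (cube a l) f / ennreal ((l ^ CARD('n)) powr (1 - \<eta> x / ?N))
            \<le> ennreal (G f x powr (1 / q x))" using le by (simp add: ennreal_leI)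
        qed
      qed
    qed
  qed simp
qed

section \<open>Sufficiency\<close>

lemma frac_maximal_cong_AE:
  assumes "AE y in lebesgue. f y = g y"
  shows "frac_maximal \<eta> f x = frac_maximal \<eta> g x"
proof -
  have "(\<integral>\<^sup>+ y \<in> Q. ennreal \<bar>f y\<bar> \<partial>lebesgue) = (\<integral>\<^sup>+ y \<in> Q. ennreal \<bar>g y\<bar> \<partial>lebesgue)" for Q
    using assms by (intro nn_integral_cong_AE) auto
  then show ?thesis unfolding frac_maximal_def by simp
qed

lemma frac_maximal_cmult:
  fixes f :: "real^'n \<Rightarrow> real"
  assumes f [measurable]: "f \<in> borel_measurable lebesgue"
  shows "frac_maximal \<eta> (\<lambda>y. c * f y) x = ennreal \<bar>c\<bar> * frac_maximal \<eta> f x"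
proof -
  have "(\<integral>\<^sup>+ y \<in> Q. ennreal \<bar>c * f y\<bar> \<partial>lebesgue) = ennreal \<bar>c\<bar> * (\<integral>\<^sup>+ y \<in> Q. ennreal \<bar>f y\<bar> \<partial>lebesgue)"
    if "Q \<in> cubes" for Q
  proof -
    have [measurable]: "Q \<in> sets lebesgue" using that by (auto simp: cubes_eq)
    show ?thesis
      by (subst nn_integral_cmult[symmetric]) (auto simp: abs_mult ennreal_mult mult.assoc)
  qed
  then show ?thesis
    unfolding frac_maximal_def SUP_mult_left_ennreal
    by (intro SUP_cong) (auto simp: ennreal_times_divide)
qed

text \<open>A coefficient l^\<delta> equals |Q|^(\<delta>/n) and thus raises the order of the
  maximal function of \<open>f\<close> from \<alpha> to \<alpha> + \<delta>. Extended nonnegative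
  values allow the comparison before finiteness is known.\<close>

lemma frac_maximal_compare:
  fixes x :: "real^'n"
  assumes [measurable]: "h \<in> borel_measurable lebesgue" "k \<in> borel_measurable lebesgue" "f \<in> borel_measurable lebesgue"
    and c: "0 \<le> c" "0 \<le> d" "0 \<le> E"
    and le: "\<And>a l y. 0 < l \<Longrightarrow> x \<in> cube a l \<Longrightarrow> y \<in> cube a l \<Longrightarrow> c * \<bar>h y\<bar> \<le> d * \<bar>k y\<bar> + E * l powr \<delta> * \<bar>f y\<bar>"
  shows "ennreal c * frac_maximal \<alpha> h x \<le> ennreal d * frac_maximal \<alpha> k x + ennreal E * frac_maximal (\<alpha> + \<delta>) f x"
proof -
  let ?N = "real CARD('n)"
  have N: "0 < ?N" by simp
  have "frac_maximal \<alpha> (\<lambda>y. c * h y) x \<le> ennreal d * frac_maximal \<alpha> k x + ennreal E * frac_maximal (\<alpha> + \<delta>) f x"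
  proof (rule frac_maximal_least)
    fix a l assume l: "0 < l" "x \<in> cube a l"
    let ?v = "l ^ CARD('n)"
    let ?m = "?v powr (1 - \<alpha> / ?N)"
    let ?I = "\<lambda>f. \<integral>\<^sup>+ y \<in> cube a l. ennreal \<bar>f y\<bar> \<partial>lebesgue"
    have v: "0 < ?v" "0 < ?m" using l by auto
    have "?I (\<lambda>y. c * h y) \<le> (\<integral>\<^sup>+ y. ennreal d * (ennreal \<bar>k y\<bar> * indicator (cube a l) y)
         + ennreal (E * l powr \<delta>) * (ennreal \<bar>f y\<bar> * indicator (cube a l) y) \<partial>lebesgue)"
    proof (intro nn_integral_mono)
      fix y
      have "ennreal \<bar>c * h y\<bar> \<le> ennreal d * ennreal \<bar>k y\<bar> + ennreal (E * l powr \<delta>) * ennreal \<bar>f y\<bar>" if "y \<in> cube a l"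
        using le[OF l that] c
        by (simp add: ennreal_mult[symmetric] ennreal_plus[symmetric] abs_mult ennreal_leI del: ennreal_plus)
      then show "ennreal \<bar>c * h y\<bar> * indicator (cube a l) y \<le> ennreal d * (ennreal \<bar>k y\<bar> * indicator (cube a l) y)
         + ennreal (E * l powr \<delta>) * (ennreal \<bar>f y\<bar> * indicator (cube a l) y)"
        by (auto simp: indicator_def)
    qed
    also have "\<dots> = ennreal d * ?I k + ennreal (E * l powr \<delta>) * ?I f"
      by (subst nn_integral_add) (auto simp: nn_integral_cmult)
    finally have "?I (\<lambda>y. c * h y) / ennreal ?m \<le> (ennreal d * ?I k + ennreal (E * l powr \<delta>) * ?I f) / ennreal ?m"
      by (rule divide_right_mono_ennreal)
    also have "\<dots> = ennreal d * (?I k / ennreal ?m) + ennreal (E * l powr \<delta>) * ?I f / ennreal ?m"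
      by (simp add: add_divide_distrib_ennreal ennreal_times_divide)
    also have "ennreal (E * l powr \<delta>) * ?I f / ennreal ?m = ennreal E * (?I f / ennreal (?v powr (1 - (\<alpha> + \<delta>) / ?N)))"
    proof -
      have "l powr \<delta> = ?v powr (\<delta> / ?N)" using l by (simp add: powr_realpow[symmetric] powr_powr)
      then have *: "?m = l powr \<delta> * ?v powr (1 - (\<alpha> + \<delta>) / ?N)"
        using v by (simp add: powr_add[symmetric] add_divide_distrib)
      have "ennreal (E * l powr \<delta>) * ?I f / ennreal ?m
        = (ennreal (l powr \<delta>) * (ennreal E * ?I f)) / (ennreal (l powr \<delta>) * ennreal (?v powr (1 - (\<alpha> + \<delta>) / ?N)))"
        unfolding * using c l by (simp add: ennreal_mult mult_ac)
      also have "\<dots> = ennreal E * ?I f / ennreal (?v powr (1 - (\<alpha> + \<delta>) / ?N))"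
        using l v by (simp add: mult.commute[of "ennreal (l powr \<delta>)"] divide_mult_eq)
      finally show ?thesis by (simp add: ennreal_times_divide)
    qed
    also have "ennreal d * (?I k / ennreal ?m) + ennreal E * (?I f / ennreal (?v powr (1 - (\<alpha> + \<delta>) / ?N)))
      \<le> ennreal d * frac_maximal \<alpha> k x + ennreal E * frac_maximal (\<alpha> + \<delta>) f x"
      using l by (intro add_mono mult_left_mono frac_maximal_upper) auto
    finally show "?I (\<lambda>y. c * h y) / ennreal ?m \<le> ennreal d * frac_maximal \<alpha> k x + ennreal E * frac_maximal (\<alpha> + \<delta>) f x" .
  qed
  then show ?thesis using c by (simp add: frac_maximal_cmult)
qed

text \<open>On cubes of side at most 1 the factor |Q|^(\<alpha>/n) is at most 1; on larger ones it
  is at most |Q|^((\<alpha> + \<delta>)/n). This yields finiteness at order \<alpha> from the two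
  orders that are controlled.\<close>

lemma frac_maximal_le_add:
  fixes x :: "real^'n"
  assumes "0 \<le> \<alpha>" "0 \<le> \<delta>"
  shows "frac_maximal \<alpha> f x \<le> frac_maximal 0 f x + frac_maximal (\<alpha> + \<delta>) f x"
proof (rule frac_maximal_least)
  fix a l assume l: "0 < l" "x \<in> cube a l"
  let ?N = "real CARD('n)"
  let ?v = "l ^ CARD('n)"
  let ?I = "\<integral>\<^sup>+ y \<in> cube a l. ennreal \<bar>f y\<bar> \<partial>lebesgue"
  have div: "?I / ennreal m \<le> ?I / ennreal m'" if "m' \<le> m" "0 < m'" for m m'
    unfolding divide_ennreal_def using that by (intro mult_left_mono) (auto simp: inverse_ennreal intro!: ennreal_leI)
  show "?I / ennreal (?v powr (1 - \<alpha> / ?N)) \<le> frac_maximal 0 f x + frac_maximal (\<alpha> + \<delta>) f x"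
  proof (cases "l \<le> 1")
    case True
    then have v: "0 < ?v" "?v \<le> 1" using l by (auto simp: power_le_one)
    have "?I / ennreal (?v powr (1 - \<alpha> / ?N)) \<le> ?I / ennreal (?v powr (1 - 0 / ?N))"
      using v assms l by (intro div powr_mono') auto
    also have "\<dots> \<le> frac_maximal 0 f x" by (rule frac_maximal_upper[OF l])
    finally show ?thesis by (simp add: add_increasing2)
  next
    case False
    then have v: "1 \<le> ?v" by simp
    have "?I / ennreal (?v powr (1 - \<alpha> / ?N)) \<le> ?I / ennreal (?v powr (1 - (\<alpha> + \<delta>) / ?N))"
      using v assms l by (intro div powr_mono) (auto simp: divide_right_mono)
    also have "\<dots> \<le> frac_maximal (\<alpha> + \<delta>) f x" by (rule frac_maximal_upper[OF l])
    finally show ?thesis by (simp add: add_increasing)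
  qed
qed

section \<open>Modular, norm and boundedness of the commutator\<close>

text \<open>Since p \<ge> 1, a factor 1/k with k \<ge> 1 shrinks the modular at least linearly. A
  modular bound K therefore turns into a norm bound with the same K.\<close>

lemma modular_shrink:
  assumes "1 \<le> k" "\<And>x. 1 \<le> p x" and [measurable]: "p \<in> borel_measurable lebesgue" "f \<in> borel_measurable lebesgue"
  shows "modular p (\<lambda>x. f x / k) \<le> ennreal (1 / k) * modular p f"
proof -
  have "modular p (\<lambda>x. f x / k) \<le> (\<integral>\<^sup>+ x. ennreal (1 / k) * ennreal (\<bar>f x\<bar> powr p x) \<partial>lebesgue)"
    unfolding modular_def
  proof (intro nn_integral_mono)
    fix x
    have "\<bar>f x / k\<bar> powr p x = (1 / k) powr p x * \<bar>f x\<bar> powr p x"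
      using assms(1) by (simp add: powr_mult[symmetric])
    also have "\<dots> \<le> (1 / k) powr 1 * \<bar>f x\<bar> powr p x"
      using assms(1,2) by (intro mult_right_mono powr_mono') auto
    finally show "ennreal (\<bar>f x / k\<bar> powr p x) \<le> ennreal (1 / k) * ennreal (\<bar>f x\<bar> powr p x)"
      using assms(1) by (simp add: ennreal_mult[symmetric] ennreal_leI)
  qed
  also have "\<dots> = ennreal (1 / k) * modular p f"
    unfolding modular_def by (rule nn_integral_cmult) measurable
  finally show ?thesis .
qed

lemma modular_shrink_le_1:
  assumes "modular p f \<le> ennreal k" "1 \<le> k" "\<And>x. 1 \<le> p x" "p \<in> borel_measurable lebesgue" "f \<in> borel_measurable lebesgue"
  shows "modular p (\<lambda>x. f x / k) \<le> 1"
proof -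
  have "modular p (\<lambda>x. f x / k) \<le> ennreal (1 / k) * modular p f" using assms by (intro modular_shrink) auto
  also have "\<dots> \<le> ennreal (1 / k) * ennreal k" by (intro mult_left_mono assms) simp
  also have "\<dots> = 1" using assms(2) by (simp add: ennreal_mult[symmetric])
  finally show ?thesis .
qed

text \<open>The set whose infimum is the norm is nonempty; without this the real infimum would carry
  no information.\<close>

lemma var_Lp_ex_le_1:
  assumes p: "p \<in> var_exponent" and f: "f \<in> var_Lp p"
  shows "\<exists>t>0. modular p (\<lambda>x. f x / t) \<le> 1"
proof -
  obtain t where t: "0 < t" "modular p (\<lambda>x. f x / t) < \<infinity>" and [measurable]: "f \<in> borel_measurable lebesgue"
    using f by (auto simp: var_Lp_def)
  note pv = var_exponentD[OF p]
  have [measurable]: "p \<in> borel_measurable lebesgue" by (rule pv)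
  define k where "k = max 1 (enn2real (modular p (\<lambda>x. f x / t)))"
  have "modular p (\<lambda>x. f x / t) = ennreal (enn2real (modular p (\<lambda>x. f x / t)))"
    using t(2) by simp
  also have "\<dots> \<le> ennreal k" by (intro ennreal_leI) (simp add: k_def)
  finally have "modular p (\<lambda>x. f x / t / k) \<le> 1"
    using pv(2) by (intro modular_shrink_le_1) (auto simp: k_def less_imp_le)
  then show ?thesis using t(1) by (intro exI[of _ "t * k"]) (auto simp: k_def)
qed

lemma var_Lp_norm_le:
  assumes "0 < t" "modular p (\<lambda>x. f x / t) \<le> 1"
  shows "var_Lp_norm p f \<le> t"
  unfolding var_Lp_norm_def using assms by (intro cInf_lower bdd_belowI[of _ 0]) auto

lemma var_Lipschitz_continuous:
  assumes "b \<in> var_Lipschitz \<delta>" "\<And>x. 0 < \<delta> x"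
  shows "continuous_on UNIV b"
proof -
  obtain C where C: "\<And>x y. \<bar>b x - b y\<bar> \<le> C * norm (x - y) powr \<delta> x"
    using assms(1) by (auto simp: var_Lipschitz_def)
  have "(b \<longlongrightarrow> b x) (at x)" for x
  proof -
    have "((\<lambda>y. C * norm (x - y) powr \<delta> x) \<longlongrightarrow> C * norm (x - x) powr \<delta> x) (at x)"
      using assms(2)[of x] by (intro tendsto_intros) auto
    then have "((\<lambda>y. C * norm (x - y) powr \<delta> x) \<longlongrightarrow> 0) (at x)" by simp
    then have "((\<lambda>y. b y - b x) \<longlongrightarrow> 0) (at x)"
    proof (rule Lim_null_comparison[rotated])
      show "\<forall>\<^sub>F y in at x. norm (b y - b x) \<le> C * norm (x - y) powr \<delta> x"
        using C[of x] by (intro always_eventually allI) (simp add: abs_minus_commute)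
    qed
    then show ?thesis by (rule LIM_zero_cancel)
  qed
  then show ?thesis by (simp add: continuous_on_def)
qed

theorem commutator_bounded:
  fixes \<alpha> :: real and \<delta> q r b b' :: "real^'n \<Rightarrow> real"
  assumes \<alpha>: "0 \<le> \<alpha>"
    and \<delta>: "\<And>x. 0 < \<delta> x \<and> \<delta> x < real CARD('n)"
    and r: "r \<in> log_exponent" and q: "q \<in> var_exponent"
    and lim: "limit_exponent r * (SUP x. \<alpha> + \<delta> x) < real CARD('n)"
    and eq: "\<And>x. \<delta> x / real CARD('n) = 1 / r x - \<alpha> / real CARD('n) - 1 / q x"
    and bb': "AE x in lebesgue. b x = b' x" and Lip: "b' \<in> var_Lipschitz \<delta>" and b'0: "\<And>x. 0 \<le> b' x"
  shows "bounded_operator r q (commutator b \<alpha>)"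
proof -
  let ?N = "real CARD('n)"
  define \<eta> where "\<eta> x = \<alpha> + \<delta> x" for x
  note rv = var_exponentD[OF log_exponentD(1)[OF r]]
  note qv = var_exponentD[OF q]
  have [measurable]: "r \<in> borel_measurable lebesgue" "q \<in> borel_measurable lebesgue" by (rule rv qv)+
  have N: "1 \<le> ?N" by (simp add: Suc_leI)
  obtain C0 where C0: "\<And>x y. \<bar>b' x - b' y\<bar> \<le> C0 * norm (x - y) powr \<delta> x"
    using Lip by (auto simp: var_Lipschitz_def)
  define C where "C = max 0 C0"
  have C: "0 \<le> C" "\<bar>b' x - b' y\<bar> \<le> C * norm (x - y) powr \<delta> x" for x y
    using C0[of x y] mult_right_mono[of C0 C "norm (x - y) powr \<delta> x"] by (auto simp: C_def)
  \<comment> \<open>n^n dominates n^\<delta>(x), the cost of replacing the distance by the side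
    length; the summand 1 makes \<open>D\<close> positive so that it can be divided by.\<close>
  define D where "D = C * ?N powr ?N + 1"
  have D: "0 < D" using C by (simp add: D_def add_nonneg_pos)
  have b'cont: "continuous_on UNIV b'" using Lip \<delta> by (intro var_Lipschitz_continuous) auto
  note [measurable] = continuous_imp_lebesgue_measurable[OF b'cont]
  have bE: "\<bar>b' x - b' y\<bar> \<le> D * l powr \<delta> x" if "0 < l" "x \<in> cube a l" "y \<in> cube a l" for x y a l
  proof -
    have "\<bar>b' x - b' y\<bar> \<le> C * norm (x - y) powr \<delta> x" by (rule C)
    also have "norm (x - y) powr \<delta> x \<le> (?N * l) powr \<delta> x"
      using norm_cube[OF that(2,3)] \<delta>[of x] by (intro powr_mono2) auto
    also have "\<dots> = ?N powr \<delta> x * l powr \<delta> x" by (rule powr_mult)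
    also have "\<dots> \<le> ?N powr ?N * l powr \<delta> x" using \<delta>[of x] N by (intro mult_right_mono powr_mono) auto
    finally have "\<bar>b' x - b' y\<bar> \<le> C * ?N powr ?N * l powr \<delta> x" using C by (simp add: mult_left_mono mult.assoc)
    also have "\<dots> \<le> D * l powr \<delta> x" by (intro mult_right_mono) (auto simp: D_def)
    finally show ?thesis .
  qed
  \<comment> \<open>The margin in the large-cube exponent, positive by the hypothesis on the limit
    of \<open>r\<close>.\<close>
  define \<theta> where "\<theta> = 1 - limit_exponent r * (SUP x. \<eta> x) / ?N"
  have \<theta>: "0 < \<theta>" using lim by (simp add: \<theta>_def \<eta>_def)
  have L0: "0 < limit_exponent r" using log_exponentD(4)[OF r] rv(3) by linarith
  have "bdd_above (range \<eta>)" using \<delta> by (intro bdd_aboveI[of _ "\<alpha> + ?N"]) (auto simp: \<eta>_def less_imp_le)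
  then have "\<eta> x \<le> (SUP x. \<eta> x)" for x by (intro cSUP_upper) auto
  then have \<theta>2: "limit_exponent r * (\<eta> x / ?N) \<le> 1 - \<theta>" for x
    using L0 by (simp add: \<theta>_def divide_right_mono)
  have \<eta>: "0 \<le> \<eta> x" "1 / q x = 1 / r x - \<eta> x / ?N" for x
    using \<alpha> \<delta>[of x] eq[of x] by (auto simp: \<eta>_def add_divide_distrib)
  obtain K where K: "1 \<le> K" "\<And>f. f \<in> borel_measurable lebesgue \<Longrightarrow> modular r f \<le> 1 \<Longrightarrow>
     (\<exists>G \<in> borel_measurable lebesgue. (\<forall>x. 0 \<le> G x) \<and> (\<integral>\<^sup>+ x. ennreal (G x) \<partial>lebesgue) \<le> ennreal K \<and>
       (AE x in lebesgue. frac_maximal (\<eta> x) f x \<le> ennreal (G x powr (1 / q x))))"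
    using frac_maximal_modular[OF r q \<eta> \<theta> \<theta>2] by blast
  have M0: "AE x in lebesgue. frac_maximal 0 f x < \<infinity>" if f: "f \<in> borel_measurable lebesgue" "modular r f \<le> 1" for f
  proof -
    \<comment> \<open>Order 0 with target exponent \<open>r\<close> and margin 1: the majorant is
      real-valued, so the Hardy-Littlewood maximal function is finite almost everywhere.\<close>
    have "\<exists>G. AE x in lebesgue. frac_maximal 0 f x \<le> ennreal (G x powr (1 / r x))"
      using frac_maximal_modular[OF r log_exponentD(1)[OF r], of "\<lambda>_. 0" 1] f by auto
    then show ?thesis by (auto elim!: eventually_mono intro: le_less_trans)
  qed
  show ?thesis
    unfolding bounded_operator_def
  proof (intro exI[of _ "D * K"] ballI)
    fix f assume fL: "f \<in> var_Lp r"
    then have f [measurable]: "f \<in> borel_measurable lebesgue" by (simp add: var_Lp_def)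
    let ?Mb = "frac_maximal \<alpha> (\<lambda>y. b' y * f y)" and ?Mf = "frac_maximal \<alpha> f"
    define g where "g x = b' x * enn2real (?Mf x) - enn2real (?Mb x)" for x
    have [measurable]: "g \<in> borel_measurable lebesgue" unfolding g_def by measurable
    \<comment> \<open>Both directions are proved as inequalities between sums in the extended
      nonnegative reals; they become a bound for the absolute difference only after finiteness is
      established. Nonnegativity of \<open>b'\<close> identifies |b' f| with b' |f|.\<close>
    have cmp1: "ennreal (b' x) * ?Mf x
       \<le> ennreal 1 * ?Mb x + ennreal D * frac_maximal (\<alpha> + \<delta> x) f x" for x
    proof (rule frac_maximal_compare)
      fix a l y assume l: "0 < l" "x \<in> cube a l" "y \<in> cube a l"
      have "b' x * \<bar>f y\<bar> \<le> (b' y + D * l powr \<delta> x) * \<bar>f y\<bar>"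
        using bE[OF l] by (intro mult_right_mono) auto
      then show "b' x * \<bar>f y\<bar> \<le> 1 * \<bar>b' y * f y\<bar> + D * l powr \<delta> x * \<bar>f y\<bar>"
        using b'0[of y] by (simp add: abs_mult algebra_simps)
    qed (use b'0 D in auto)
    have cmp2: "ennreal 1 * ?Mb x
       \<le> ennreal (b' x) * ?Mf x + ennreal D * frac_maximal (\<alpha> + \<delta> x) f x" for x
    proof (rule frac_maximal_compare)
      fix a l y assume l: "0 < l" "x \<in> cube a l" "y \<in> cube a l"
      have "b' y * \<bar>f y\<bar> \<le> (b' x + D * l powr \<delta> x) * \<bar>f y\<bar>"
        using bE[OF l] by (intro mult_right_mono) auto
      then show "1 * \<bar>b' y * f y\<bar> \<le> b' x * \<bar>f y\<bar> + D * l powr \<delta> x * \<bar>f y\<bar>"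
        using b'0[of y] by (simp add: abs_mult algebra_simps)
    qed (use b'0 D in auto)
    have bf: "frac_maximal \<alpha> (\<lambda>y. b y * f y) x = ?Mb x" for x
      using bb' by (intro frac_maximal_cong_AE) auto
    have main: "modular q (\<lambda>x. g x / (D * K * t)) \<le> 1 \<and> (AE x in lebesgue. commutator b \<alpha> f x = Some (g x))"
      if t: "0 < t" "modular r (\<lambda>x. f x / t) \<le> 1" for t
    proof -
      define f1 where "f1 x = f x / t" for x
      have f1 [measurable]: "f1 \<in> borel_measurable lebesgue" unfolding f1_def by measurable
      have m1: "modular r f1 \<le> 1" using t(2) by (simp add: f1_def[abs_def])
      obtain G where [measurable]: "G \<in> borel_measurable lebesgue" and G: "\<And>x. 0 \<le> G x"
        "(\<integral>\<^sup>+ x. ennreal (G x) \<partial>lebesgue) \<le> ennreal K"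
        "AE x in lebesgue. frac_maximal (\<eta> x) f1 x \<le> ennreal (G x powr (1 / q x))"
        using K(2)[OF f1 m1] by blast
      have scale: "frac_maximal e f x = ennreal t * frac_maximal e f1 x" for e x
        using frac_maximal_cmult[OF f1, of e t x] t(1) by (simp add: f1_def)
      have "AE x in lebesgue. commutator b \<alpha> f x = Some (g x) \<and> \<bar>g x\<bar> \<le> D * t * G x powr (1 / q x)"
        using G(3) M0[OF f1 m1] bb'
      proof eventually_elim
        case (elim x)
        have A: "frac_maximal (\<eta> x) f x \<le> ennreal (t * G x powr (1 / q x))"
          unfolding scale using elim(1) t(1) by (simp add: ennreal_mult mult_left_mono)
        then have "frac_maximal (\<eta> x) f x < \<infinity>" using le_less_trans by fastforce
        moreover have "frac_maximal 0 f x < \<infinity>"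
          unfolding scale using elim(2) by (simp add: ennreal_mult_less_top)
        ultimately have fin1: "?Mf x < \<infinity>"
          using frac_maximal_le_add[OF \<alpha>, of "\<delta> x" f x] \<delta>[of x] le_less_trans[of "?Mf x"]
          by (auto simp: \<eta>_def)
        have A': "ennreal D * frac_maximal (\<alpha> + \<delta> x) f x \<le> ennreal (D * t * G x powr (1 / q x))"
          using mult_left_mono[OF A, of "ennreal D"] D t(1) by (simp add: \<eta>_def ennreal_mult mult.assoc)
        have fin2: "?Mb x < \<infinity>"
        proof -
          have "?Mb x \<le> ennreal (b' x) * ?Mf x + ennreal (D * t * G x powr (1 / q x))"
            by (rule order_trans[OF _ add_left_mono[OF A']]) (use cmp2[of x] in simp)
          also have "\<dots> < \<infinity>" using fin1 by (simp add: ennreal_mult_less_top)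
          finally show ?thesis .
        qed
        obtain u where u: "?Mf x = ennreal u" "0 \<le> u" using fin1 by (cases "?Mf x") auto
        obtain w where w: "?Mb x = ennreal w" "0 \<le> w"
          using fin2 by (cases "?Mb x") auto
        define e where "e = D * t * G x powr (1 / q x)"
        have e: "0 \<le> e" using D t(1) by (simp add: e_def)
        have "ennreal (b' x) * ennreal u \<le> ennreal w + ennreal e"
          unfolding e_def by (rule order_trans[OF _ add_left_mono[OF A']]) (use cmp1[of x] in \<open>simp add: u w\<close>)
        then have "b' x * u \<le> w + e"
          using b'0[of x] u w e by (simp add: ennreal_mult[symmetric] ennreal_plus[symmetric] del: ennreal_plus)
        moreover have "ennreal w \<le> ennreal (b' x) * ennreal u + ennreal e"
          unfolding e_def by (rule order_trans[OF _ add_left_mono[OF A']]) (use cmp2[of x] in \<open>simp add: u w\<close>)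
        then have "w \<le> b' x * u + e"
          using b'0[of x] u w e by (simp add: ennreal_mult[symmetric] ennreal_plus[symmetric] del: ennreal_plus)
        ultimately have "\<bar>g x\<bar> \<le> e" by (simp add: g_def u w)
        moreover have "commutator b \<alpha> f x = Some (g x)"
          using fin1 fin2 elim(3) by (simp add: commutator_def bf g_def)
        ultimately show ?case by (simp add: e_def)
      qed
      then have c: "AE x in lebesgue. commutator b \<alpha> f x = Some (g x)"
        and gb: "AE x in lebesgue. \<bar>g x\<bar> \<le> D * t * G x powr (1 / q x)" by auto
      have "modular q (\<lambda>x. g x / (D * t)) \<le> (\<integral>\<^sup>+ x. ennreal (G x) \<partial>lebesgue)"
        unfolding modular_def
      proof (rule nn_integral_mono_AE, use gb in eventually_elim)
        case (elim x)
        have "\<bar>g x / (D * t)\<bar> \<le> G x powr (1 / q x)"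
          using elim D t(1) by (simp add: abs_mult divide_le_eq mult_ac)
        then have "\<bar>g x / (D * t)\<bar> powr q x \<le> (G x powr (1 / q x)) powr q x"
          using qv(2)[of x] by (intro powr_mono2) auto
        also have "\<dots> = G x" using qv(2)[of x] G(1)[of x] by (simp add: powr_powr)
        finally show "ennreal (\<bar>g x / (D * t)\<bar> powr q x) \<le> ennreal (G x)" by (rule ennreal_leI)
      qed
      also note G(2)
      finally have "modular q (\<lambda>x. g x / (D * t) / K) \<le> 1"
        using K(1) qv(2) by (intro modular_shrink_le_1) (auto simp: less_imp_le)
      then show ?thesis using c by (simp add: mult_ac)
    qed
    obtain t0 where t0: "0 < t0" "modular r (\<lambda>x. f x / t0) \<le> 1"
      using var_Lp_ex_le_1[OF log_exponentD(1)[OF r] fL] by blast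
    show "\<exists>g\<in>var_Lp q. (AE x in lebesgue. commutator b \<alpha> f x = Some (g x)) \<and> var_Lp_norm q g \<le> D * K * var_Lp_norm r f"
    proof (intro bexI[of _ g] conjI)
      show "AE x in lebesgue. commutator b \<alpha> f x = Some (g x)" using main[OF t0] by blast
      have DK: "0 < D * K" using D K(1) by simp
      show "g \<in> var_Lp q"
        unfolding var_Lp_def using main[OF t0] DK t0(1)
        by (auto intro!: exI[of _ "D * K * t0"] intro: le_less_trans)
      \<comment> \<open>The bound holds for every admissible \<open>t\<close>, so it survives the
        infimum, which need not be attained.\<close>
      have "var_Lp_norm q g / (D * K) \<le> t" if "0 < t" "modular r (\<lambda>x. f x / t) \<le> 1" for t
      proof -
        have "var_Lp_norm q g \<le> D * K * t"
          using main[OF that] that(1) DK by (intro var_Lp_norm_le) auto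
        then show ?thesis using DK by (simp add: divide_le_eq mult_ac)
      qed
      then have "var_Lp_norm q g / (D * K) \<le> var_Lp_norm r f"
        unfolding var_Lp_norm_def[of r] using t0 by (intro cInf_greatest) auto
      then show "var_Lp_norm q g \<le> D * K * var_Lp_norm r f" using DK by (simp add: divide_le_eq mult_ac)
    qed
  qed
qed

section \<open>Necessity\<close>

text \<open>Across a cube of side at most 1 all values of \<open>u\<close> may be exchanged for
  \<open>u x\<close>; on a larger cube only comparison with the value \<open>L\<close> at infinity
  is possible.\<close>

definition scale_exponent :: "(real^'n \<Rightarrow> real) \<Rightarrow> real \<Rightarrow> real^'n \<Rightarrow> real \<Rightarrow> real" where
  "scale_exponent u L x l = (if l \<le> 1 then u x else L)"

abbreviation cube_exponent :: "(real^'n \<Rightarrow> real) \<Rightarrow> real^'n \<Rightarrow> real \<Rightarrow> real" where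
  "cube_exponent r x l \<equiv> scale_exponent r (limit_exponent r) x l"

lemma mean_le_powr:
  fixes r :: "real^'n \<Rightarrow> real"
  assumes r: "r \<in> log_exponent"
  shows "\<exists>K\<ge>1. \<forall>g a l x. unit_modular r g \<longrightarrow> 0 < l \<longrightarrow> x \<in> cube a l \<longrightarrow>
    mean (cube a l) g \<le> K * (l ^ CARD('n)) powr (- (1 / cube_exponent r x l))"
proof -
  note rv = var_exponentD[OF log_exponentD(1)[OF r]]
  have r1: "1 \<le> r x" for x by (rule less_imp_le[OF rv(2)])
  have L1: "1 \<le> limit_exponent r" using log_exponentD(4)[OF r] rv(3) by linarith
  obtain C where lh: "log_holder r (limit_exponent r) C" using log_exponentD(3)[OF r] by blast
  obtain K1 where K1: "1 \<le> K1" "\<And>g a l x. unit_modular r g \<Longrightarrow> 0 < l \<Longrightarrow> l \<le> 1 \<Longrightarrow> x \<in> cube a l \<Longrightarrow>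
    mean (cube a l) g \<le> K1 * (l ^ CARD('n)) powr (- (1 / r x))"
    using mean_small_cube[OF lh r1 L1] by blast
  obtain K2 where K2: "1 \<le> K2" "\<And>g a l. unit_modular r g \<Longrightarrow> 1 \<le> l \<Longrightarrow>
    mean (cube a l) g \<le> K2 * (l ^ CARD('n)) powr (- (1 / limit_exponent r))"
    using mean_large_cube[OF lh r1 L1] by blast
  show ?thesis
  proof (intro exI[of _ "max K1 K2"] conjI allI impI)
    fix g and a x :: "real^'n" and l assume *: "unit_modular r g" "0 < l" "x \<in> cube a l"
    have le: "k * V \<le> max K1 K2 * V" if "k \<le> max K1 K2" "0 \<le> V" for k V
      using that by (rule mult_right_mono)
    show "mean (cube a l) g \<le> max K1 K2 * (l ^ CARD('n)) powr (- (1 / cube_exponent r x l))"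
    proof (cases "l \<le> 1")
      case True
      show ?thesis
        using order_trans[OF K1(2)[OF *(1,2) True *(3)] le] True by (simp add: scale_exponent_def)
    next
      case False
      then show ?thesis
        using order_trans[OF K2(2)[OF *(1), of l a] le] by (simp add: scale_exponent_def)
    qed
  qed (use K1 in simp)
qed

section \<open>Testing the commutator on indicators of cubes\<close>

lemma modular_indicator_le:
  fixes Q :: "(real^'n) set"
  assumes Q: "Q \<in> sets lebesgue" and F: "\<And>y. y \<in> Q \<Longrightarrow> c powr p y \<le> F y" "\<And>y. 0 \<le> F y"
    and c: "0 \<le> c"
  shows "modular p (\<lambda>y. c * indicator Q y) \<le> (\<integral>\<^sup>+ y \<in> Q. ennreal (F y) \<partial>lebesgue)"
  unfolding modular_def
  by (intro nn_integral_mono) (use F c in \<open>auto simp: indicator_def intro!: ennreal_leI\<close>)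

text \<open>An upper bound of the expected order for the norm of the indicator. With c = |Q|^(-1/r)
  the power c^(r y) should be 1/|Q|; exchanging exponents costs a constant on small cubes and an
  additional integrable decay on large ones.\<close>

lemma modular_indicator_cube:
  fixes r :: "real^'n \<Rightarrow> real"
  assumes r: "r \<in> log_exponent"
  shows "\<exists>K\<ge>1. \<forall>a l x. 0 < l \<longrightarrow> x \<in> cube a l \<longrightarrow>
    modular r (\<lambda>y. indicator (cube a l) y / (K * (l ^ CARD('n)) powr (1 / cube_exponent r x l))) \<le> 1"
proof -
  let ?N = "real CARD('n)"
  define L where "L = limit_exponent r"
  note rv = var_exponentD[OF log_exponentD(1)[OF r]]
  have [measurable]: "r \<in> borel_measurable lebesgue" by (rule rv)
  have r1: "1 \<le> r x" for x by (rule less_imp_le[OF rv(2)])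
  have L1: "1 \<le> L" using log_exponentD(4)[OF r] rv(3) by (simp add: L_def)
  have N: "1 \<le> ?N" by (simp add: Suc_leI)
  obtain C where lh: "log_holder r L C" using log_exponentD(3)[OF r] by (auto simp: L_def)
  have C: "0 \<le> C" by (rule log_holder_nonneg[OF lh])
  define m where "m = ?N + 2"
  have m: "0 \<le> m" by (simp add: m_def)
  obtain H where H: "0 \<le> H" "(\<integral>\<^sup>+ x. ennreal (decay m (x :: real^'n)) \<partial>lebesgue) \<le> ennreal H"
    using decay_integrable[where 'n = 'n and m = m] by (auto simp: m_def)
  define K1 where "K1 = exp ((ln ?N + 1) * C) powr ?N"
  define K2 where "K2 = exp (m * C)"
  define K where "K = max K1 (K2 + H)"
  have "1 \<le> exp ((ln ?N + 1) * C)" using C N by simp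
  then have K1: "1 \<le> K1" unfolding K1_def by (intro ge_one_powr_ge_zero) auto
  have K2: "1 \<le> K2" using C m by (simp add: K2_def)
  have K: "1 \<le> K" "K1 \<le> K" "K2 + H \<le> K" using K1 by (auto simp: K_def)
  show ?thesis
  proof (intro exI[of _ K] conjI allI impI)
    fix a x :: "real^'n" and l :: real assume l: "0 < l" "x \<in> cube a l"
    define v where "v = l ^ CARD('n)"
    have v: "0 < v" using l by (simp add: v_def)
    define e where "e = 1 / scale_exponent r L x l"
    define c where "c = v powr (- e)"
    have c: "0 < c" using v by (simp add: c_def)
    have e: "v powr e = 1 / c" using v by (simp add: c_def powr_minus_divide)
    have eqf: "(\<lambda>y. indicator (cube a l) y / (K * v powr e)) = (\<lambda>y. c * indicator (cube a l) y / K)"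
      unfolding e by auto
    have "modular r (\<lambda>y. c * indicator (cube a l) y / K) \<le> 1"
    proof (intro modular_shrink_le_1 K(1) r1)
      show "modular r (\<lambda>y. c * indicator (cube a l) y) \<le> ennreal K"
      proof (cases "l \<le> 1")
        case True
        have "c powr r y \<le> K1 / v" if y: "y \<in> cube a l" for y
        proof -
          have rx: "0 < r x" "1 \<le> r x" using r1[of x] by auto
          have v1: "v \<le> 1" using True l by (simp add: v_def power_le_one)
          have "c powr r y = v powr (- (r y / r x))"
            using True v by (simp add: c_def e_def scale_exponent_def powr_powr)
          also have "- (r y / r x) = - 1 + (r x - r y) / r x" using rx by (simp add: field_simps)
          also have "v powr \<dots> = v powr (- 1) * v powr ((r x - r y) / r x)" by (rule powr_add)
          also have "v powr ((r x - r y) / r x) \<le> v powr (- \<bar>r x - r y\<bar>)"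
          proof (intro powr_mono')
            have "\<bar>(r x - r y) / r x\<bar> \<le> \<bar>r x - r y\<bar>"
              using rx by (simp add: abs_divide divide_le_eq mult_le_cancel_left1)
            then show "- \<bar>r x - r y\<bar> \<le> (r x - r y) / r x" by linarith
          qed (use v v1 in auto)
          also have "\<dots> = ((1 / l) powr \<bar>r x - r y\<bar>) powr ?N"
            using l by (simp add: v_def powr_realpow[symmetric] powr_powr powr_minus_divide powr_divide mult.commute)
          also have "\<dots> \<le> K1"
            unfolding K1_def using log_holder_local[OF lh l(1) True N norm_cube[OF l(2) y]]
            by (intro powr_mono2) auto
          finally show ?thesis using v by (simp add: powr_minus_divide field_simps)
        qed
        then have "modular r (\<lambda>y. c * indicator (cube a l) y) \<le> (\<integral>\<^sup>+ y \<in> cube a l. ennreal (K1 / v) \<partial>lebesgue)"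
          using c K1 v by (intro modular_indicator_le) auto
        also have "\<dots> = ennreal (K1 / v) * emeasure lebesgue (cube a l)"
          by (rule nn_integral_cmult_indicator) (rule sets_cube)
        also have "\<dots> = ennreal (K1 / v) * ennreal v" unfolding v_def emeasure_cube[OF l(1)] ..
        also have "\<dots> = ennreal K1" using v K1 by (simp add: ennreal_mult[symmetric])
        also have "\<dots> \<le> ennreal K" by (intro ennreal_leI K)
        finally show ?thesis .
      next
        case False
        then have v1: "1 \<le> v" by (simp add: v_def)
        have cL: "c = v powr (- (1 / L))" using False by (simp add: c_def e_def scale_exponent_def)
        have c1: "c \<le> 1" unfolding cL using v1 L1 powr_mono[of "- (1 / L)" 0 v] by auto
        \<comment> \<open>Either \<open>c\<close> exceeds the decay and \<open>r y\<close> can be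
          exchanged for \<open>L\<close>, or c^(r y) \<le> c is itself below the decay.\<close>
        have "c powr r y \<le> K2 / v + decay m y" for y
        proof (cases "decay m y \<le> c")
          case True
          have "c powr (r y - L) \<le> c powr (- \<bar>r y - L\<bar>)" using c c1 by (intro powr_mono') auto
          also have "\<dots> \<le> K2" unfolding K2_def using True by (intro log_holder_infinity[OF lh m]) auto
          finally have 1: "c powr L * c powr (r y - L) \<le> c powr L * K2" by (intro mult_left_mono) auto
          have 2: "c powr r y = c powr L * c powr (r y - L)" using c by (simp add: powr_add[symmetric])
          have "c powr L = v powr (- 1)" unfolding cL powr_powr using L1 by simp
          also have "\<dots> = 1 / v" using v by (simp add: powr_minus_divide)
          finally have "c powr r y \<le> K2 / v" using 1 2 by simp
          then show ?thesis using decay_pos[of m y] by simp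
        next
          case False
          have "c powr r y \<le> c powr 1" using c c1 r1 by (intro powr_mono') auto
          moreover have "0 \<le> K2 / v" using K2 v by simp
          ultimately show ?thesis using False c by simp
        qed
        then have "modular r (\<lambda>y. c * indicator (cube a l) y) \<le> (\<integral>\<^sup>+ y \<in> cube a l. ennreal (K2 / v + decay m y) \<partial>lebesgue)"
          using c K2 v by (intro modular_indicator_le) (auto intro!: add_nonneg_nonneg less_imp_le[OF decay_pos])
        also have "\<dots> \<le> (\<integral>\<^sup>+ y. ennreal (K2 / v) * indicator (cube a l) y + ennreal (decay m y) \<partial>lebesgue)"
          using K2 v by (intro nn_integral_mono) (auto simp: indicator_def decay_pos less_imp_le)
        also have "\<dots> = ennreal (K2 / v) * ennreal v + (\<integral>\<^sup>+ y. ennreal (decay m (y :: real^'n)) \<partial>lebesgue)"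
          unfolding v_def emeasure_cube[OF l(1), of a, symmetric]
          by (subst nn_integral_add) (auto simp: nn_integral_cmult_indicator)
        also have "\<dots> \<le> ennreal (K2 / v) * ennreal v + ennreal H" by (intro add_left_mono H)
        also have "\<dots> = ennreal (K2 + H)" using v K2 H by (simp add: ennreal_mult[symmetric])
        also have "\<dots> \<le> ennreal K" by (intro ennreal_leI K)
        finally show ?thesis .
      qed
    qed measurable
    then show "modular r (\<lambda>y. indicator (cube a l) y / (K * (l ^ CARD('n)) powr (1 / cube_exponent r x l))) \<le> 1"
      unfolding v_def[symmetric] L_def[symmetric] e_def[symmetric] eqf .
  qed (rule K)
qed

text \<open>For a competing cube of volume w the quotient is at most w^(\<alpha>/n) when w \<le> |Q|
  and at most |Q| / w^(1 - \<alpha>/n) otherwise. By 0 \<le> \<alpha> < n both bounds are largest at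
  w = |Q|, which the cube itself attains.\<close>

lemma frac_maximal_indicator_cube:
  fixes x :: "real^'n"
  assumes \<alpha>: "0 \<le> \<alpha>" "\<alpha> < real CARD('n)" and l: "0 < l" "x \<in> cube a l"
  shows "frac_maximal \<alpha> (indicator (cube a l)) x = ennreal ((l ^ CARD('n)) powr (\<alpha> / real CARD('n)))"
proof (rule antisym)
  define e where "e = \<alpha> / real CARD('n)"
  have e: "0 \<le> e" "e < 1" using \<alpha> by (auto simp: e_def)
  have I: "(\<integral>\<^sup>+ y \<in> cube a' l'. ennreal \<bar>indicator (cube a l) y\<bar> \<partial>lebesgue) = emeasure lebesgue (cube a l \<inter> cube a' l')"
    for a' :: "real^'n" and l'
  proof -
    have "(\<integral>\<^sup>+ y \<in> cube a' l'. ennreal \<bar>indicator (cube a l) y\<bar> \<partial>lebesgue)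
        = (\<integral>\<^sup>+ y. indicator (cube a l \<inter> cube a' l') y \<partial>lebesgue)"
      by (intro nn_integral_cong) (simp add: indicator_def)
    also have "\<dots> = emeasure lebesgue (cube a l \<inter> cube a' l')"
      by (rule nn_integral_indicator) (intro sets.Int sets_cube)
    finally show ?thesis .
  qed
  have div: "ennreal v / ennreal (v powr (1 - e)) = ennreal (v powr e)" if "0 < v" for v
    using that by (subst divide_ennreal) (auto simp: powr_diff)
  let ?v = "l ^ CARD('n)"
  have v: "0 < ?v" using l by simp
  show "frac_maximal \<alpha> (indicator (cube a l)) x \<le> ennreal (?v powr (\<alpha> / real CARD('n)))"
  proof (rule frac_maximal_least)
    fix a' l' assume l': "0 < l'" "x \<in> cube a' l'"
    let ?w = "l' ^ CARD('n)"
    have w: "0 < ?w" using l' by simp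
    have "emeasure lebesgue (cube a l \<inter> cube a' l') / ennreal (?w powr (1 - e)) \<le> ennreal (?v powr e)"
    proof (cases "?w \<le> ?v")
      case True
      have "emeasure lebesgue (cube a l \<inter> cube a' l') \<le> ennreal ?w"
        unfolding emeasure_cube[OF l'(1), of a', symmetric] by (intro emeasure_mono) auto
      then have "emeasure lebesgue (cube a l \<inter> cube a' l') / ennreal (?w powr (1 - e)) \<le> ennreal ?w / ennreal (?w powr (1 - e))"
        by (rule divide_right_mono_ennreal)
      also have "\<dots> = ennreal (?w powr e)" using w by (rule div)
      also have "\<dots> \<le> ennreal (?v powr e)" using True w e by (intro ennreal_leI powr_mono2) auto
      finally show ?thesis .
    next
      case False
      have "emeasure lebesgue (cube a l \<inter> cube a' l') \<le> ennreal ?v"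
        unfolding emeasure_cube[OF l(1), of a, symmetric] by (intro emeasure_mono) auto
      then have "emeasure lebesgue (cube a l \<inter> cube a' l') / ennreal (?w powr (1 - e)) \<le> ennreal ?v / ennreal (?w powr (1 - e))"
        by (rule divide_right_mono_ennreal)
      also have "\<dots> = ennreal (?v / ?w powr (1 - e))" using v w l(1) l'(1) by (intro divide_ennreal) auto
      also have "\<dots> \<le> ennreal (?v / ?v powr (1 - e))"
        using False v w e l(1) l'(1) by (intro ennreal_leI divide_left_mono powr_mono2) auto
      also have "\<dots> = ennreal (?v powr e)" using v by (simp add: powr_diff)
      finally show ?thesis .
    qed
    then show "(\<integral>\<^sup>+ y \<in> cube a' l'. ennreal \<bar>indicator (cube a l) y\<bar> \<partial>lebesgue) / ennreal (?w powr (1 - \<alpha> / real CARD('n)))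
      \<le> ennreal (?v powr (\<alpha> / real CARD('n)))"
      unfolding I e_def .
  qed
  have "ennreal (?v powr e) = emeasure lebesgue (cube a l \<inter> cube a l) / ennreal (?v powr (1 - e))"
    using div[OF v] emeasure_cube[OF l(1), of a] by simp
  also have "\<dots> \<le> frac_maximal \<alpha> (indicator (cube a l)) x"
    unfolding I[symmetric] e_def by (rule frac_maximal_upper[OF l])
  finally show "ennreal (?v powr (\<alpha> / real CARD('n))) \<le> frac_maximal \<alpha> (indicator (cube a l)) x"
    by (simp add: e_def)
qed

lemma mean_mono_AE:
  assumes "set_integrable lebesgue Q f" "set_integrable lebesgue Q g" "AE y in lebesgue. y \<in> Q \<longrightarrow> f y \<le> g y"
  shows "mean Q f \<le> mean Q g"
  unfolding mean_def using assms by (intro divide_right_mono set_integral_mono_AE) auto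

text \<open>Strictness of \<open>T\<close> above the norm yields an admissible scale below
  \<open>T\<close>, so attainment of the infimum is not an issue.\<close>

lemma unit_modular_of_norm:
  assumes q: "q \<in> var_exponent" and g: "g \<in> var_Lp q" and T: "var_Lp_norm q g < T"
  shows "unit_modular q (\<lambda>x. \<bar>g x\<bar> / T)" "0 < T"
proof -
  note qv = var_exponentD[OF q]
  have [measurable]: "g \<in> borel_measurable lebesgue" using g by (simp add: var_Lp_def)
  have "{t. 0 < t \<and> modular q (\<lambda>x. g x / t) \<le> 1} \<noteq> {}" using var_Lp_ex_le_1[OF q g] by auto
  from cInf_lessD[OF this T[unfolded var_Lp_norm_def]]
  obtain t where t: "0 < t" "modular q (\<lambda>x. g x / t) \<le> 1" "t < T" by auto
  then show "0 < T" by simp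
  have "(\<integral>\<^sup>+ x. ennreal ((\<bar>g x\<bar> / T) powr q x) \<partial>lebesgue) \<le> modular q (\<lambda>x. g x / t)"
    unfolding modular_def
  proof (intro nn_integral_mono ennreal_leI powr_mono2)
    fix x
    show "\<bar>g x\<bar> / T \<le> \<bar>g x / t\<bar>" using t by (auto simp: abs_divide intro!: divide_left_mono)
    show "0 \<le> q x" using qv(2)[of x] by simp
  qed (use t in auto)
  also note t(2)
  finally show "unit_modular q (\<lambda>x. \<bar>g x\<bar> / T)"
    using qv(1) less_imp_le[OF qv(2)] t by unfold_locales auto
qed

text \<open>On the cube the commutator of its indicator controls the mean of |b| minus
  \<open>b\<close> from above. This one-sided bound already controls the full oscillation, because
  the mean of b - \<mu> vanishes for the mean \<mu> of \<open>b\<close>.\<close>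

proposition mean_oscillation:
  fixes \<alpha> :: real and \<delta> q r b :: "real^'n \<Rightarrow> real"
  assumes \<alpha>: "0 \<le> \<alpha>" "\<alpha> < real CARD('n)"
    and r: "r \<in> log_exponent" and q: "q \<in> log_exponent"
    and eq: "\<And>x. \<delta> x / real CARD('n) = 1 / r x - \<alpha> / real CARD('n) - 1 / q x"
    and eqL: "d / real CARD('n) = 1 / limit_exponent r - \<alpha> / real CARD('n) - 1 / limit_exponent q"
    and b: "\<And>a l. set_integrable lebesgue (cube a l) b"
    and bd: "bounded_operator r q (commutator b \<alpha>)"
  shows "\<exists>K\<ge>0. \<forall>a l x. 0 < l \<longrightarrow> x \<in> cube a l \<longrightarrow>
    mean (cube a l) (\<lambda>y. \<bar>b y - mean (cube a l) b\<bar>) \<le> K * l powr scale_exponent \<delta> d x l \<and>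
    mean (cube a l) (\<lambda>y. \<bar>b y\<bar>) - mean (cube a l) b \<le> K * l powr scale_exponent \<delta> d x l"
proof -
  let ?N = "real CARD('n)"
  note rv = var_exponentD[OF log_exponentD(1)[OF r]]
  obtain Kr where Kr: "1 \<le> Kr" "\<And>a l x. 0 < l \<Longrightarrow> x \<in> cube a l \<Longrightarrow>
    modular r (\<lambda>y. indicator (cube a l) y / (Kr * (l ^ CARD('n)) powr (1 / cube_exponent r x l))) \<le> 1"
    using modular_indicator_cube[OF r] by blast
  obtain Kq where Kq: "1 \<le> Kq" "\<And>g a l x. unit_modular q g \<Longrightarrow> 0 < l \<Longrightarrow> x \<in> cube a l \<Longrightarrow>
    mean (cube a l) g \<le> Kq * (l ^ CARD('n)) powr (- (1 / cube_exponent q x l))"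
    using mean_le_powr[OF q] by blast
  obtain C where C: "\<And>f. f \<in> var_Lp r \<Longrightarrow> \<exists>g\<in>var_Lp q. (AE x in lebesgue. commutator b \<alpha> f x = Some (g x))
      \<and> var_Lp_norm q g \<le> C * var_Lp_norm r f"
    using bd by (auto simp: bounded_operator_def)
  \<comment> \<open>|C| + 1 replaces \<open>C\<close>, whose sign is unknown, and makes the norm
    bound strict. The factors \<open>Kr\<close> and \<open>Kq\<close> come from the indicator norm
    and from averaging; the 2 comes from the step to absolute oscillation.\<close>
  define K where "K = 2 * (((\<bar>C\<bar> + 1) * Kr) * Kq)"
  have main: "mean (cube a l) (\<lambda>y. \<bar>b y - mean (cube a l) b\<bar>) \<le> K * l powr scale_exponent \<delta> d x l \<and>
      mean (cube a l) (\<lambda>y. \<bar>b y\<bar>) - mean (cube a l) b \<le> K * l powr scale_exponent \<delta> d x l"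
    if l: "0 < l" "x \<in> cube a l" for a l x
  proof -
    let ?Q = "cube a l"
    let ?B = "mean ?Q (\<lambda>y. \<bar>b y\<bar>)"
    define v where "v = l ^ CARD('n)"
    have v: "0 < v" using l by (simp add: v_def)
    define T where "T = Kr * v powr (1 / cube_exponent r x l)"
    have T: "0 < T" using Kr v by (simp add: T_def)
    define f :: "real^'n \<Rightarrow> real" where "f = indicator ?Q"
    have f1: "modular r (\<lambda>y. f y / T) \<le> 1" unfolding f_def T_def v_def by (rule Kr(2)[OF l])
    have fL: "f \<in> var_Lp r" using f1 T
      by (auto simp: var_Lp_def f_def intro!: exI[of _ T] intro: le_less_trans)
    obtain g where g: "g \<in> var_Lp q" "AE x in lebesgue. commutator b \<alpha> f x = Some (g x)"
      "var_Lp_norm q g \<le> C * var_Lp_norm r f" using C[OF fL] by blast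
    let ?G = "mean ?Q (\<lambda>x. \<bar>g x\<bar>)"
    have [measurable]: "g \<in> borel_measurable lebesgue" using g(1) by (simp add: var_Lp_def)
    have nf: "var_Lp_norm r f \<le> T" by (rule var_Lp_norm_le[OF T f1])
    have nf0: "0 \<le> var_Lp_norm r f"
      unfolding var_Lp_norm_def using T f1 by (intro cInf_greatest) auto
    define T2 where "T2 = (\<bar>C\<bar> + 1) * T"
    have "C * var_Lp_norm r f \<le> \<bar>C\<bar> * var_Lp_norm r f" using nf0 by (intro mult_right_mono) auto
    also have "\<dots> \<le> \<bar>C\<bar> * T" using nf by (intro mult_left_mono) auto
    also have "\<dots> < T2" using T by (simp add: T2_def algebra_simps)
    finally have "var_Lp_norm q g < T2" using g(3) by simp
    note um = unit_modular_of_norm[OF log_exponentD(1)[OF q] g(1) this]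
    interpret um: unit_modular q "\<lambda>x. \<bar>g x\<bar> / T2" by (rule um)
    have T2: "0 < T2" by (rule um)
    have ig: "set_integrable lebesgue ?Q (\<lambda>x. \<bar>g x\<bar>)"
      using set_integrable_mult_right[of T2, OF um.set_integrable_self[of a l]] T2 by simp
    have "mean ?Q (\<lambda>x. \<bar>g x\<bar> / T2) \<le> Kq * v powr (- (1 / cube_exponent q x l))"
      unfolding v_def by (rule Kq(2)[OF um(1) l])
    moreover have "mean ?Q (\<lambda>x. \<bar>g x\<bar> / T2) = ?G / T2"
      using mean_cmult[of ?Q "1 / T2" "\<lambda>x. \<bar>g x\<bar>"] by simp
    ultimately have mg: "?G \<le> T2 * (Kq * v powr (- (1 / cube_exponent q x l)))"
      using T2 by (simp add: divide_le_eq mult.commute)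
    define c where "c = v powr (\<alpha> / ?N)"
    have c: "0 < c" using v by (simp add: c_def)
    define \<omega> where "\<omega> = l powr scale_exponent \<delta> d x l"
    have mgc: "2 * (?G / c) \<le> K * \<omega>"
    proof -
      \<comment> \<open>Exponents of the volume: 1/r from the norm of the indicator, -1/q from
        averaging the commutator, and -\<alpha>/n from dividing by the maximal function of the
        indicator. Their sum is \<delta>(x)/n or d/n according to the scale.\<close>
      let ?e = "1 / cube_exponent r x l - 1 / cube_exponent q x l - \<alpha> / ?N"
      have "?e = scale_exponent \<delta> d x l / ?N" using eq[of x] eqL by (simp add: scale_exponent_def)
      then have \<omega>: "v powr ?e = \<omega>"
        using l by (simp add: \<omega>_def v_def powr_realpow[symmetric] powr_powr)
      have "?G / c \<le> T2 * (Kq * v powr (- (1 / cube_exponent q x l))) / c"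
        using mg c by (intro divide_right_mono) auto
      also have "\<dots> = ((\<bar>C\<bar> + 1) * Kr) * Kq * v powr ?e"
        using v by (simp add: T2_def T_def c_def powr_diff powr_minus_divide)
      finally show ?thesis unfolding \<omega> K_def by simp
    qed
    have ib: "set_integrable lebesgue ?Q b" by (rule b)
    have iab: "set_integrable lebesgue ?Q (\<lambda>y. \<bar>b y\<bar>)" using ib by (rule set_integrable_abs)
    have mb: "mean ?Q b \<le> ?B" by (intro mean_mono ib iab) auto
    \<comment> \<open>At each point of the cube, testing the supremum on that cube alone bounds the
      maximal function of b times its indicator below by |Q|^(\<alpha>/n) times the mean of
      |b|.\<close>
    have ptw: "AE y in lebesgue. y \<in> ?Q \<longrightarrow> ?B - b y \<le> \<bar>g y\<bar> / c"
      using g(2)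
    proof eventually_elim
      case (elim y)
      show ?case
      proof
        assume y: "y \<in> ?Q"
        have M1: "frac_maximal \<alpha> f y = ennreal c"
          unfolding f_def c_def v_def by (rule frac_maximal_indicator_cube[OF \<alpha> l(1) y])
        have fin: "frac_maximal \<alpha> (\<lambda>y. b y * f y) y < \<infinity>"
          and gy: "g y = b y * enn2real (frac_maximal \<alpha> f y) - enn2real (frac_maximal \<alpha> (\<lambda>y. b y * f y) y)"
          using elim by (auto simp: commutator_def split: if_splits)
        have "ennreal (c * ?B) \<le> frac_maximal \<alpha> (\<lambda>y. b y * f y) y"
        proof -
          have "(\<integral>\<^sup>+ z \<in> ?Q. ennreal \<bar>b z * f z\<bar> \<partial>lebesgue) = absint ?Q b"
            by (intro nn_integral_cong) (auto simp: f_def indicator_def)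
          also have "\<dots> = ennreal (v * ?B)"
            unfolding v_def by (intro set_nn_integral_eq_mean iab l) auto
          finally have "(\<integral>\<^sup>+ z \<in> ?Q. ennreal \<bar>b z * f z\<bar> \<partial>lebesgue) / ennreal (v powr (1 - \<alpha> / ?N))
            = ennreal (v * ?B / v powr (1 - \<alpha> / ?N))"
            using v by (simp add: divide_ennreal mean_nonneg)
          also have "v * ?B / v powr (1 - \<alpha> / ?N) = c * ?B"
            using v by (simp add: c_def powr_diff)
          finally show ?thesis
            using frac_maximal_upper[OF l(1) y, of "\<lambda>y. b y * f y" \<alpha>] by (simp add: v_def)
        qed
        then have "c * ?B \<le> enn2real (frac_maximal \<alpha> (\<lambda>y. b y * f y) y)"
          using fin c enn2real_mono[of "ennreal (c * ?B)"] by (simp add: mean_nonneg)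
        then have "c * ?B - c * b y \<le> - g y"
          using c by (simp add: gy M1 mult.commute)
        then have "c * (?B - b y) \<le> \<bar>g y\<bar>" by (simp add: algebra_simps)
        then show "?B - b y \<le> \<bar>g y\<bar> / c" using c by (simp add: field_simps)
      qed
    qed
    have igc: "set_integrable lebesgue ?Q (\<lambda>y. \<bar>g y\<bar> / c)" using ig by (rule set_integrable_divide)
    have mgc0: "mean ?Q (\<lambda>y. \<bar>g y\<bar> / c) = ?G / c"
      using mean_cmult[of ?Q "1 / c" "\<lambda>x. \<bar>g x\<bar>"] by simp
    have mg0: "0 \<le> ?G / c" using c by (simp add: mean_nonneg)
    have ci: "set_integrable lebesgue ?Q (\<lambda>y. k :: real)" for k by (rule set_integrable_const_cube)
    have "mean ?Q (\<lambda>y. ?B - b y) \<le> mean ?Q (\<lambda>y. \<bar>g y\<bar> / c)"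
      by (intro mean_mono_AE set_integral_diff ci ib igc ptw)
    then have 1: "?B - mean ?Q b \<le> ?G / c"
      by (simp add: mean_diff ci ib mean_const[OF l(1)] mgc0)
    define \<mu> where "\<mu> = mean ?Q b"
    have iabm: "set_integrable lebesgue ?Q (\<lambda>y. \<bar>b y - \<mu>\<bar>)"
      by (intro set_integrable_abs set_integral_diff ib ci)
    \<comment> \<open>Pointwise |b - \<mu>| is b - \<mu> plus twice the positive part of \<mu> - b,
      and \<mu> is at most the mean of |b|.\<close>
    have "mean ?Q (\<lambda>y. \<bar>b y - \<mu>\<bar>) \<le> mean ?Q (\<lambda>y. 2 * (\<bar>g y\<bar> / c) + (b y - \<mu>))"
    proof (intro mean_mono_AE iabm set_integral_add set_integral_diff set_integrable_mult_right igc ib ci)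
      show "AE y in lebesgue. y \<in> ?Q \<longrightarrow> \<bar>b y - \<mu>\<bar> \<le> 2 * (\<bar>g y\<bar> / c) + (b y - \<mu>)"
        using ptw
      proof eventually_elim
        case (elim y)
        have "0 \<le> \<bar>g y\<bar> / c" using c by simp
        then show ?case using elim mb unfolding \<mu>_def[symmetric] by auto
      qed
    qed
    also have "\<dots> = 2 * mean ?Q (\<lambda>y. \<bar>g y\<bar> / c) + (mean ?Q b - \<mu>)"
      using mean_add[OF set_integrable_mult_right[OF igc] set_integral_diff(1)[OF ib ci], of 2 \<mu>]
      unfolding mean_cmult mean_diff[OF ib ci] mean_const[OF l(1)] by simp
    finally have 2: "mean ?Q (\<lambda>y. \<bar>b y - \<mu>\<bar>) \<le> 2 * (?G / c)"
      by (simp add: \<mu>_def mgc0)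
    show ?thesis
      using 1 2 mgc mg0 unfolding \<mu>_def \<omega>_def by simp
  qed
  have "0 \<le> K" using Kr Kq by (simp add: K_def)
  with main show ?thesis by (intro exI[of _ K]) blast
qed

section \<open>Campanato's argument: from mean oscillation to a continuous representative\<close>

text \<open>The sup-norm ball of radius l/2, expressed through \<open>cube\<close> so that the rules
  for means apply.\<close>

definition ccube :: "real^'n \<Rightarrow> real \<Rightarrow> (real^'n) set" where
  "ccube x l = cube (\<chi> i. x $ i - l / 2) l"

lemma mem_ccube: "y \<in> ccube x l \<longleftrightarrow> (\<forall>i. \<bar>y $ i - x $ i\<bar> \<le> l / 2)"
proof -
  have "x $ i - l / 2 \<le> y $ i \<and> y $ i \<le> x $ i - l / 2 + l \<longleftrightarrow> \<bar>y $ i - x $ i\<bar> \<le> l / 2" for i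
    by arith
  then show ?thesis by (simp add: ccube_def mem_cube)
qed

lemma center_in_ccube: "0 \<le> l \<Longrightarrow> x \<in> ccube x l"
  by (simp add: mem_ccube)

lemma ccube_mono: "l \<le> l' \<Longrightarrow> ccube x l \<subseteq> ccube x l'"
  by (auto simp: mem_ccube) (meson order_trans)

lemma ccube_subset:
  assumes "norm (x - y) \<le> d" "l + 2 * d \<le> l'"
  shows "ccube y l \<subseteq> ccube x l'"
proof
  fix z assume z: "z \<in> ccube y l"
  show "z \<in> ccube x l'"
    unfolding mem_ccube
  proof
    fix i
    have "\<bar>x $ i - y $ i\<bar> \<le> norm (x - y)" using component_le_norm_cart[of "x - y" i] by simp
    moreover have "\<bar>z $ i - y $ i\<bar> \<le> l / 2" using z by (simp add: mem_ccube)
    ultimately show "\<bar>z $ i - x $ i\<bar> \<le> l' / 2" using assms by linarith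
  qed
qed

lemma cube_subset_ccube: "y \<in> cube a l \<Longrightarrow> cube a l \<subseteq> ccube y (2 * l)"
proof
  fix z assume "y \<in> cube a l" "z \<in> cube a l"
  then show "z \<in> ccube y (2 * l)" by (simp add: mem_ccube mem_cube abs_le_iff) (smt (verit))
qed

text \<open>Averaging b - \<mu> over the subcube costs at most the ratio of the volumes, which is at
  most c^n.\<close>

lemma mean_subcube_diff:
  fixes a a' :: "real^'n"
  assumes b: "\<And>a l. set_integrable lebesgue (cube a l) b"
    and sub: "cube a' l' \<subseteq> cube a l" and l: "0 < l'" "0 < l" and c: "l \<le> c * l'"
  shows "\<bar>mean (cube a' l') b - mean (cube a l) b\<bar> \<le> c ^ CARD('n) * mean (cube a l) (\<lambda>y. \<bar>b y - mean (cube a l) b\<bar>)"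
proof -
  let ?Q = "cube a l" and ?Q' = "cube a' l'"
  define \<mu> where "\<mu> = mean ?Q b"
  let ?h = "\<lambda>y. \<bar>b y - \<mu>\<bar>"
  have ci: "set_integrable lebesgue (cube a l) (\<lambda>y. k :: real)" for a l k by (rule set_integrable_const_cube)
  have bm: "set_integrable lebesgue (cube a l) (\<lambda>y. b y - \<mu>)" for a l by (intro set_integral_diff b ci)
  then have h: "set_integrable lebesgue (cube a l) ?h" for a l by (intro set_integrable_abs)
  have "mean ?Q' b - \<mu> = mean ?Q' (\<lambda>y. b y - \<mu>)"
    unfolding mean_diff[OF b ci] mean_const[OF l(1)] ..
  also have "\<bar>\<dots>\<bar> \<le> mean ?Q' ?h"
  proof -
    have "mean ?Q' (\<lambda>y. b y - \<mu>) \<le> mean ?Q' ?h" by (intro mean_mono bm h) auto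
    moreover have "mean ?Q' (\<lambda>y. - 1 * (b y - \<mu>)) \<le> mean ?Q' ?h"
      by (intro mean_mono set_integrable_mult_right bm h) auto
    ultimately show ?thesis unfolding mean_cmult by (simp add: abs_le_iff)
  qed
  also have "\<dots> \<le> c ^ CARD('n) * mean ?Q ?h"
  proof -
    have "(LINT y:?Q'|lebesgue. ?h y) \<le> (LINT y:?Q|lebesgue. ?h y)"
      unfolding set_lebesgue_integral_def
      by (intro integral_mono h[unfolded set_integrable_def]) (use sub in \<open>auto simp: indicator_def\<close>)
    also have "\<dots> = l ^ CARD('n) * mean ?Q ?h" using l by (simp add: mean_def content_cube)
    also have "\<dots> \<le> (c * l') ^ CARD('n) * mean ?Q ?h"
      using c l by (intro mult_right_mono power_mono mean_nonneg) auto
    finally show ?thesis using l by (simp add: mean_def[of ?Q'] content_cube divide_le_eq power_mult_distrib mult_ac)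
  qed
  finally show ?thesis by (simp add: \<mu>_def)
qed

text \<open>Takes the place of Lebesgue differentiation: tiling a fixed cube by cubes of side at
  most \<epsilon> bounds its integral by K * \<epsilon>^d times its volume, and \<epsilon> is
  arbitrary. The restriction 2 * l \<le> 1 leaves room for doubled cubes.\<close>

lemma AE_eq_of_local_means:
  fixes h :: "real^'n \<Rightarrow> real"
  assumes [measurable]: "h \<in> borel_measurable lebesgue" and h0: "\<And>x. 0 \<le> h x"
    and d: "0 < d" and K: "0 \<le> K"
    and le: "\<And>a l. 0 < l \<Longrightarrow> 2 * l \<le> 1 \<Longrightarrow> (\<integral>\<^sup>+ y \<in> cube a l. ennreal (h y) \<partial>lebesgue) \<le> ennreal (K * l powr d * l ^ CARD('n))"
  shows "AE x in lebesgue. h x = 0"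
proof -
  have zero: "(\<integral>\<^sup>+ y \<in> cube a0 l0. ennreal (h y) \<partial>lebesgue) = 0" if l0: "0 < l0" for a0 :: "real^'n" and l0
  proof -
    let ?Q = "cube a0 l0" and ?I = "\<integral>\<^sup>+ y \<in> cube a0 l0. ennreal (h y) \<partial>lebesgue"
    let ?D = "density lebesgue (\<lambda>x. ennreal (h x))"
    have bnd: "?I \<le> ennreal (K * \<epsilon> powr d * l0 ^ CARD('n))" if \<epsilon>: "0 < \<epsilon>" "2 * \<epsilon> \<le> 1" for \<epsilon>
    proof -
      have ne: "box a0 (\<chi> i. a0 $ i + l0) \<noteq> {}"
        using l0 by (auto simp: interval_ne_empty_cart)
      \<comment> \<open>Each tile lies in a ball of radius \<epsilon>/2, which forces its side to be
        at most \<epsilon>.\<close>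
      have gg: "gauge (\<lambda>x::real^'n. ball x (\<epsilon> / 2))" using \<epsilon> by (intro gauge_ball_dependent) auto
      obtain \<D> where D: "countable \<D>" "\<Union>\<D> \<subseteq> ?Q"
        "\<And>S. S \<in> \<D> \<Longrightarrow> interior S \<noteq> {} \<and> (\<exists>c d. S = cbox c d)"
        "pairwise (\<lambda>A B. interior A \<inter> interior B = {}) \<D>"
        "\<And>S. S \<in> \<D> \<Longrightarrow> \<exists>x \<in> ?Q \<inter> S. S \<subseteq> ball x (\<epsilon> / 2)"
        "\<And>u v. cbox u v \<in> \<D> \<Longrightarrow> \<exists>n. \<forall>i \<in> Basis. v \<bullet> i - u \<bullet> i = ((\<chi> i. a0 $ i + l0) \<bullet> i - a0 \<bullet> i) / 2^n"
        "?Q \<subseteq> \<Union>\<D>"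
        using covering_lemma[OF _ ne gg, of ?Q] unfolding cube_def by blast
      have cb: "\<exists>c l. 0 < l \<and> l \<le> \<epsilon> \<and> S = cube c l" if S: "S \<in> \<D>" for S
      proof -
        obtain u w where uw: "S = cbox u w" using D(3)[OF S] by blast
        then obtain n where n: "\<And>i. i \<in> Basis \<Longrightarrow> w \<bullet> i - u \<bullet> i = ((\<chi> i. a0 $ i + l0) \<bullet> i - a0 \<bullet> i) / 2^n"
          using D(6)[of u w] S by blast
        \<comment> \<open>The covering bisects all sides equally often, so the tiles of a cube are
          cubes again.\<close>
        define l where "l = l0 / 2 ^ n"
        have l: "0 < l" using l0 by (simp add: l_def)
        have wu: "w $ i - u $ i = l" for i
          using n[of "axis i 1"] by (simp add: axis_in_Basis_iff inner_axis l_def)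
        have "w = (\<chi> i. u $ i + l)" using wu by (simp add: vec_eq_iff) (metis add.commute diff_add_cancel)
        then have Sc: "S = cube u l" by (simp add: uw cube_def)
        obtain x where x: "S \<subseteq> ball x (\<epsilon> / 2)" using D(5)[OF S] by blast
        have "u \<in> S" "w \<in> S" using Sc l wu by (auto simp: mem_cube) (smt (verit))+
        then have "dist u w < \<epsilon>" using x dist_triangle_half_r[of x u \<epsilon> w] by (auto simp: subset_eq)
        moreover have "l \<le> norm (w - u)"
          using component_le_norm_cart[of "w - u" undefined] wu l by simp
        ultimately have "l \<le> \<epsilon>" by (simp add: dist_norm norm_minus_commute)
        with l Sc show ?thesis by blast
      qed
      have meas: "S \<in> sets lebesgue" if "S \<in> \<D>" for S using cb[OF that] by auto
      have "?I \<le> emeasure ?D (\<Union>S\<in>\<D>. S)"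
      proof -
        have U: "(\<Union>S\<in>\<D>. S) \<in> sets lebesgue" using D(1) meas by (intro sets.countable_UN'') auto
        have "?I \<le> (\<integral>\<^sup>+ y \<in> (\<Union>S\<in>\<D>. S). ennreal (h y) \<partial>lebesgue)"
        proof (rule nn_integral_mono)
          fix y
          have "y \<in> (\<Union>S\<in>\<D>. S)" if "y \<in> ?Q" using D(7) that by blast
          then show "ennreal (h y) * indicator ?Q y \<le> ennreal (h y) * indicator (\<Union>S\<in>\<D>. S) y"
            by (intro mult_left_mono) (simp_all add: indicator_def)
        qed
        also have "\<dots> = emeasure ?D (\<Union>S\<in>\<D>. S)"
          using U by (subst emeasure_density) auto
        finally show ?thesis .
      qed
      also have "\<dots> \<le> (\<integral>\<^sup>+ S. emeasure ?D S \<partial>count_space \<D>)"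
        using D(1) meas by (intro emeasure_countable_subadditive) auto
      also have "\<dots> \<le> (\<integral>\<^sup>+ S. ennreal (K * \<epsilon> powr d) * emeasure lebesgue (interior S) \<partial>count_space \<D>)"
      proof (intro nn_integral_mono)
        fix S assume "S \<in> space (count_space \<D>)"
        then have S: "S \<in> \<D>" by simp
        obtain c l where cl: "0 < l" "l \<le> \<epsilon>" "S = cube c l" using cb[OF S] by blast
        have "emeasure ?D S = (\<integral>\<^sup>+ y \<in> cube c l. ennreal (h y) \<partial>lebesgue)"
          using meas[OF S] cl by (subst emeasure_density) auto
        also have "\<dots> \<le> ennreal (K * l powr d * l ^ CARD('n))" using cl \<epsilon> by (intro le) auto
        also have "\<dots> \<le> ennreal (K * \<epsilon> powr d * l ^ CARD('n))"
          using cl d K by (intro ennreal_leI mult_right_mono mult_left_mono powr_mono2) auto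
        also have "\<dots> = ennreal (K * \<epsilon> powr d) * emeasure lebesgue (cube c l)"
          unfolding emeasure_cube[OF cl(1)] using K cl by (subst ennreal_mult[symmetric]) auto
        \<comment> \<open>Only the interiors of the tiles are disjoint, so the volumes are summed
          over interiors; the boundary has measure 0.\<close>
        also have "emeasure lebesgue (cube c l) = emeasure lebesgue (interior S)"
          unfolding cl(3) cube_def interior_cbox
          by (simp add: emeasure_lborel_box_eq emeasure_lborel_cbox_eq)
        finally show "emeasure ?D S \<le> ennreal (K * \<epsilon> powr d) * emeasure lebesgue (interior S)" .
      qed
      also have "\<dots> = ennreal (K * \<epsilon> powr d) * (\<integral>\<^sup>+ S. emeasure lebesgue (interior S) \<partial>count_space \<D>)"
        by (rule nn_integral_cmult) simp
      also have "(\<integral>\<^sup>+ S. emeasure lebesgue (interior S) \<partial>count_space \<D>) = emeasure lebesgue (\<Union>S\<in>\<D>. interior S)"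
        using D(1,4) by (intro emeasure_UN_countable[symmetric]) (auto simp: disjoint_family_on_def pairwise_def)
      also have "\<dots> \<le> emeasure lebesgue ?Q"
        by (rule emeasure_mono[OF _ sets_cube(1)]) (use D(2) interior_subset in blast)
      also have "\<dots> = ennreal (l0 ^ CARD('n))" by (rule emeasure_cube[OF l0])
      also have "ennreal (K * \<epsilon> powr d) * ennreal (l0 ^ CARD('n)) = ennreal (K * \<epsilon> powr d * l0 ^ CARD('n))"
        using K l0 by (intro ennreal_mult[symmetric]) auto
      finally show ?thesis by (simp add: mult_left_mono)
    qed
    have "((\<lambda>\<epsilon>. ennreal (K * \<epsilon> powr d * l0 ^ CARD('n))) \<longlongrightarrow> ennreal (K * 0 * l0 ^ CARD('n))) (at_right 0)"
      using d by (intro tendsto_ennrealI tendsto_intros tendsto_zero_powrI) (auto simp: eventually_at_right_less intro: eventually_at_right_less eventually_mono)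
    moreover have "\<forall>\<^sub>F \<epsilon> in at_right 0. ?I \<le> ennreal (K * \<epsilon> powr d * l0 ^ CARD('n))"
      unfolding eventually_at_right_field using bnd by (intro exI[of _ "1/2"]) auto
    ultimately have "?I \<le> ennreal (K * 0 * l0 ^ CARD('n))"
      by (intro tendsto_lowerbound[where F = "at_right 0"]) auto
    then show ?thesis by simp
  qed
  have "AE x in lebesgue. x \<in> ccube 0 (real (Suc k)) \<longrightarrow> h x = 0" for k
  proof -
    have "(\<integral>\<^sup>+ y \<in> ccube 0 (real (Suc k)). ennreal (h y) \<partial>lebesgue) = 0"
      unfolding ccube_def by (rule zero) simp
    then have "AE y in lebesgue. ennreal (h y) * indicator (ccube 0 (real (Suc k))) y = 0"
      by (subst (asm) nn_integral_0_iff_AE) (auto simp: ccube_def)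
    then show ?thesis
      by eventually_elim (use h0 in \<open>auto simp: indicator_def ennreal_eq_0_iff intro: antisym split: if_splits\<close>)
  qed
  then have "AE x in lebesgue. \<forall>k. x \<in> ccube 0 (real (Suc k)) \<longrightarrow> h x = 0"
    unfolding AE_all_countable by blast
  then show ?thesis
  proof eventually_elim
    case (elim x)
    obtain k where k: "2 * norm x \<le> real k" using real_arch_simple by blast
    have "x \<in> ccube 0 (real (Suc k))"
      unfolding mem_ccube
    proof
      fix i
      have "real k \<le> real (Suc k)" by simp
      then show "\<bar>x $ i - (0 :: real^'n) $ i\<bar> \<le> real (Suc k) / 2"
        using component_le_norm_cart[of x i] k by simp
    qed
    then show ?case using elim by blast
  qed
qed

text \<open>Means over concentric cubes form a Cauchy net whose limit is the desired representative.\<close>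

proposition campanato:
  fixes b :: "real^'n \<Rightarrow> real" and \<Omega> :: "real^'n \<Rightarrow> real \<Rightarrow> real"
  assumes b: "\<And>a l. set_integrable lebesgue (cube a l) b" and bmeas [measurable]: "b \<in> borel_measurable lebesgue"
    and osc: "\<And>a l x. 0 < l \<Longrightarrow> x \<in> cube a l \<Longrightarrow> mean (cube a l) (\<lambda>y. \<bar>b y - mean (cube a l) b\<bar>) \<le> K * \<Omega> x l"
    and K: "0 \<le> K" and \<Omega>0: "\<And>x l. 0 \<le> \<Omega> x l" and d: "0 < d"
    and dil: "\<And>x l \<mu>. 0 < l \<Longrightarrow> 0 < \<mu> \<Longrightarrow> \<mu> \<le> 1 \<Longrightarrow> \<Omega> x (\<mu> * l) \<le> \<mu> powr d * \<Omega> x l"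
    and cmp: "\<And>a l x y. 0 < l \<Longrightarrow> x \<in> cube a l \<Longrightarrow> y \<in> cube a l \<Longrightarrow> \<Omega> y l \<le> K' * \<Omega> x l"
    and K': "0 \<le> K'"
    and unif: "\<And>x. \<Omega> x 1 \<le> 1"
  shows "\<exists>b' K. (AE x in lebesgue. b x = b' x) \<and> 0 \<le> K \<and> (\<forall>x y. x \<noteq> y \<longrightarrow> \<bar>b' x - b' y\<bar> \<le> K * \<Omega> x (4 * norm (x - y)))"
proof -
  let ?N = "CARD('n)"
  define m where "m x l = mean (ccube x l) b" for x l
  define \<theta> where "\<theta> = (1 / 2 :: real) powr d"
  have \<theta>: "0 < \<theta>" "\<theta> < 1" using d powr_less_mono'[of "1/2::real" 0 d] by (auto simp: \<theta>_def)
  \<comment> \<open>The geometric series of the errors made by successive halvings, fixed by 2^n K +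
    K2 \<theta> = K2.\<close>
  define K2 where "K2 = 2 ^ ?N * K / (1 - \<theta>)"
  have K2: "0 \<le> K2" "2 ^ ?N * K + K2 * \<theta> = K2"
    using \<theta> K by (auto simp: K2_def field_simps)
  have step: "\<bar>mean (cube a' l') b - m x l\<bar> \<le> 2 ^ ?N * K * \<Omega> x l"
    if "cube a' l' \<subseteq> ccube x l" "0 < l'" "0 < l" "l \<le> 2 * l'" for a' l' x l
  proof -
    have "\<bar>mean (cube a' l') b - m x l\<bar> \<le> 2 ^ ?N * mean (ccube x l) (\<lambda>y. \<bar>b y - m x l\<bar>)"
      using mean_subcube_diff[OF b, of a' l' _ l 2] that unfolding m_def ccube_def by blast
    also have "\<dots> \<le> 2 ^ ?N * (K * \<Omega> x l)"
      unfolding m_def ccube_def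
      using that center_in_ccube[of l x] by (intro mult_left_mono osc) (auto simp: ccube_def)
    finally show ?thesis by simp
  qed
  \<comment> \<open>Induction on a bound for the number of halvings between \<open>l\<close> and
    \<open>l'\<close>. The last step has ratio at most 2 but need not be a halving, so arbitrary
    radii are covered.\<close>
  have chain: "0 < l' \<Longrightarrow> l' \<le> l \<Longrightarrow> l \<le> 2 ^ j * l' \<Longrightarrow> \<bar>m x l - m x l'\<bar> \<le> K2 * \<Omega> x l" for x l l' j
  proof (induction j arbitrary: l)
    case 0
    then have "l = l'" by simp
    then show ?case using K2 \<Omega>0 by simp
  next
    case (Suc j)
    have big: "2 ^ ?N * K * \<Omega> x l \<le> K2 * \<Omega> x l"
      using K2 mult_nonneg_nonneg[of K2 \<theta>] \<theta> \<Omega>0[of x l] by (intro mult_right_mono) linarith+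
    show ?case
    proof (cases "l \<le> 2 * l'")
      case True
      have "\<bar>m x l' - m x l\<bar> \<le> 2 ^ ?N * K * \<Omega> x l"
        unfolding m_def[of x l'] ccube_def[of x l']
        using True Suc.prems ccube_mono[of l' l x] by (intro step) (auto simp: ccube_def)
      then show ?thesis using big by (simp add: abs_minus_commute)
    next
      case False
      have 1: "\<bar>m x (l / 2) - m x l\<bar> \<le> 2 ^ ?N * K * \<Omega> x l"
        unfolding m_def[of x "l / 2"] ccube_def[of x "l / 2"]
        using False Suc.prems ccube_mono[of "l / 2" l x] by (intro step) (auto simp: ccube_def)
      have "\<bar>m x (l / 2) - m x l'\<bar> \<le> K2 * \<Omega> x (l / 2)"
        using False Suc.prems by (intro Suc.IH) auto
      also have "\<dots> \<le> K2 * (\<theta> * \<Omega> x l)"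
        using dil[of l "1 / 2" x] Suc.prems K2(1) by (intro mult_left_mono) (auto simp: \<theta>_def)
      finally have "\<bar>m x l - m x l'\<bar> \<le> (2 ^ ?N * K + K2 * \<theta>) * \<Omega> x l" using 1 by (simp add: algebra_simps)
      then show ?thesis by (simp only: K2(2))
    qed
  qed
  have chain': "\<bar>m x l - m x l'\<bar> \<le> K2 * \<Omega> x l" if "0 < l'" "l' \<le> l" for x l l'
  proof -
    obtain j where "l / l' < 2 ^ j" using real_arch_pow[of 2 "l / l'"] by auto
    then have "l \<le> 2 ^ j * l'" using that by (simp add: field_simps less_imp_le)
    then show ?thesis using chain that by blast
  qed
  \<comment> \<open>Dilation from side 1, where \<Omega> is at most 1, gives a bound uniform in
    \<open>x\<close>; convergence of the means and continuity of the limit rest on it.\<close>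
  have small: "\<Omega> x l \<le> l powr d" if "0 < l" "l \<le> 1" for x l
  proof -
    have "\<Omega> x (l * 1) \<le> l powr d * \<Omega> x 1" using that by (intro dil) auto
    also have "\<dots> \<le> l powr d * 1" using unif by (intro mult_left_mono) auto
    finally show ?thesis by simp
  qed
  define s where "s k = (1 / 2 :: real) ^ k" for k :: nat
  have s: "0 < s k" "s k \<le> 1" for k by (auto simp: s_def power_le_one)
  have s0: "s \<longlonglongrightarrow> 0" unfolding s_def by (intro LIMSEQ_power_zero) simp
  have sd0: "(\<lambda>k. K2 * s k powr d) \<longlonglongrightarrow> 0"
    using tendsto_mult_left[OF tendsto_zero_powrI[OF s0 tendsto_const _ d], of K2] s by (simp add: less_imp_le)
  have smono: "s j \<le> s i" if "i \<le> j" for i j using that by (auto simp: s_def intro: power_decreasing)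
  have conv: "convergent (\<lambda>k. m x (s k))" for x
  proof (rule Cauchy_convergent, rule metric_CauchyI)
    fix e :: real assume "0 < e"
    then have "\<forall>\<^sub>F k in sequentially. K2 * s k powr d < e / 2" by (intro order_tendstoD(2)[OF sd0]) simp
    then obtain M where M: "K2 * s M powr d < e / 2" by (auto simp: eventually_sequentially)
    have *: "\<bar>m x (s M) - m x (s i)\<bar> < e / 2" if "M \<le> i" for i
    proof -
      have "\<bar>m x (s M) - m x (s i)\<bar> \<le> K2 * \<Omega> x (s M)" by (rule chain'[OF s(1) smono[OF that]])
      also have "\<dots> \<le> K2 * s M powr d" using K2 s by (intro mult_left_mono small) auto
      finally show ?thesis using M by simp
    qed
    show "\<exists>M. \<forall>i\<ge>M. \<forall>j\<ge>M. dist (m x (s i)) (m x (s j)) < e"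
    proof (intro exI[of _ M] allI impI)
      fix i j assume "M \<le> i" "M \<le> j"
      then show "dist (m x (s i)) (m x (s j)) < e" using *[of i] *[of j] unfolding dist_real_def by linarith
    qed
  qed
  define b' where "b' x = lim (\<lambda>k. m x (s k))" for x
  have b'lim: "(\<lambda>k. m x (s k)) \<longlonglongrightarrow> b' x" for x using conv[of x] by (simp add: b'_def convergent_LIMSEQ_iff)
  have b'm: "\<bar>m x l - b' x\<bar> \<le> K2 * \<Omega> x l" if "0 < l" for x l
  proof (rule tendsto_upperbound[OF tendsto_rabs[OF tendsto_diff[OF tendsto_const b'lim]]])
    have "\<forall>\<^sub>F k in sequentially. s k < l" by (rule order_tendstoD(2)[OF s0 that])
    then show "\<forall>\<^sub>F k in sequentially. \<bar>m x l - m x (s k)\<bar> \<le> K2 * \<Omega> x l"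
      by eventually_elim (use s in \<open>auto intro: chain'\<close>)
  qed simp
  define K3 where "K3 = K2 + 2 ^ ?N * K + K2 * K'"
  have K3: "0 \<le> K3" using K K2 K' by (simp add: K3_def)
  have lip: "\<bar>b' x - b' y\<bar> \<le> K3 * \<Omega> x (4 * norm (x - y))" if "x \<noteq> y" for x y
  proof -
    \<comment> \<open>The cube of side 2t around \<open>y\<close> lies in the cube of side 4t around
      \<open>x\<close>, which gives the chain b' x, m x (4t), m y (2t), b' y.\<close>
    define t where "t = norm (x - y)"
    have t: "0 < t" using that by (simp add: t_def)
    have sub: "ccube y (2 * t) \<subseteq> ccube x (4 * t)" by (rule ccube_subset[of _ _ t]) (auto simp: t_def)
    have 1: "\<bar>m x (4 * t) - b' x\<bar> \<le> K2 * \<Omega> x (4 * t)" using t by (intro b'm) simp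
    have 2: "\<bar>m y (2 * t) - b' y\<bar> \<le> K2 * \<Omega> y (2 * t)" using t by (intro b'm) simp
    have "\<Omega> y (1 / 2 * (4 * t)) \<le> (1 / 2) powr d * \<Omega> y (4 * t)" using t by (intro dil) auto
    also have "\<dots> \<le> 1 * \<Omega> y (4 * t)" using \<theta> \<Omega>0 by (intro mult_right_mono) (auto simp: \<theta>_def)
    also have "\<dots> \<le> K' * \<Omega> x (4 * t)" unfolding mult_1
    proof (rule cmp)
      show "x \<in> cube (\<chi> i. x $ i - 4 * t / 2) (4 * t)" "y \<in> cube (\<chi> i. x $ i - 4 * t / 2) (4 * t)"
        using center_in_ccube[of "4 * t" x] center_in_ccube[of "2 * t" y] sub t by (auto simp: ccube_def)
    qed (use t in simp)
    finally have "K2 * \<Omega> y (2 * t) \<le> K2 * (K' * \<Omega> x (4 * t))" using K2 by (intro mult_left_mono) auto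
    moreover have "\<bar>m y (2 * t) - m x (4 * t)\<bar> \<le> 2 ^ ?N * K * \<Omega> x (4 * t)"
      unfolding m_def[of y] ccube_def[of y] using t sub by (intro step) (auto simp: ccube_def)
    ultimately have "\<bar>b' x - b' y\<bar> \<le> K2 * \<Omega> x (4 * t) + 2 ^ ?N * K * \<Omega> x (4 * t) + K2 * (K' * \<Omega> x (4 * t))"
      using 1 2 by linarith
    also have "\<dots> = K3 * \<Omega> x (4 * t)" by (simp add: K3_def algebra_simps)
    finally show ?thesis by (simp add: t_def)
  qed
  \<comment> \<open>Continuity makes the limit \<open>b'\<close> measurable and integrable on cubes,
    so that it can be compared with \<open>b\<close> in the mean.\<close>
  have "isCont b' x" for x
    unfolding isCont_def
  proof (rule LIM_zero_cancel, rule Lim_null_comparison)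
    have "\<forall>\<^sub>F y in at x. y \<noteq> x" by (simp add: eventually_at_filter)
    moreover have "((\<lambda>y. 4 * norm (x - y)) \<longlongrightarrow> 4 * norm (x - x)) (at x)" by (intro tendsto_intros)
    then have "\<forall>\<^sub>F y in at x. 4 * norm (x - y) < 1" by (rule order_tendstoD(2)) simp
    ultimately show "\<forall>\<^sub>F y in at x. norm (b' y - b' x) \<le> K3 * (4 * norm (x - y)) powr d"
    proof eventually_elim
      case (elim y)
      have "\<bar>b' x - b' y\<bar> \<le> K3 * \<Omega> x (4 * norm (x - y))" using elim by (intro lip) auto
      also have "\<dots> \<le> K3 * (4 * norm (x - y)) powr d" using elim K3 by (intro mult_left_mono small) auto
      finally show ?case by (simp add: abs_minus_commute)
    qed
    have "((\<lambda>y. K3 * (4 * norm (x - y)) powr d) \<longlongrightarrow> K3 * (4 * norm (x - x)) powr d) (at x)"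
      using d by (intro tendsto_intros) auto
    then show "((\<lambda>y. K3 * (4 * norm (x - y)) powr d) \<longlongrightarrow> 0) (at x)" using d by simp
  qed
  then have b'cont: "continuous_on S b'" for S by (simp add: continuous_at_imp_continuous_on)
  note [measurable] = continuous_imp_lebesgue_measurable[OF b'cont]
  \<comment> \<open>\<open>K\<close> bounds the mean of |b - \<mu>|, 2^n K compares \<mu> with the
    mean over the doubled cube around \<open>y\<close>, and \<open>K2\<close> compares that mean
    with b' y. The factor 2^d stems from doubling the side.\<close>
  define K4 where "K4 = (K + (2 ^ ?N * K + K2)) * 2 powr d"
  have "AE x in lebesgue. \<bar>b x - b' x\<bar> = 0"
  proof (rule AE_eq_of_local_means[OF _ _ d, of _ K4])
    show "0 \<le> K4" using K K2 by (simp add: K4_def)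
    fix a :: "real^'n" and l :: real assume l: "0 < l" "2 * l \<le> 1"
    let ?Q = "cube a l"
    define \<mu> where "\<mu> = mean ?Q b"
    have ci: "set_integrable lebesgue ?Q (\<lambda>y. k :: real)" for k by (rule set_integrable_const_cube)
    have ib': "set_integrable lebesgue ?Q b'" unfolding cube_def by (rule absolutely_integrable_continuous[OF b'cont])
    have ibm: "set_integrable lebesgue ?Q (\<lambda>y. \<bar>b y - \<mu>\<bar>)" by (intro set_integrable_abs set_integral_diff b ci)
    have ibb: "set_integrable lebesgue ?Q (\<lambda>y. \<bar>b y - b' y\<bar>)" by (intro set_integrable_abs set_integral_diff b ib')
    have "\<bar>b y - b' y\<bar> \<le> \<bar>b y - \<mu>\<bar> + (2 ^ ?N * K + K2) * (2 * l) powr d" if y: "y \<in> ?Q" for y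
    proof -
      have "\<bar>m y (2 * l) - b' y\<bar> \<le> K2 * \<Omega> y (2 * l)" using l by (intro b'm) simp
      moreover have "\<bar>\<mu> - m y (2 * l)\<bar> \<le> 2 ^ ?N * K * \<Omega> y (2 * l)"
        unfolding \<mu>_def using l cube_subset_ccube[OF y] by (intro step) auto
      moreover have "(2 ^ ?N * K + K2) * \<Omega> y (2 * l) \<le> (2 ^ ?N * K + K2) * (2 * l) powr d"
        using l K K2 by (intro mult_left_mono small) auto
      ultimately show ?thesis by (simp add: algebra_simps)
    qed
    then have "mean ?Q (\<lambda>y. \<bar>b y - b' y\<bar>) \<le> mean ?Q (\<lambda>y. \<bar>b y - \<mu>\<bar> + (2 ^ ?N * K + K2) * (2 * l) powr d)"
      by (intro mean_mono ibb set_integral_add ibm ci)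
    also have "\<dots> = mean ?Q (\<lambda>y. \<bar>b y - \<mu>\<bar>) + (2 ^ ?N * K + K2) * (2 * l) powr d"
      unfolding mean_add[OF ibm ci] mean_const[OF l(1)] ..
    also have "\<dots> \<le> K * (2 * l) powr d + (2 ^ ?N * K + K2) * (2 * l) powr d"
    proof -
      have "mean ?Q (\<lambda>y. \<bar>b y - \<mu>\<bar>) \<le> K * \<Omega> a l"
        unfolding \<mu>_def using l by (intro osc corner_in_cube) auto
      also have "\<dots> \<le> K * l powr d" using K l by (intro mult_left_mono small) auto
      also have "\<dots> \<le> K * (2 * l) powr d" using K l d by (intro mult_left_mono powr_mono2) auto
      finally show ?thesis by simp
    qed
    also have "\<dots> = K4 * l powr d" by (simp add: K4_def powr_mult algebra_simps)
    finally have "l ^ ?N * mean ?Q (\<lambda>y. \<bar>b y - b' y\<bar>) \<le> K4 * l powr d * l ^ ?N"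
      using l by (simp add: mult.commute mult_left_mono)
    then show "(\<integral>\<^sup>+ y \<in> ?Q. ennreal \<bar>b y - b' y\<bar> \<partial>lebesgue) \<le> ennreal (K4 * l powr d * l ^ ?N)"
      by (subst set_nn_integral_eq_mean[OF ibb _ l(1)]) (auto intro: ennreal_leI)
  qed auto
  then have "AE x in lebesgue. b x = b' x" by eventually_elim simp
  then show ?thesis using lip K3 by blast
qed

section \<open>Regularity of the data and the equivalence\<close>

lemma locally_integrable_measurable:
  fixes b :: "real^'n \<Rightarrow> real"
  assumes "\<And>a l. set_integrable lebesgue (cube a l) b"
  shows "b \<in> borel_measurable lebesgue"
proof (rule borel_measurable_LIMSEQ_real)
  show "(\<lambda>x. indicator (ccube 0 (real k)) x *\<^sub>R b x) \<in> borel_measurable lebesgue" for k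
    using assms unfolding ccube_def set_integrable_def by blast
  fix x :: "real^'n"
  obtain k0 where k0: "2 * norm x \<le> real k0" using real_arch_simple by blast
  have "x \<in> ccube 0 (real k)" if "k0 \<le> k" for k
    unfolding mem_ccube
  proof
    fix i
    have "real k0 \<le> real k" using that by simp
    then show "\<bar>x $ i - (0 :: real^'n) $ i\<bar> \<le> real k / 2"
      using component_le_norm_cart[of x i] k0 by simp
  qed
  then have "\<forall>\<^sub>F k in sequentially. indicator (ccube 0 (real k)) x *\<^sub>R b x = b x"
    unfolding eventually_sequentially by (intro exI[of _ k0]) auto
  then show "(\<lambda>k. indicator (ccube 0 (real k)) x *\<^sub>R b x) \<longlonglongrightarrow> b x"
    by (rule tendsto_eventually)
qed

text \<open>The logarithm in the local condition tends to infinity as the points merge, which forces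
  the oscillation to 0.\<close>

lemma log_holder_continuous:
  fixes p :: "real^'n \<Rightarrow> real"
  assumes "log_holder p L C"
  shows "continuous_on S p"
proof -
  have "isCont p x" for x
    unfolding isCont_def
  proof (rule LIM_zero_cancel, rule Lim_null_comparison)
    show "\<forall>\<^sub>F y in at x. norm (p y - p x) \<le> C / ln (exp 1 + inverse (norm (x - y)))"
    proof (intro always_eventually allI)
      fix y
      have "\<bar>p x - p y\<bar> * ln (exp 1 + inverse (norm (x - y))) \<le> C"
        using assms by (simp add: log_holder_def inverse_eq_divide)
      then show "norm (p y - p x) \<le> C / ln (exp 1 + inverse (norm (x - y)))"
        using ln_exp_1_plus_pos[of "inverse (norm (x - y))"] by (simp add: pos_le_divide_eq abs_minus_commute)
    qed
    have "((\<lambda>y. norm (x - y)) \<longlongrightarrow> norm (x - x)) (at x)" by (intro tendsto_intros)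
    moreover have "\<forall>\<^sub>F y in at x. 0 < norm (x - y)" by (simp add: eventually_at_filter)
    ultimately have "LIM y at x. inverse (norm (x - y)) :> at_top"
      by (intro filterlim_inverse_at_top) simp_all
    then show "((\<lambda>y. C / ln (exp 1 + inverse (norm (x - y)))) \<longlongrightarrow> 0) (at x)"
      by (intro real_tendsto_divide_at_top[OF tendsto_const] filterlim_compose[OF ln_at_top]
          filterlim_tendsto_add_at_top[OF tendsto_const])
  qed
  then show ?thesis by (simp add: continuous_at_imp_continuous_on)
qed

text \<open>By continuity the exceptional set is open, and a nonempty open set is not null. This
  turns p \<ge> p_infinity into an inequality at every point.\<close>

lemma AE_ge_imp_ge:
  fixes p :: "real^'n \<Rightarrow> real"
  assumes "continuous_on UNIV p" "AE x in lebesgue. c \<le> p x"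
  shows "c \<le> p x"
proof (rule ccontr)
  assume "\<not> c \<le> p x"
  then have "{x. p x < c} \<noteq> {}" by (auto simp: not_le)
  moreover have "open {x. p x < c}"
    using assms(1) by (intro open_Collect_less continuous_intros)
  moreover have "negligible {x. p x < c}"
    using assms(2) by (simp add: eventually_ae_filter negligible_iff_null_sets not_le)
      (metis (no_types, lifting) Collect_mono completion.complete2 null_sets_completion_subset not_le)
  ultimately show False using open_not_negligible by blast
qed

lemma mean_cong_AE:
  assumes "set_integrable lebesgue Q f" "set_integrable lebesgue Q g" "AE y in lebesgue. f y = g y"
  shows "mean Q f = mean Q g"
  using assms by (intro antisym mean_mono_AE) auto

text \<open>Identification modulo null sets appears as the representative \<open>b'\<close>. It is
  compatible with the other side, since the maximal functions only see integrals and the value of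
  the commutator is prescribed almost everywhere.\<close>

theorem theorem3p3:
  fixes \<alpha> \<beta> :: real and \<delta> p q r b :: "real^'n \<Rightarrow> real"
  assumes "0 \<le> \<alpha>" and "\<alpha> < real CARD('n)"
    and "\<And>x. 0 < \<delta> x \<and> \<delta> x < real CARD('n)"
    and "p \<in> log_exponent" and "q \<in> log_exponent" and "r \<in> log_exponent"
    and "1 < \<beta>" and "\<beta> < (INF x. p x)"
    and "0 < (INF x. \<delta> x)"
    and "(SUP x. r x * (\<alpha> + \<delta> x)) < real CARD('n)"
    and "limit_exponent r * (SUP x. \<alpha> + \<delta> x) < real CARD('n)"
    and "AE x in lebesgue. limit_exponent p \<le> p x"
    and "1 / \<beta> + 1 / (SUP x. conj_exponent p x) > 1"
    and "\<And>x. 1 / \<beta> - 1 / p x = \<delta> x / real CARD('n)"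
    and "\<And>x. \<delta> x / real CARD('n) = 1 / r x - \<alpha> / real CARD('n) - 1 / q x"
    and "locally_integrable b"
  shows "(\<exists>b'. (AE x in lebesgue. b x = b' x) \<and> b' \<in> var_Lipschitz \<delta> \<and> (\<forall>x. 0 \<le> b' x))
    \<longleftrightarrow> bounded_operator r q (commutator b \<alpha>)"
proof
  assume "\<exists>b'. (AE x in lebesgue. b x = b' x) \<and> b' \<in> var_Lipschitz \<delta> \<and> (\<forall>x. 0 \<le> b' x)"
  then obtain b' where "AE x in lebesgue. b x = b' x" "b' \<in> var_Lipschitz \<delta>" "\<And>x. 0 \<le> b' x" by blast
  then show "bounded_operator r q (commutator b \<alpha>)"
    using commutator_bounded[OF assms(1,3,6) log_exponentD(1)[OF assms(5)] assms(11,15)] by blast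
next
  assume bd: "bounded_operator r q (commutator b \<alpha>)"
  let ?N = "real CARD('n)"
  note \<delta> = assms(3)
  note pv = var_exponentD[OF log_exponentD(1)[OF assms(4)]]
  have N: "1 \<le> ?N" "0 < ?N" by (simp_all add: Suc_leI)
  define Lp where "Lp = limit_exponent p"
  \<comment> \<open>The limit of \<delta> at infinity, read off from 1/\<beta> - 1/p =
    \<delta>/n.\<close>
  define d where "d = ?N * (1 / \<beta> - 1 / Lp)"
  define d0 where "d0 = (INF x. \<delta> x)"
  have \<delta>p: "\<delta> x = ?N * (1 / \<beta> - 1 / p x)" for x using assms(14)[of x] N by (simp add: field_simps)
  have gt1: "1 < limit_exponent u" if "u \<in> log_exponent" for u :: "real^'n \<Rightarrow> real"
    using log_exponentD(4)[OF that] var_exponentD(3)[OF log_exponentD(1)[OF that]] by simp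
  have Lp: "1 < Lp" unfolding Lp_def by (rule gt1[OF assms(4)])
  obtain C where lh: "log_holder p Lp C" using log_exponentD(3)[OF assms(4)] by (auto simp: Lp_def)
  have pge: "Lp \<le> p x" for x
    using AE_ge_imp_ge[OF log_holder_continuous[OF lh] assms(12)] by (simp add: Lp_def)
  \<comment> \<open>Here p \<ge> p_infinity enters: it is what later lets a bound by l^d on large
    cubes be weakened to l^\<delta>(x).\<close>
  have \<delta>d: "d \<le> \<delta> x" for x
    unfolding d_def \<delta>p using pge[of x] Lp by (intro mult_left_mono diff_left_mono divide_left_mono) auto
  have d0: "0 < d0" using assms(9) by (simp add: d0_def)
  have \<delta>d0: "d0 \<le> \<delta> x" for x
    unfolding d0_def using \<delta> by (intro cINF_lower bdd_belowI[of _ 0]) (auto simp: less_imp_le)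
  have nt: "\<not> trivial_limit (at_infinity :: (real^'n) filter)" by (rule trivial_limit_at_infinity)
  have lim1: "(\<delta> \<longlongrightarrow> d) at_infinity"
    unfolding \<delta>p[abs_def] d_def using log_exponentD(2)[OF assms(4)] Lp by (intro tendsto_intros) (auto simp: Lp_def)
  have dd0: "d0 \<le> d" by (rule tendsto_lowerbound[OF lim1]) (auto simp: \<delta>d0 nt)
  have eqL: "d / ?N = 1 / limit_exponent r - \<alpha> / ?N - 1 / limit_exponent q"
  proof (rule tendsto_unique[OF nt])
    show "((\<lambda>x. \<delta> x / ?N) \<longlongrightarrow> d / ?N) at_infinity" using lim1 by (intro tendsto_intros) auto
    show "((\<lambda>x. \<delta> x / ?N) \<longlongrightarrow> 1 / limit_exponent r - \<alpha> / ?N - 1 / limit_exponent q) at_infinity"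
      unfolding assms(15) using log_exponentD(2)[OF assms(5)] log_exponentD(2)[OF assms(6)] gt1[OF assms(5)] gt1[OF assms(6)]
      by (intro tendsto_intros) auto
  qed
  \<comment> \<open>\<delta> inherits log-Hoelder continuity from \<open>p\<close>, because t
    \<mapsto> 1/t is Lipschitz with constant 1 on (1, infinity).\<close>
  have lh\<delta>: "log_holder \<delta> d (?N * C)"
  proof -
    let ?d = "\<lambda>t. ?N * (1 / \<beta> - 1 / t)"
    have inv: "\<bar>1 / s - 1 / t\<bar> \<le> \<bar>s - t\<bar>" if "1 < s" "1 < t" for s t :: real
    proof -
      have "1 * 1 \<le> s * t" using that by (intro mult_mono) auto
      moreover have "1 / s - 1 / t = (t - s) / (s * t)" using that by (simp add: field_simps)
      ultimately show ?thesis
        by (simp add: abs_divide abs_minus_commute divide_le_eq mult_le_cancel_left1)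
    qed
    have *: "\<bar>?d s - ?d t\<bar> * w \<le> ?N * C"
      if "1 < s" "1 < t" "\<bar>s - t\<bar> * w \<le> C" "0 \<le> w" for s t w
    proof -
      have "\<bar>?d s - ?d t\<bar> = ?N * \<bar>1 / s - 1 / t\<bar>"
        by (simp add: right_diff_distrib[symmetric] abs_mult abs_minus_commute)
      also have "\<dots> \<le> ?N * \<bar>s - t\<bar>" using inv[OF that(1,2)] by (intro mult_left_mono) auto
      finally have "\<bar>?d s - ?d t\<bar> * w \<le> ?N * \<bar>s - t\<bar> * w"
        using that(4) by (rule mult_right_mono)
      also have "\<dots> \<le> ?N * C" unfolding mult.assoc using that(3) by (intro mult_left_mono) auto
      finally show ?thesis .
    qed
    show ?thesis
      using lh pv(2) Lp unfolding log_holder_def \<delta>p d_def by (intro conjI allI * less_imp_le[OF ln_exp_1_plus_pos]) auto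
  qed
  have NC: "0 \<le> ?N * C" by (rule log_holder_nonneg[OF lh\<delta>])
  have ib: "set_integrable lebesgue (cube a l) b" for a l
    using assms(16) compact_cube[of a l] by (simp add: locally_integrable_def)
  have bmeas [measurable]: "b \<in> borel_measurable lebesgue" by (rule locally_integrable_measurable[OF ib])
  obtain K where K: "0 \<le> K" "\<And>a l x. 0 < l \<Longrightarrow> x \<in> cube a l \<Longrightarrow>
    mean (cube a l) (\<lambda>y. \<bar>b y - mean (cube a l) b\<bar>) \<le> K * l powr scale_exponent \<delta> d x l"
    "\<And>a l x. 0 < l \<Longrightarrow> x \<in> cube a l \<Longrightarrow>
    mean (cube a l) (\<lambda>y. \<bar>b y\<bar>) - mean (cube a l) b \<le> K * l powr scale_exponent \<delta> d x l"
    using mean_oscillation[OF assms(1,2,6,5,15) eqL ib bd] by blast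
  define \<Omega> where "\<Omega> x l = l powr scale_exponent \<delta> d x l" for x l
  define K' where "K' = exp ((ln ?N + 1) * (?N * C))"
  have K': "1 \<le> K'" using N NC by (simp add: K'_def)
  have \<Omega>le: "\<Omega> x l \<le> l powr \<delta> x" for x l
    unfolding \<Omega>_def scale_exponent_def using \<delta>d[of x] by (auto intro: powr_mono)
  have "\<exists>b' K. (AE x in lebesgue. b x = b' x) \<and> 0 \<le> K \<and> (\<forall>x y. x \<noteq> y \<longrightarrow> \<bar>b' x - b' y\<bar> \<le> K * \<Omega> x (4 * norm (x - y)))"
  proof (rule campanato[OF ib bmeas _ K(1) _ d0])
    show "mean (cube a l) (\<lambda>y. \<bar>b y - mean (cube a l) b\<bar>) \<le> K * \<Omega> x l" if "0 < l" "x \<in> cube a l" for a l x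
      unfolding \<Omega>_def by (rule K(2)[OF that])
    show "0 \<le> \<Omega> x l" "\<Omega> x 1 \<le> 1" for x l by (simp_all add: \<Omega>_def)
    show "0 \<le> K'" using K' by simp
    show "\<Omega> x (\<mu> * l) \<le> \<mu> powr d0 * \<Omega> x l" if l: "0 < l" "0 < \<mu>" "\<mu> \<le> 1" for x l \<mu>
    proof -
      have mu: "\<mu> powr e \<le> \<mu> powr d0" if "d0 \<le> e" for e using l that by (intro powr_mono') auto
      have ml: "\<mu> * l \<le> l" using l by (simp add: mult_le_cancel_right1)
      \<comment> \<open>Only the last case changes the exponent: the shrunken side is at most 1, and
        there d \<le> \<delta>(x) makes the power with \<delta>(x) the smaller one.\<close>
      consider "l \<le> 1" | "1 < l" "1 < \<mu> * l" | "1 < l" "\<mu> * l \<le> 1" by linarith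
      then have "\<Omega> x (\<mu> * l) \<le> \<mu> powr (if l \<le> 1 then \<delta> x else d) * \<Omega> x l"
      proof cases
        case 1
        then show ?thesis using ml by (simp add: \<Omega>_def scale_exponent_def powr_mult)
      next
        case 2
        then show ?thesis by (simp add: \<Omega>_def scale_exponent_def powr_mult)
      next
        case 3
        then have "\<Omega> x (\<mu> * l) \<le> (\<mu> * l) powr d"
          using l \<delta>d[of x] by (simp add: \<Omega>_def scale_exponent_def powr_mono')
        then show ?thesis using 3 by (simp add: \<Omega>_def scale_exponent_def powr_mult)
      qed
      also have "\<dots> \<le> \<mu> powr d0 * \<Omega> x l"
        using mu \<delta>d0[of x] dd0 by (intro mult_right_mono) (auto simp: \<Omega>_def)
      finally show ?thesis .
    qed
    show "\<Omega> y l \<le> K' * \<Omega> x l" if l: "0 < l" "x \<in> cube a l" "y \<in> cube a l" for a l x y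
    proof (cases "l \<le> 1")
      case True
      have "l powr \<delta> y = l powr (\<delta> y - \<delta> x) * l powr \<delta> x" using l by (simp add: powr_add[symmetric])
      also have "l powr (\<delta> y - \<delta> x) \<le> l powr (- \<bar>\<delta> x - \<delta> y\<bar>)" using l True by (intro powr_mono') auto
      also have "\<dots> = (1 / l) powr \<bar>\<delta> x - \<delta> y\<bar>" using l by (simp add: powr_minus_divide powr_divide)
      also have "\<dots> \<le> K'" unfolding K'_def using log_holder_local[OF lh\<delta> l(1) True N(1) norm_cube[OF l(2,3)]] .
      finally show ?thesis using True by (simp add: \<Omega>_def scale_exponent_def mult_right_mono)
    next
      case False
      then show ?thesis using K' by (simp add: \<Omega>_def scale_exponent_def mult_le_cancel_right1)
    qed
  qed
  then obtain b' K3 where b': "AE x in lebesgue. b x = b' x" and K3: "0 \<le> K3"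
    "\<And>x y. x \<noteq> y \<Longrightarrow> \<bar>b' x - b' y\<bar> \<le> K3 * \<Omega> x (4 * norm (x - y))" by blast
  have Lip: "b' \<in> var_Lipschitz \<delta>"
    unfolding var_Lipschitz_def
  proof (intro CollectI exI[of _ "K3 * 4 powr ?N"] allI)
    fix x y
    show "\<bar>b' x - b' y\<bar> \<le> K3 * 4 powr ?N * norm (x - y) powr \<delta> x"
    proof (cases "x = y")
      case False
      have "\<bar>b' x - b' y\<bar> \<le> K3 * \<Omega> x (4 * norm (x - y))" by (rule K3(2)[OF False])
      also have "\<dots> \<le> K3 * (4 * norm (x - y)) powr \<delta> x" by (intro mult_left_mono K3(1) \<Omega>le)
      also have "\<dots> = K3 * (4 powr \<delta> x * norm (x - y) powr \<delta> x)" by (simp add: powr_mult)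
      also have "\<dots> \<le> K3 * (4 powr ?N * norm (x - y) powr \<delta> x)"
        using \<delta>[of x] by (intro mult_left_mono mult_right_mono powr_mono K3(1)) auto
      finally show ?thesis by (simp add: mult.assoc)
    qed (use K3 in simp)
  qed
  have cont: "continuous_on S b'" for S
    using var_Lipschitz_continuous[OF Lip] \<delta> continuous_on_subset by blast
  have ib': "set_integrable lebesgue (cube a l) b'" for a l
    unfolding cube_def by (rule absolutely_integrable_continuous[OF cont])
  have "0 \<le> b' x" for x
  \<comment> \<open>Around a point with b' x = -c < 0, continuity keeps |b'| - b' at least
    \<open>c\<close> on small cubes, whereas the gap between the means of |b| and \<open>b\<close>
    is at most K l^\<delta>(x), which tends to 0 with the side.\<close>
  proof (rule ccontr)
    assume "\<not> 0 \<le> b' x"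
    define c where "c = - b' x"
    have c: "0 < c" using \<open>\<not> 0 \<le> b' x\<close> by (simp add: c_def)
    obtain e where e: "0 < e" "\<And>y. dist y x < e \<Longrightarrow> dist (b' y) (b' x) < c / 2"
      using cont[of UNIV] c unfolding continuous_on_iff by (metis UNIV_I half_gt_zero)
    have t0: "((\<lambda>l. K * l powr \<delta> x) \<longlongrightarrow> K * 0) (at_right 0)"
      using \<delta>[of x] by (intro tendsto_intros tendsto_zero_powrI) (auto simp: eventually_at_right_less intro: eventually_mono[OF eventually_at_right_less])
    have "\<forall>\<^sub>F l in at_right 0. K * l powr \<delta> x < c"
      using order_tendstoD(2)[OF t0, of c] c by simp
    moreover have "\<forall>\<^sub>F l in at_right 0. (0::real) < l \<and> l < min 1 (e / ?N)"
      unfolding eventually_at_right_field using e(1) N by (intro exI[of _ "min 1 (e / ?N)"]) auto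
    ultimately have "\<forall>\<^sub>F l in at_right 0. K * l powr \<delta> x < c \<and> (0::real) < l \<and> l < min 1 (e / ?N)"
      by (rule eventually_conj)
    then obtain l where l: "K * l powr \<delta> x < c" "0 < l" "l < 1" "l < e / ?N"
      using eventually_happens'[of "at_right (0::real)"] by auto
    let ?Q = "cube x l"
    have xQ: "x \<in> ?Q" using l by (intro corner_in_cube) simp
    have iab: "set_integrable lebesgue ?Q (\<lambda>y. \<bar>b y\<bar>)" "set_integrable lebesgue ?Q (\<lambda>y. \<bar>b' y\<bar>)"
      by (intro set_integrable_abs ib ib')+
    have "c = mean ?Q (\<lambda>y. c)" by (simp add: mean_const[OF l(2)])
    also have "\<dots> \<le> mean ?Q (\<lambda>y. \<bar>b' y\<bar> - b' y)"
    proof (intro mean_mono set_integral_diff set_integrable_const_cube iab ib')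
      fix y assume "y \<in> ?Q"
      then have "norm (y - x) \<le> ?N * l" using xQ by (rule norm_cube)
      also have "\<dots> < e" using l(4) N by (simp add: field_simps)
      finally have "dist (b' y) (b' x) < c / 2" by (intro e(2)) (simp add: dist_norm)
      then show "c \<le> \<bar>b' y\<bar> - b' y" by (simp add: dist_real_def c_def)
    qed
    also have "\<dots> = mean ?Q (\<lambda>y. \<bar>b' y\<bar>) - mean ?Q b'" by (rule mean_diff[OF iab(2) ib'])
    also have "mean ?Q (\<lambda>y. \<bar>b' y\<bar>) = mean ?Q (\<lambda>y. \<bar>b y\<bar>)"
      using b' by (intro mean_cong_AE iab) auto
    also have "mean ?Q b' = mean ?Q b"
      using b' by (intro mean_cong_AE ib ib') auto
    also have "mean ?Q (\<lambda>y. \<bar>b y\<bar>) - mean ?Q b \<le> K * l powr \<delta> x"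
      using K(3)[OF l(2) xQ] l(3) by (simp add: scale_exponent_def)
    finally show False using l(1) by simp
  qed
  then show "\<exists>b'. (AE x in lebesgue. b x = b' x) \<and> b' \<in> var_Lipschitz \<delta> \<and> (\<forall>x. 0 \<le> b' x)"
    using b' Lip by blast
qed

end
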